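(* Let $H$ be a separable Hilbert space, let $A$ be a commutative $C^*$-algebra, and let $t\in \mathrm{L}_A(C_0(\widehat{A},H))$ be an adjointable operator. Then $t\in\mathrm{L}^1_A(C_0(\widehat{A},H))$ if and only if the function $x\mapsto t_x$ lies in $C_0(\widehat{A},\mathrm{L}^1(H))$.
   Context: $A$ is a commutative $C^*$-algebra with spectrum $\widehat A$, so $A\cong C_0(\widehat A)$; $\mathrm M(A)$ is its multiplier algebra. Hilbert modules are right modules, with $A$-valued inner products $A$-linear in the right-hand argument; $\mathrm{L}_A$ denotes adjointable operators. $C_0(\widehat A,H)$ is a Hilbert $A$-module with pointwise module action and inner product $\langle f|g\rangle(x)=\langle f(x)|g(x)\rangle_H$. **Localisation.** Each $t\in \mathrm{L}_A(C_0(\widehat A,H))$ induces, for each $x\in\widehat A$, a bounded operator $t_x$ on $H$, determined by $(t\xi)(x)=t_x(\xi(x))$ for all $\xi\in C_0(\widehat A,H)$. **Multipliers and frames.** For a Hilbert $A$-module $F$, $\mathrm M(F):=\mathrm{L}_A(A,F)$, a Hilbert $\mathrm M(A)$-module with $\langle r|s\rangle=r^*s\in \mathrm{L}_A(A)=\mathrm M(A)$; $F\subseteq \mathrm M(F)$ via $\xi\mapsto (a\mapsto\xi a)$, and $t\in \mathrm{L}_A(F)$ acts on $\mathrm M(F)$ by $t(r)=t\circ r$. A frame of multipliers for $F$ is a sequence $(\beta_i)_{i\in\mathbb N}$ in $\mathrm M(F)$ with $\langle\xi|\eta\rangle=\sum_{i=1}^\infty\langle\xi|\beta_i\rangle\langle\beta_i|\eta\rangle$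 for all $\xi,\eta\in F$, converging in the norm of $A$. For example, if $(\epsilon_i)$ is an orthonormal basis of $H$, then the multipliers $\widetilde{\epsilon_i}:A\to C_0(\widehat A,H)$, $\widetilde{\epsilon_i}(a)(x)=a(x)\epsilon_i$, form a frame of multipliers for $C_0(\widehat A,H)$. **Trace-class operators.** For a Hilbert $A$-module $F$ admitting a frame of multipliers and $t\in \mathrm{L}_A(F)$ positive, $\mathrm{trace}(t):=\sum_{i=1}^\infty\langle\beta_i|t\beta_i\rangle$, where $(\beta_i)$ is a frame of multipliers; it is said to be defined in $A$ if the series converges in the norm of $\mathrm M(A)$ to an element of $A$ (both this and the value are known to be independent of the choice of frame of multipliers). An operator $t\in \mathrm{L}_A(F)$ is of trace class if $\mathrm{trace}(|t|)$ is defined in $A$; $\mathrm{L}^1_A(F)$ is the set of trace-class operators on $F$. $\mathrm{L}^1(H)$ is the Banach space of trace-class operators on the Hilbert space $H$, with norm $t\mapsto\mathrm{trace}(|t|)$, and $C_0(\widehat A,\mathrm{L}^1(H))$ is the space of continuous functions vanishing at infinity with respect to that norm. *)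

theory Defs
  imports "HOL-Analysis.Analysis"
begin

section \<open>Complex Hilbert spaces and C*-algebras\<close>

class complex_vector = real_vector +
  fixes scaleC :: "complex \<Rightarrow> 'a \<Rightarrow> 'a" (infixr "*\<^sub>C" 75)
  assumes scaleC_add_right: "c *\<^sub>C (x + y) = c *\<^sub>C x + c *\<^sub>C y"
    and scaleC_add_left: "(c + d) *\<^sub>C x = c *\<^sub>C x + d *\<^sub>C x"
    and scaleC_scaleC: "c *\<^sub>C (d *\<^sub>C x) = (c * d) *\<^sub>C x"
    and scaleC_one: "1 *\<^sub>C x = x"
    and scaleR_eq_scaleC: "r *\<^sub>R x = complex_of_real r *\<^sub>C x"

text \<open>Inner products are linear in the right-hand argument.\<close>

class complex_hilbert_space = complex_vector + real_normed_vector + complete_space +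
  fixes cinner :: "'a \<Rightarrow> 'a \<Rightarrow> complex"
  assumes cinner_commute: "cinner x y = cnj (cinner y x)"
    and cinner_add_right: "cinner x (y + z) = cinner x y + cinner x z"
    and cinner_scaleC_right: "cinner x (c *\<^sub>C y) = c * cinner x y"
    and cinner_self: "cinner x x = complex_of_real ((norm x)\<^sup>2)"

text \<open>C*-algebras need not be unital.\<close>

class cstar_algebra = complex_vector + real_normed_algebra + complete_space +
  fixes star :: "'a \<Rightarrow> 'a"
  assumes scaleC_mult_left: "(c *\<^sub>C x) * y = c *\<^sub>C (x * y)"
    and scaleC_mult_right: "x * (c *\<^sub>C y) = c *\<^sub>C (x * y)"
    and norm_scaleC: "norm (c *\<^sub>C x) = cmod c * norm x"
    and star_star: "star (star x) = x"
    and star_add: "star (x + y) = star x + star y"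
    and star_scaleC: "star (c *\<^sub>C x) = cnj c *\<^sub>C star x"
    and star_mult: "star (x * y) = star y * star x"
    and cstar_identity: "norm (star x * x) = (norm x)\<^sup>2"

class comm_cstar_algebra = cstar_algebra + comm_ring

text \<open>The spectrum is the set of characters. Its topology is the subspace topology inherited from
  the library topology on functions, which is that of pointwise convergence.\<close>

definition spectrum :: "('a::comm_cstar_algebra \<Rightarrow> complex) set" where
  "spectrum = {\<phi>. (\<forall>a b. \<phi> (a + b) = \<phi> a + \<phi> b) \<and> (\<forall>c a. \<phi> (c *\<^sub>C a) = c * \<phi> a) \<and>
     (\<forall>a b. \<phi> (a * b) = \<phi> a * \<phi> b) \<and> (\<exists>a. \<phi> a \<noteq> 0)}"

text \<open>\<open>C0 X V \<nu>\<close> is \<open>C\<^sub>0(X, V)\<close> where \<open>V\<close> carries the norm \<open>\<nu>\<close>. The norm is a parameter because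
  the trace norm is not the norm of a type. Functions are \<open>undefined\<close> outside \<open>X\<close>.\<close>

definition C0 :: "'x::topological_space set \<Rightarrow> 'v::minus set \<Rightarrow> ('v \<Rightarrow> real) \<Rightarrow> ('x \<Rightarrow> 'v) set" where
  "C0 X V \<nu> = {f \<in> X \<rightarrow>\<^sub>E V.
     (\<forall>x\<in>X. ((\<lambda>y. \<nu> (f y - f x)) \<longlongrightarrow> 0) (at x within X)) \<and>
     (\<forall>e>0. \<exists>K. K \<subseteq> X \<and> compact K \<and> (\<forall>x\<in>X - K. \<nu> (f x) < e))}"


section \<open>Hilbert modules and adjointable operators\<close>

record ('f, 'a) hmodule =
  mcarrier :: "'f set"
  mact :: "'f \<Rightarrow> 'a \<Rightarrow> 'f"
  mip :: "'f \<Rightarrow> 'f \<Rightarrow> 'a"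

text \<open>The algebra as a module over itself.\<close>

definition alg_module :: "('a::cstar_algebra, 'a) hmodule" where
  "alg_module = \<lparr>mcarrier = UNIV, mact = (*), mip = (\<lambda>a b. star a * b)\<rparr>"

text \<open>By Gelfand duality, the pointwise inner product of two elements of this module is the transform
  of exactly one element of the algebra.\<close>

definition C0_module ::
  "(('a::comm_cstar_algebra \<Rightarrow> complex) \<Rightarrow> 'h::complex_hilbert_space, 'a) hmodule" where
  "C0_module = \<lparr>mcarrier = C0 spectrum UNIV norm,
     mact = (\<lambda>f a. \<lambda>\<phi>\<in>spectrum. \<phi> a *\<^sub>C f \<phi>),
     mip = (\<lambda>f g. THE a. \<forall>\<phi>\<in>spectrum. \<phi> a = cinner (f \<phi>) (g \<phi>))\<rparr>"

text \<open>A Hilbert space as a Hilbert module over the complex numbers; its adjointable operators are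
  its bounded linear operators.\<close>

definition hilbert_module :: "('h::complex_hilbert_space, complex) hmodule" where
  "hilbert_module = \<lparr>mcarrier = UNIV, mact = (\<lambda>v c. c *\<^sub>C v), mip = cinner\<rparr>"

text \<open>Adjointable maps are automatically module maps and bounded.\<close>

definition is_adjoint ::
  "('e, 'a) hmodule \<Rightarrow> ('f, 'a) hmodule \<Rightarrow> ('e \<Rightarrow> 'f) \<Rightarrow> ('f \<Rightarrow> 'e) \<Rightarrow> bool" where
  "is_adjoint E F t s \<longleftrightarrow> s \<in> mcarrier F \<rightarrow>\<^sub>E mcarrier E \<and>
     (\<forall>\<xi>\<in>mcarrier E. \<forall>\<eta>\<in>mcarrier F. mip F (t \<xi>) \<eta> = mip E \<xi> (s \<eta>))"

definition adjointable :: "('e, 'a) hmodule \<Rightarrow> ('f, 'a) hmodule \<Rightarrow> ('e \<Rightarrow> 'f) set" where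
  "adjointable E F = {t \<in> mcarrier E \<rightarrow>\<^sub>E mcarrier F. \<exists>s. is_adjoint E F t s}"

definition adj :: "('e, 'a) hmodule \<Rightarrow> ('f, 'a) hmodule \<Rightarrow> ('e \<Rightarrow> 'f) \<Rightarrow> 'f \<Rightarrow> 'e" where
  "adj E F t = (THE s. is_adjoint E F t s)"

text \<open>Positivity and the absolute value \<open>(t\<^sup>*t)\<^sup>1\<^sup>/\<^sup>2\<close> are those of the C*-algebra of adjointable operators.\<close>

definition positive_ops :: "('f, 'a) hmodule \<Rightarrow> ('f \<Rightarrow> 'f) set" where
  "positive_ops F = {compose (mcarrier F) (adj F F s) s | s. s \<in> adjointable F F}"

definition abs_op :: "('f, 'a) hmodule \<Rightarrow> ('f \<Rightarrow> 'f) \<Rightarrow> 'f \<Rightarrow> 'f" where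
  "abs_op F t = (THE p. p \<in> positive_ops F \<and>
     compose (mcarrier F) p p = compose (mcarrier F) (adj F F t) t)"


section \<open>Multipliers, frames and trace-class operators\<close>

definition multipliers :: "('f, 'a::cstar_algebra) hmodule \<Rightarrow> ('a \<Rightarrow> 'f) set" where
  "multipliers F = adjointable alg_module F"

definition multiplier_ip ::
  "('f, 'a::cstar_algebra) hmodule \<Rightarrow> ('a \<Rightarrow> 'f) \<Rightarrow> ('a \<Rightarrow> 'f) \<Rightarrow> 'a \<Rightarrow> 'a" where
  "multiplier_ip F r s = adj alg_module F r \<circ> s"

text \<open>The inclusion of a module in its multipliers. For the algebra itself it is isometric for the
  operator norm.\<close>

definition to_multiplier :: "('f, 'a) hmodule \<Rightarrow> 'f \<Rightarrow> 'a \<Rightarrow> 'f" where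
  "to_multiplier F \<xi> = (\<lambda>a. mact F \<xi> a)"

text \<open>The series of multipliers \<open>m\<close> of the algebra converges to the element \<open>b\<close> of the algebra, in
  the norm of the multiplier algebra.\<close>

definition multiplier_sums :: "(nat \<Rightarrow> 'a \<Rightarrow> 'a) \<Rightarrow> 'a::cstar_algebra \<Rightarrow> bool" where
  "multiplier_sums m b \<longleftrightarrow>
     (\<lambda>n. onorm (\<lambda>a. (\<Sum>i<n. m i a) - to_multiplier alg_module b a)) \<longlonglongrightarrow> 0"

definition frame_of_multipliers ::
  "('f, 'a::cstar_algebra) hmodule \<Rightarrow> (nat \<Rightarrow> 'a \<Rightarrow> 'f) \<Rightarrow> bool" where
  "frame_of_multipliers F \<beta> \<longleftrightarrow> (\<forall>i. \<beta> i \<in> multipliers F) \<and>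
     (\<forall>\<xi>\<in>mcarrier F. \<forall>\<eta>\<in>mcarrier F.
        multiplier_sums
          (\<lambda>i. multiplier_ip F (to_multiplier F \<xi>) (\<beta> i) \<circ> multiplier_ip F (\<beta> i) (to_multiplier F \<eta>))
          (mip F \<xi> \<eta>))"

text \<open>The trace of the positive operator \<open>t\<close> is defined in the algebra, with value \<open>b\<close>. Neither
  fact depends on the choice of the frame.\<close>

definition has_trace :: "('f, 'a::cstar_algebra) hmodule \<Rightarrow> ('f \<Rightarrow> 'f) \<Rightarrow> 'a \<Rightarrow> bool" where
  "has_trace F t b \<longleftrightarrow> (\<exists>\<beta>. frame_of_multipliers F \<beta> \<and>
     multiplier_sums (\<lambda>i. multiplier_ip F (\<beta> i) (t \<circ> \<beta> i)) b)"

definition trace_class_ops :: "('f, 'a::cstar_algebra) hmodule \<Rightarrow> ('f \<Rightarrow> 'f) set" where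
  "trace_class_ops F = {t \<in> adjointable F F. \<exists>b. has_trace F (abs_op F t) b}"


section \<open>Trace-class operators on a Hilbert space\<close>

definition bounded_op :: "('h::complex_hilbert_space \<Rightarrow> 'h) \<Rightarrow> bool" where
  "bounded_op T \<longleftrightarrow> bounded_linear T \<and> (\<forall>c v. T (c *\<^sub>C v) = c *\<^sub>C T v)"

text \<open>Orthonormal bases as maximal orthonormal sets.\<close>

definition orthonormal_basis :: "'h::complex_hilbert_space set \<Rightarrow> bool" where
  "orthonormal_basis B \<longleftrightarrow> (\<forall>e\<in>B. \<forall>f\<in>B. cinner e f = (if e = f then 1 else 0)) \<and>
     (\<forall>v. (\<forall>e\<in>B. cinner e v = 0) \<longrightarrow> v = 0)"

text \<open>Summability and the value of the trace do not depend on the orthonormal basis.\<close>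

definition some_basis :: "'h::complex_hilbert_space set" where
  "some_basis = (SOME B. orthonormal_basis B)"

definition L1 :: "('h::complex_hilbert_space \<Rightarrow> 'h) set" where
  "L1 = {T. bounded_op T \<and> (\<lambda>e. cinner e (abs_op hilbert_module T e)) summable_on some_basis}"

definition trace_norm :: "('h::complex_hilbert_space \<Rightarrow> 'h) \<Rightarrow> real" where
  "trace_norm T = Re (\<Sum>\<^sub>\<infinity>e\<in>some_basis. cinner e (abs_op hilbert_module T e))"


section \<open>Localisation\<close>

definition localise ::
  "((('a::comm_cstar_algebra \<Rightarrow> complex) \<Rightarrow> 'h::complex_hilbert_space) \<Rightarrow> (('a \<Rightarrow> complex) \<Rightarrow> 'h)) \<Rightarrow>
   ('a \<Rightarrow> complex) \<Rightarrow> 'h \<Rightarrow> 'h" where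
  "localise t x = (THE T. bounded_op T \<and> (\<forall>\<xi>\<in>C0 spectrum UNIV norm. t \<xi> x = T (\<xi> x)))"

end

(* The idea: by Gelfand duality A = C_0(spectrum), so an adjointable t is a strongly continuous family of
   operators t_x on H, bounded by the uniform boundedness principle, and |t| is the family |t_x|. A frame of
   multipliers is at each point a Parseval frame of H, and along any Parseval frame sum <b_i, |t_x| b_i> is
   the trace norm of t_x. So a trace b in A has b(x) = trace_norm t_x, and this function lies in C_0.
   Conversely, if the trace norm of t_x is in C_0, Dini's theorem on the one-point compactification makes the series
   over an orthonormal basis converge uniformly. What remains is that continuity of the trace norm of t_x
   forces x |-> t_x to be continuous in the trace norm: for the first n basis vectors this is strong continuity, and
   |tr W t (1 - P_n)| <= (tr |t|)^(1/2) (tr (1 - P_n) |t| (1 - P_n))^(1/2) bounds the rest by tails of the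
   trace, which are continuous in x. *)

theory Submission
  imports Defs
begin

section \<open>Gelfand duality\<close>

text \<open>The algebra may lack a unit and \<open>spectrum\<close> is just a set of functionals, so
  Gelfand duality is built by elementary means: a power-multiplicative seminorm that is minimal in a
  suitable class is multiplicative, hence the modulus of a character, and the zero functional serves
  as the point at infinity. Three devices shape the rest. Operators travel with their adjoints: an
  adjoint pair is linear by itself, and adjoints are all that the module speaks of. Square roots
  come from an iteration whose rate of convergence does not depend on the operator; this makes |t_x|
  as continuous in x as t_x. The polar part of T is replaced by the contractions T (p + e)^-1 with p
  = |T|, whose error, a multiple of e, disappears in finite sums. Absolute values do not behave well
  under sums of operators. The trace norm is therefore estimated by duality, through the sums of |<W
  e_i, T e_i>| for contractions W, which are subadditive in T; the triangle inequality and the split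
  into head and tail both come from this.\<close>

lemma scaleC_zero_left [simp]: "(0::complex) *\<^sub>C x = (0::'a::complex_vector)"
  by (metis add_cancel_right_right scaleC_add_left)

lemma scaleC_zero_right [simp]: "c *\<^sub>C (0::'a::complex_vector) = 0"
  by (metis add_cancel_right_right scaleC_add_right)

lemma scaleC_minus_left: "(- c) *\<^sub>C x = - (c *\<^sub>C (x::'a::complex_vector))"
  by (metis add.inverse_unique add.right_inverse scaleC_add_left scaleC_zero_left)

lemma scaleC_minus_right: "c *\<^sub>C (- x) = - (c *\<^sub>C (x::'a::complex_vector))"
  by (metis add.inverse_unique add.right_inverse scaleC_add_right scaleC_zero_right)

lemma scaleC_diff_right: "c *\<^sub>C (x - y) = c *\<^sub>C x - c *\<^sub>C (y::'a::complex_vector)"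
  by (metis scaleC_add_right scaleC_minus_right uminus_add_conv_diff add.commute)

declare scaleC_one [simp] scaleC_scaleC [simp]

instance comm_cstar_algebra \<subseteq> banach ..
instance complex_hilbert_space \<subseteq> banach ..

subsection \<open>Power-multiplicative seminorms\<close>

text \<open>The moduli of characters are such seminorms, and by
  \<open>exists_character_of_seminorm\<close> every multiplicative one that is not zero is the
  modulus of a character.\<close>

definition pm_seminorm :: "('a::comm_cstar_algebra \<Rightarrow> real) \<Rightarrow> bool" where
  "pm_seminorm p \<longleftrightarrow> (\<forall>x y. p (x + y) \<le> p x + p y) \<and> (\<forall>c x. p (c *\<^sub>C x) = cmod c * p x) \<and>
     (\<forall>x y. p (x * y) \<le> p x * p y) \<and> (\<forall>x. p (x * x) = (p x)\<^sup>2) \<and> (\<forall>x. p x \<le> norm x)"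

lemma pm_seminormD:
  assumes "pm_seminorm p"
  shows "p (x + y) \<le> p x + p y" "p (c *\<^sub>C x) = cmod c * p x" "p (x * y) \<le> p x * p y"
    "p (x * x) = (p x)\<^sup>2" "p x \<le> norm x"
  using assms by (auto simp: pm_seminorm_def)

lemma pm_seminorm_zero: "pm_seminorm p \<Longrightarrow> p 0 = 0"
  by (metis mult_eq_0_iff norm_zero pm_seminormD(2) scaleC_zero_left)

lemma pm_seminorm_minus: "pm_seminorm p \<Longrightarrow> p (- x) = p x"
  by (metis mult.left_neutral norm_minus_cancel norm_one pm_seminormD(2) scaleC_minus_left scaleC_one)

lemma pm_seminorm_nonneg: "pm_seminorm p \<Longrightarrow> 0 \<le> p x"
  using pm_seminormD(1)[of p x "- x"] pm_seminorm_zero[of p] pm_seminorm_minus[of p x] by simp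

text \<open>By commutativity \<open>star (x * x) * (x * x)\<close> is \<open>star h * h\<close> for
  h = \<open>star x * x\<close>, so the C*-identity applies a second time.\<close>

lemma pm_seminorm_norm: "pm_seminorm (norm :: 'a::comm_cstar_algebra \<Rightarrow> real)"
proof -
  have "norm (x * x) = (norm x)\<^sup>2" for x :: 'a
  proof -
    have "(norm (x * x))\<^sup>2 = norm (star (x * x) * (x * x))" by (simp add: cstar_identity)
    also have "\<dots> = norm (star (star x * x) * (star x * x))"
      by (simp add: star_mult star_star ac_simps)
    also have "\<dots> = ((norm x)\<^sup>2)\<^sup>2" by (simp add: cstar_identity)
    finally show ?thesis by (rule power2_eq_imp_eq) auto
  qed
  then show ?thesis
    by (auto simp: pm_seminorm_def norm_triangle_ineq norm_scaleC norm_mult_ineq)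
qed

text \<open>This is x b^n. Without a unit there is no b^0, so a starting element is multiplied
  repeatedly instead of forming powers.\<close>

definition mult_iter :: "'a::comm_cstar_algebra \<Rightarrow> nat \<Rightarrow> 'a \<Rightarrow> 'a" where
  "mult_iter b n x = ((\<lambda>y. y * b) ^^ n) x"

lemma mult_iter_simps [simp]: "mult_iter b 0 x = x" "mult_iter b (Suc n) x = mult_iter b n x * b"
  by (simp_all add: mult_iter_def)

lemma mult_iter_mult: "mult_iter b n x * y = mult_iter b n (x * y)"
  by (induction n) (auto simp: ac_simps)

lemma mult_iter_mult_iter: "mult_iter b n x * mult_iter b m y = mult_iter b (n + m) (x * y)"
proof (induction n)
  case 0
  then show ?case by (metis mult_iter_mult mult_iter_simps(1) add_0 mult.commute)
next
  case (Suc n)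
  have "mult_iter b (Suc n) x * mult_iter b m y = (mult_iter b n x * mult_iter b m y) * b"
    by (simp add: ac_simps)
  then show ?case using Suc by simp
qed

lemma mult_iter_add: "mult_iter b n (x + y) = mult_iter b n x + mult_iter b n y"
  by (induction n) (auto simp: algebra_simps)

lemma mult_iter_scaleC: "mult_iter b n (c *\<^sub>C x) = c *\<^sub>C mult_iter b n x"
  by (induction n) (auto simp: scaleC_mult_left)

text \<open>Passing to this limit turns multiplication by b into exact scaling by
  \<open>p b\<close>, while the seminorm can only decrease. For \<open>p b > 0\<close> the sequence
  is decreasing, so that the limit exists.\<close>

definition smoothing :: "('a::comm_cstar_algebra \<Rightarrow> real) \<Rightarrow> 'a \<Rightarrow> 'a \<Rightarrow> real" where
  "smoothing p b x = lim (\<lambda>n. p (mult_iter b n x) / p b ^ n)"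

context
  fixes p :: "'a::comm_cstar_algebra \<Rightarrow> real" and b :: 'a
  assumes p: "pm_seminorm p" and b: "p b > 0"
begin

lemma smoothing_step: "p (mult_iter b (Suc n) x) / p b ^ Suc n \<le> p (mult_iter b n x) / p b ^ n"
  using pm_seminormD(3)[OF p, of "mult_iter b n x" b] b by (simp add: field_simps)

lemma smoothing_decseq: "decseq (\<lambda>n. p (mult_iter b n x) / p b ^ n)"
  using smoothing_step by (rule decseq_SucI)

lemma smoothing_tendsto: "(\<lambda>n. p (mult_iter b n x) / p b ^ n) \<longlonglongrightarrow> smoothing p b x"
proof -
  have "bdd_below (range (\<lambda>n. p (mult_iter b n x) / p b ^ n))"
    using b pm_seminorm_nonneg[OF p] by (intro bdd_belowI[of _ 0]) auto
  then have "convergent (\<lambda>n. p (mult_iter b n x) / p b ^ n)"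
    using LIMSEQ_decseq_INF[OF _ smoothing_decseq] convergentI by blast
  then show ?thesis unfolding smoothing_def by (simp add: convergent_LIMSEQ_iff)
qed

lemma smoothing_le: "smoothing p b x \<le> p x"
  using decseq_ge[OF smoothing_decseq smoothing_tendsto, of x 0] by simp

lemma smoothing_times: "smoothing p b (x * b) = smoothing p b x * p b"
proof -
  have "mult_iter b n (x * b) = mult_iter b (Suc n) x" for n
    by (metis mult_iter_mult mult_iter_simps(2))
  then have "p (mult_iter b n (x * b)) / p b ^ n = p (mult_iter b (Suc n) x) / p b ^ Suc n * p b" for n
    using b by simp
  then have "(\<lambda>n. p (mult_iter b n (x * b)) / p b ^ n) \<longlonglongrightarrow> smoothing p b x * p b"
    using tendsto_mult_right[OF LIMSEQ_Suc[OF smoothing_tendsto[of x]], of "p b"] by presburger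
  then show ?thesis using smoothing_tendsto LIMSEQ_unique by blast
qed

text \<open>For n = 2^k - 1 the iterate is the 2^k-th power of b, on which repeated squaring is
  exact. A decreasing sequence that keeps returning to its initial value is constant.\<close>

lemma smoothing_self: "smoothing p b b = p b"
proof -
  have e: "p (mult_iter b (2 ^ k - 1) b) / p b ^ (2 ^ k - 1) = p b" for k
  proof (induction k)
    case (Suc k)
    have 1: "Suc (2 ^ k - 1 + (2 ^ k - 1)) = 2 ^ Suc k - (1::nat)"
      using one_le_power[of "2::nat" k] unfolding power_Suc mult_2 by linarith
    have "mult_iter b (2 ^ Suc k - 1) b = mult_iter b (2 ^ k - 1) b * mult_iter b (2 ^ k - 1) b"
      unfolding mult_iter_mult_iter 1[symmetric] by (simp add: mult_iter_mult)
    then have "p (mult_iter b (2 ^ Suc k - 1) b) = (p b * p b ^ (2 ^ k - 1))\<^sup>2"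
      using Suc b pm_seminormD(4)[OF p] by (simp add: field_simps)
    also have "\<dots> = p b * p b ^ (2 ^ Suc k - 1)"
      by (subst 1[symmetric]) (simp only: power_Suc power_add power2_eq_square mult.assoc mult.left_commute)
    finally show ?case using b by simp
  qed simp
  have "p (mult_iter b n b) / p b ^ n = p b" for n
  proof -
    have "n \<le> 2 ^ n - 1" using less_exp[of n] by linarith
    then have "p b \<le> p (mult_iter b n b) / p b ^ n"
      using decseqD[OF smoothing_decseq, of n "2 ^ n - 1" b] e[of n] by simp
    moreover have "p (mult_iter b n b) / p b ^ n \<le> p b"
      using decseqD[OF smoothing_decseq, of 0 n b] by simp
    ultimately show ?thesis by simp
  qed
  then show ?thesis using LIMSEQ_unique[OF smoothing_tendsto[of b], of "p b"] by simp
qed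

lemma pm_seminorm_smoothing: "pm_seminorm (smoothing p b)"
  unfolding pm_seminorm_def
proof (intro conjI allI)
  fix x y :: 'a and c :: complex
  have d: "strict_mono (\<lambda>n::nat. 2 * n)" by (simp add: strict_mono_def)
  \<comment> \<open>Along even indices products split evenly: (x y) b^(2n) = (x b^n) (y
    b^n).\<close>
  have lim2: "(\<lambda>n. p (mult_iter b (2*n) z) / p b ^ (2*n)) \<longlonglongrightarrow> smoothing p b z" for z
    using LIMSEQ_subseq_LIMSEQ[OF smoothing_tendsto d] by (simp add: o_def)
  have mm: "mult_iter b (2*n) (x * y) = mult_iter b n x * mult_iter b n y" for n x y
    by (simp add: mult_iter_mult_iter mult_2)
  have "p (mult_iter b n (x + y)) / p b ^ n \<le> p (mult_iter b n x) / p b ^ n + p (mult_iter b n y) / p b ^ n" for n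
    using pm_seminormD(1)[OF p, of "mult_iter b n x" "mult_iter b n y"] b
    by (simp add: mult_iter_add divide_right_mono flip: add_divide_distrib)
  then show "smoothing p b (x + y) \<le> smoothing p b x + smoothing p b y"
    by (intro LIMSEQ_le[OF smoothing_tendsto tendsto_add[OF smoothing_tendsto smoothing_tendsto]]) auto
  have "(\<lambda>n. p (mult_iter b n (c *\<^sub>C x)) / p b ^ n) \<longlonglongrightarrow> cmod c * smoothing p b x"
    using tendsto_mult_left[OF smoothing_tendsto, of "cmod c" x]
    by (simp add: mult_iter_scaleC pm_seminormD(2)[OF p])
  then show "smoothing p b (c *\<^sub>C x) = cmod c * smoothing p b x"
    using smoothing_tendsto LIMSEQ_unique by blast
  have "p (mult_iter b (2*n) (x * y)) / p b ^ (2*n) \<le> p (mult_iter b n x) / p b ^ n * (p (mult_iter b n y) / p b ^ n)" for n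
    using pm_seminormD(3)[OF p, of "mult_iter b n x" "mult_iter b n y"] b unfolding mm
    by (simp add: mult_2 power_add divide_right_mono)
  then show "smoothing p b (x * y) \<le> smoothing p b x * smoothing p b y"
    by (intro LIMSEQ_le[OF lim2 tendsto_mult[OF smoothing_tendsto smoothing_tendsto]]) auto
  have "p (mult_iter b (2*n) (x * x)) / p b ^ (2*n) = (p (mult_iter b n x) / p b ^ n)\<^sup>2" for n
    using pm_seminormD(4)[OF p, of "mult_iter b n x"] b unfolding mm
    by (simp add: power_divide mult.commute flip: power_mult)
  then have "(\<lambda>n. p (mult_iter b (2*n) (x * x)) / p b ^ (2*n)) \<longlonglongrightarrow> (smoothing p b x)\<^sup>2"
    using tendsto_power[OF smoothing_tendsto, of x 2] by simp
  then show "smoothing p b (x * x) = (smoothing p b x)\<^sup>2"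
    using lim2 LIMSEQ_unique by blast
  show "smoothing p b x \<le> norm x"
    using smoothing_le pm_seminormD(5)[OF p] order_trans by blast
qed

end

text \<open>A minimal element among the power-multiplicative seminorms for which multiplication by \<open>a\<close>
  scales by \<open>norm a\<close> agrees with all its smoothings.\<close>

lemma exists_multiplicative_seminorm:
  fixes a :: "'a::comm_cstar_algebra"
  assumes a: "a \<noteq> 0"
  obtains p where "pm_seminorm p" "p a = norm a" "\<And>x y. p (x * y) = p x * p y"
proof -
  \<comment> \<open>The last condition is what lets the value at \<open>a\<close> survive smoothing
    at another b: it makes p (b^n a) equal to p (b^n) times norm a.\<close>
  define A where "A = {p::'a \<Rightarrow> real. pm_seminorm p \<and> p a = norm a \<and> (\<forall>x. p (x * a) = p x * norm a)}"
  have na: "norm a > 0" using a by simp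
  have ne: "smoothing norm a \<in> A"
    using na by (simp add: A_def pm_seminorm_smoothing[OF pm_seminorm_norm] smoothing_self[OF pm_seminorm_norm]
        smoothing_times[OF pm_seminorm_norm])
  have "\<exists>m\<in>A. \<forall>q\<in>A. q \<le> m \<longrightarrow> q = m"
  proof (rule predicate_Zorn)
    show "partial_order_on A (relation_of (\<lambda>x y. y \<le> x) A)"
      by (rule partial_order_on_relation_ofI) auto
    fix C assume C: "C \<in> Chains (relation_of (\<lambda>x y. y \<le> x) A)"
    then have CA: "C \<subseteq> A" by (rule Chains_relation_of)
    have tot: "p \<le> q \<or> q \<le> p" if "p \<in> C" "q \<in> C" for p q
      using C that by (auto simp: Chains_def relation_of_def)
    show "\<exists>u\<in>A. \<forall>p\<in>C. u \<le> p"
    proof (cases "C = {}")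
      case True
      then show ?thesis using ne by auto
    next
      case False
      define u where "u x = (INF p\<in>C. p x)" for x
      have nn: "0 \<le> p x" if "p \<in> C" for p x
        using that CA by (auto simp: A_def intro: pm_seminorm_nonneg)
      have pm: "pm_seminorm p" if "p \<in> C" for p
        using that CA by (auto simp: A_def)
      have ul: "u x \<le> p x" if "p \<in> C" for p x
        unfolding u_def using nn that by (intro cINF_lower bdd_belowI2[of _ 0])
      have ug: "z \<le> u x" if "\<And>p. p \<in> C \<Longrightarrow> z \<le> p x" for z x
        unfolding u_def using False that by (rule cINF_greatest)
      have u0: "0 \<le> u x" for x using nn by (intro ug) auto
      have close: "\<exists>p\<in>C. p x < u x + e" if "e > 0" for x e
        using ug[of "u x + e" x] that by (meson not_le less_add_same_cancel1)
      \<comment> \<open>A chain is totally ordered, so one member is close to the infimum at both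
        points. The inequalities in two arguments pass to \<open>u\<close> in this way.\<close>
      have close2: "\<exists>p\<in>C. p x < u x + e \<and> p y < u y + e" if "e > 0" for x y e
      proof -
        obtain p where "p \<in> C" "p x < u x + e"
          using close[OF \<open>e > 0\<close>] by blast
        moreover obtain q where "q \<in> C" "q y < u y + e"
          using close[OF \<open>e > 0\<close>] by blast
        ultimately show ?thesis
          using tot[of p q] le_funD[of p q y] le_funD[of q p x] by force
      qed
      have "u \<in> A" unfolding A_def pm_seminorm_def
      proof (intro CollectI conjI allI)
        fix x y :: 'a and c :: complex
        show "u (x + y) \<le> u x + u y"
        proof (rule field_le_epsilon)
          fix e :: real assume "e > 0"
          then obtain p where "p \<in> C" "p x < u x + e / 2" "p y < u y + e / 2"
            using close2[of "e/2" x y] by auto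
          then show "u (x + y) \<le> u x + u y + e"
            using ul[of p "x + y"] pm_seminormD(1)[OF pm, of p x y] by linarith
        qed
        show "u (c *\<^sub>C x) = cmod c * u x"
        proof (rule antisym)
          show "cmod c * u x \<le> u (c *\<^sub>C x)"
            using ul by (intro ug) (simp add: pm_seminormD(2)[OF pm] mult_left_mono)
          show "u (c *\<^sub>C x) \<le> cmod c * u x"
          proof (cases "c = 0")
            case c: True
            obtain p where "p \<in> C" using False by blast
            then show ?thesis using c ul[of p 0] pm_seminorm_zero[OF pm[of p]] by simp
          next
            case c: False
            have "u (c *\<^sub>C x) / cmod c \<le> u x"
              using ul[of _ "c *\<^sub>C x"] c by (intro ug) (simp add: pm_seminormD(2)[OF pm] field_simps)
            then show ?thesis using c by (simp add: field_simps)
          qed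
        qed
        have le: "u (x * y) \<le> u x * u y" for x y
        proof (rule ccontr)
          assume "\<not> u (x * y) \<le> u x * u y"
          moreover have "(\<lambda>n. (u x + 1 / real (Suc n)) * (u y + 1 / real (Suc n))) \<longlonglongrightarrow> (u x + 0) * (u y + 0)"
            by (intro tendsto_intros LIMSEQ_Suc lim_1_over_n)
          ultimately have "\<forall>\<^sub>F n in sequentially. (u x + 1 / real (Suc n)) * (u y + 1 / real (Suc n)) < u (x * y)"
            by (intro order_tendstoD(2)) auto
          then obtain n where n: "(u x + 1 / real (Suc n)) * (u y + 1 / real (Suc n)) < u (x * y)"
            by (auto simp: eventually_sequentially)
          obtain p where "p \<in> C" "p x < u x + 1 / real (Suc n)" "p y < u y + 1 / real (Suc n)"
            using close2[of "1 / real (Suc n)" x y] by auto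
          then have "p (x * y) \<le> (u x + 1 / real (Suc n)) * (u y + 1 / real (Suc n))"
            using order_trans[OF pm_seminormD(3)[OF pm, of p x y]
                mult_mono[of "p x" "u x + 1 / real (Suc n)" "p y" "u y + 1 / real (Suc n)"]] nn[of p] u0
            by simp
          then show False using n ul[OF \<open>p \<in> C\<close>, of "x * y"] by simp
        qed
        show "u (x * y) \<le> u x * u y" by (rule le)
        have "(u x)\<^sup>2 \<le> u (x * x)"
          using ul u0 by (intro ug) (simp add: pm_seminormD(4)[OF pm] power_mono)
        then show "u (x * x) = (u x)\<^sup>2" using le[of x x] by (simp add: power2_eq_square)
        obtain p0 where "p0 \<in> C" using False by blast
        then show "u x \<le> norm x" using ul[of p0 x] pm_seminormD(5)[OF pm, of p0 x] by linarith
        have pna: "p a = norm a" and pta: "p (x * a) = p x * norm a" if "p \<in> C" for p x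
          using that CA unfolding A_def by blast+
        have "u a \<le> norm a" using ul[OF \<open>p0 \<in> C\<close>, of a] pna[OF \<open>p0 \<in> C\<close>] by simp
        moreover have "norm a \<le> u a" by (rule ug) (simp add: pna)
        ultimately show ua: "u a = norm a" by simp
        have "u x * norm a \<le> u (x * a)"
        proof (rule ug)
          fix p assume "p \<in> C"
          then show "u x * norm a \<le> p (x * a)"
            unfolding pta[OF \<open>p \<in> C\<close>] by (intro mult_right_mono ul) auto
        qed
        then show "u (x * a) = u x * norm a" using le[of x a] ua by simp
      qed
      then show ?thesis using ul by (auto simp: le_fun_def)
    qed
  qed
  then obtain p where pA: "p \<in> A" and min: "\<And>q. q \<in> A \<Longrightarrow> q \<le> p \<Longrightarrow> q = p" by blast
  have p: "pm_seminorm p" "p a = norm a" and pa: "\<And>x. p (x * a) = p x * norm a"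
    using pA by (auto simp: A_def)
  have "p (x * b) = p x * p b" for x b
  proof (cases "p b = 0")
    case True
    then show ?thesis using pm_seminormD(3)[OF p(1), of x b] pm_seminorm_nonneg[OF p(1), of "x * b"] by simp
  next
    case False
    then have b: "p b > 0" using pm_seminorm_nonneg[OF p(1), of b] by simp
    let ?q = "smoothing p b"
    have xa: "?q (x * a) = ?q x * norm a" for x
    proof -
      have "mult_iter b n (x * a) = mult_iter b n x * a" for n by (simp add: mult_iter_mult)
      then have "(\<lambda>n. p (mult_iter b n (x * a)) / p b ^ n) \<longlonglongrightarrow> ?q x * norm a"
        using tendsto_mult_right[OF smoothing_tendsto[OF p(1) b], of x "norm a"] by (simp add: pa)
      then show ?thesis using smoothing_tendsto[OF p(1) b] LIMSEQ_unique by blast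
    qed
    have "p (mult_iter b n a) / p b ^ n = norm a" for n
    proof (cases n)
      case (Suc m)
      \<comment> \<open>The decreasing sequence for b starts at \<open>p b\<close> and has the limit
        \<open>p b\<close>, so it is constant.\<close>
      have "p (mult_iter b m b) = p b * p b ^ m"
      proof -
        have "p b \<le> p (mult_iter b m b) / p b ^ m"
          using decseq_ge[OF smoothing_decseq[OF p(1) b] smoothing_tendsto[OF p(1) b], of b m]
          by (simp add: smoothing_self[OF p(1) b])
        moreover have "p (mult_iter b m b) / p b ^ m \<le> p b"
          using decseqD[OF smoothing_decseq[OF p(1) b], of 0 m b] by simp
        ultimately show ?thesis using b by (simp add: field_simps)
      qed
      moreover have "mult_iter b (Suc m) a = mult_iter b m b * a"
        by (simp add: mult_iter_mult mult.commute[of a b])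
      ultimately show ?thesis using b by (simp add: Suc pa)
    qed (simp add: p)
    then have "?q a = norm a"
      using LIMSEQ_unique[OF smoothing_tendsto[OF p(1) b, of a], of "norm a"] by simp
    then have "?q \<in> A" using pm_seminorm_smoothing[OF p(1) b] xa by (auto simp: A_def)
    moreover have "?q \<le> p" using smoothing_le[OF p(1) b] by (auto simp: le_fun_def)
    ultimately have "?q = p" by (rule min)
    then show ?thesis using smoothing_times[OF p(1) b, of x] by simp
  qed
  then show ?thesis using that p by blast
qed

subsection \<open>Characters\<close>

lemma power_power_tendsto_zero:
  fixes r :: real
  assumes "0 \<le> r" "r < 1"
  shows "(\<lambda>k. r ^ (2 ^ k)) \<longlonglongrightarrow> 0"
proof (rule tendsto_sandwich[OF _ _ tendsto_const LIMSEQ_realpow_zero[OF assms]])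
  show "\<forall>\<^sub>F k in sequentially. r ^ (2 ^ k) \<le> r ^ k"
    using assms less_exp by (intro always_eventually allI power_decreasing) (auto intro: less_imp_le)
qed (use assms in auto)

lemma spectrumI:
  assumes "\<And>a b. \<phi> (a + b) = \<phi> a + \<phi> b" "\<And>c a. \<phi> (c *\<^sub>C a) = c * \<phi> a"
    "\<And>a b. \<phi> (a * b) = \<phi> a * \<phi> b" "\<phi> a \<noteq> 0"
  shows "\<phi> \<in> spectrum"
  using assms by (auto simp: spectrum_def)

text \<open>\<open>unitised u l\<close> extends the multiplicative seminorm \<open>p\<close> to the element \<open>u + l\<close> of the unitisation.
  Where \<open>l \<mapsto> unitised x l\<close> has a positive minimum \<open>m\<close>, factoring \<open>y\<^sup>N - c\<^sup>N\<close> for \<open>N = 2\<^sup>k\<close>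
  shows that it is locally, hence globally constant, although it tends to infinity.\<close>

context
  fixes p :: "'a::comm_cstar_algebra \<Rightarrow> real" and a :: 'a
  assumes p: "pm_seminorm p" and pa: "p a > 0" and mult: "\<And>x y. p (x * y) = p x * p y"
begin

definition unitised :: "'a \<Rightarrow> complex \<Rightarrow> real" where
  "unitised u l = p (u * a + l *\<^sub>C a) / p a"

lemma unitised_mult: "unitised u l * unitised v m = unitised (u * v + m *\<^sub>C u + l *\<^sub>C v) (l * m)"
proof -
  have "(u * a + l *\<^sub>C a) * (v * a + m *\<^sub>C a) = ((u * v + m *\<^sub>C u + l *\<^sub>C v) * a + (l * m) *\<^sub>C a) * a"
    by (simp add: algebra_simps scaleC_mult_left scaleC_mult_right)
  then have "p (u * a + l *\<^sub>C a) * p (v * a + m *\<^sub>C a) = p ((u * v + m *\<^sub>C u + l *\<^sub>C v) * a + (l * m) *\<^sub>C a) * p a"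
    by (metis mult)
  then show ?thesis using pa by (simp add: unitised_def field_simps)
qed

lemma unitised_add_le: "unitised (u + v) (l + m) \<le> unitised u l + unitised v m"
proof -
  have "(u + v) * a + (l + m) *\<^sub>C a = (u * a + l *\<^sub>C a) + (v * a + m *\<^sub>C a)"
    by (simp add: algebra_simps scaleC_add_left)
  then show ?thesis using pm_seminormD(1)[OF p, of "u * a + l *\<^sub>C a" "v * a + m *\<^sub>C a"] pa
    by (simp add: unitised_def divide_right_mono flip: add_divide_distrib)
qed

lemma unitised_scale: "unitised (c *\<^sub>C u) (c * l) = cmod c * unitised u l"
proof -
  have "(c *\<^sub>C u) * a + (c * l) *\<^sub>C a = c *\<^sub>C (u * a + l *\<^sub>C a)"
    by (simp add: scaleC_add_right scaleC_mult_left)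
  then show ?thesis by (simp add: unitised_def pm_seminormD(2)[OF p])
qed

lemma unitised_nonneg: "0 \<le> unitised u l"
  using pm_seminorm_nonneg[OF p] pa by (simp add: unitised_def)

lemma unitised_zero_left: "unitised 0 l = cmod l"
  using pa by (simp add: unitised_def pm_seminormD(2)[OF p])

lemma unitised_zero_right: "unitised u 0 = p u"
  using pa by (simp add: unitised_def mult)

lemma unitised_lipschitz: "\<bar>unitised u l - unitised u m\<bar> \<le> cmod (l - m)"
  using unitised_add_le[of u 0 m "l - m"] unitised_add_le[of u 0 l "m - l"]
  by (simp add: unitised_zero_left norm_minus_commute)

lemma unitised_lower: "cmod l - p u \<le> unitised u l"
  using unitised_lipschitz[of 0 0 l] unitised_add_le[of u "- u" l 0] unitised_scale[of "-1" u 0]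
  by (simp add: unitised_zero_left unitised_zero_right scaleC_minus_left)

text \<open>The pair stands for (u + l)^(2^k) in the unitisation; a step squares v + m.\<close>

fun square_iter :: "'a \<Rightarrow> complex \<Rightarrow> nat \<Rightarrow> 'a \<times> complex" where
  "square_iter u l 0 = (u, l)"
| "square_iter u l (Suc k) = (let (v, m) = square_iter u l k in (v * v + (2 * m) *\<^sub>C v, m * m))"

definition unitised_iter :: "'a \<Rightarrow> complex \<Rightarrow> nat \<Rightarrow> complex \<Rightarrow> real" where
  "unitised_iter u l k d = unitised (fst (square_iter u l k)) (snd (square_iter u l k) + d)"

text \<open>Difference of two squares: with y = (u + l)^(2^k), the product of y - d and y + d is y^2
  - d^2.\<close>

lemma unitised_iter_Suc: "unitised_iter u l (Suc k) (- (d * d)) = unitised_iter u l k (- d) * unitised_iter u l k d"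
proof -
  obtain v m where vm: "square_iter u l k = (v, m)" by fastforce
  have "(m + d) *\<^sub>C v + (m - d) *\<^sub>C v = (2 * m) *\<^sub>C v"
    by (simp add: scaleC_add_left[symmetric])
  moreover have "(m - d) * (m + d) = m * m - d * d" by (simp add: algebra_simps)
  ultimately have "unitised v (m - d) * unitised v (m + d) = unitised (v * v + (2 * m) *\<^sub>C v) (m * m - d * d)"
    by (simp add: unitised_mult add.assoc)
  then show ?thesis by (simp add: unitised_iter_def vm)
qed

lemma exists_unitised_eq_0: "\<exists>l. unitised u l = 0"
proof -
  have cont: "continuous_on S (unitised u)" for S
    unfolding continuous_on_iff dist_norm
    using unitised_lipschitz by (metis le_less_trans real_norm_def)
  \<comment> \<open>Outside the ball of radius 2 p u, \<open>unitised_lower\<close> gives more than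
    p u, the value at l = 0. The minimum on the ball is therefore global.\<close>
  obtain l0 where l0: "l0 \<in> cball 0 (2 * p u)" "\<And>l. l \<in> cball 0 (2 * p u) \<Longrightarrow> unitised u l0 \<le> unitised u l"
    using continuous_attains_inf[OF compact_cball _ cont, of 0 "2 * p u"] pm_seminorm_nonneg[OF p, of u]
    by auto
  define m where "m = unitised u l0"
  have min: "m \<le> unitised u l" for l
  proof (cases "l \<in> cball 0 (2 * p u)")
    case True
    then show ?thesis using l0 by (simp add: m_def)
  next
    case False
    then have "p u < unitised u l" using unitised_lower[of l u] by simp
    moreover have "m \<le> p u" using l0(2)[of 0] pm_seminorm_nonneg[OF p, of u]
      by (simp add: m_def unitised_zero_right)
    ultimately show ?thesis by simp
  qed
  have "m = 0"
  proof (rule ccontr)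
    assume "m \<noteq> 0"
    then have m: "m > 0" using unitised_nonneg[of u l0] by (simp add: m_def)
    have step: "unitised u (l - c) = m" if l: "unitised u l = m" and c: "cmod c < m" for l c
    proof -
      \<comment> \<open>Every d is minus the square of \<open>csqrt (- d)\<close>, so level k + 1
        factors into two values at level k; at level 0 each value is at least m.\<close>
      have c1: "m ^ (2 ^ k) \<le> unitised_iter u l k d" for k d
      proof (induction k arbitrary: d)
        case 0
        then show ?case by (simp add: unitised_iter_def min)
      next
        case (Suc k)
        have "- (csqrt (- d) * csqrt (- d)) = d"
          using power2_csqrt[of "- d"] by (simp add: power2_eq_square)
        then have "unitised_iter u l (Suc k) d = unitised_iter u l k (- csqrt (- d)) * unitised_iter u l k (csqrt (- d))"
          using unitised_iter_Suc[of u l k "csqrt (- d)"] by simp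
        moreover have "m ^ (2 ^ k) * m ^ (2 ^ k) \<le> unitised_iter u l k (- csqrt (- d)) * unitised_iter u l k (csqrt (- d))"
          using Suc[of "- csqrt (- d)"] Suc[of "csqrt (- d)"] m by (intro mult_mono) (auto intro: order_trans[rotated])
        ultimately show ?case by (simp add: power_add mult_2)
      qed
      \<comment> \<open>With y = u + l and N = 2^k, y^(2N) - c^(2N) is the product of y^N - c^N and
        y^N + c^N, and the second factor is at least m^N by \<open>c1\<close>. Combined with
        \<open>c3\<close>, this bounds the value at l - c by m (1 + (|c| / m)^N).\<close>
      have c2: "unitised u (l - c) * m ^ (2 ^ k) \<le> m * unitised_iter u l k (- (c ^ (2 ^ k)))" for k
      proof (induction k)
        case 0
        then show ?case by (simp add: unitised_iter_def)
      next
        case (Suc k)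
        have "unitised u (l - c) * m ^ (2 ^ Suc k) = (unitised u (l - c) * m ^ (2 ^ k)) * m ^ (2 ^ k)"
          by (simp add: power_add mult_2)
        also have "\<dots> \<le> (m * unitised_iter u l k (- (c ^ (2 ^ k)))) * unitised_iter u l k (c ^ (2 ^ k))"
          by (rule mult_mono) (use Suc c1[of k "c ^ (2 ^ k)"] m unitised_nonneg in \<open>auto simp: unitised_iter_def\<close>)
        also have "\<dots> = m * unitised_iter u l (Suc k) (- (c ^ (2 ^ Suc k)))"
          using unitised_iter_Suc[of u l k "c ^ (2 ^ k)"] by (simp add: power_add mult_2)
        finally show ?case .
      qed
      have c3: "unitised_iter u l k 0 = m ^ (2 ^ k)" for k
      proof (induction k)
        case 0
        then show ?case by (simp add: unitised_iter_def l)
      next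
        case (Suc k)
        then show ?case using unitised_iter_Suc[of u l k 0] by (simp add: power_add mult_2)
      qed
      have "unitised u (l - c) \<le> m * (1 + (cmod c / m) ^ (2 ^ k))" for k
      proof -
        have "unitised_iter u l k (- (c ^ (2 ^ k))) \<le> m ^ (2 ^ k) + cmod c ^ (2 ^ k)"
          using unitised_add_le[of "fst (square_iter u l k)" 0 "snd (square_iter u l k)" "- (c ^ (2 ^ k))"] c3[of k]
          by (simp add: unitised_iter_def unitised_zero_left norm_power)
        then have "unitised u (l - c) * m ^ (2 ^ k) \<le> m * (m ^ (2 ^ k) + cmod c ^ (2 ^ k))"
          using c2[of k] m by (meson mult_left_mono order_trans less_imp_le)
        then show ?thesis using m by (simp add: field_simps power_divide)
      qed
      moreover have "(\<lambda>k. m * (1 + (cmod c / m) ^ (2 ^ k))) \<longlonglongrightarrow> m * (1 + 0)"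
        using c m by (intro tendsto_intros power_power_tendsto_zero) auto
      ultimately have "unitised u (l - c) \<le> m * (1 + 0)"
        by (intro LIMSEQ_le_const) auto
      then show ?thesis using min[of "l - c"] by simp
    qed
    \<comment> \<open>Steps of length m / 2, which is shorter than m, carry the constancy
      arbitrarily far from \<open>l0\<close>, against the growth in
      \<open>unitised_lower\<close>.\<close>
    have "unitised u (l0 - of_nat n * of_real (m / 2)) = m" for n
    proof (induction n)
      case (Suc n)
      have "l0 - of_nat (Suc n) * of_real (m / 2) = (l0 - of_nat n * of_real (m / 2)) - of_real (m / 2)"
        by (simp add: algebra_simps)
      then show ?case using step[OF Suc, of "of_real (m / 2)"] m by (simp only: norm_of_real)
    qed (simp add: m_def)
    then have "cmod (l0 - of_nat n * of_real (m / 2)) \<le> m + p u" for n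
      using unitised_lower[of "l0 - of_nat n * of_real (m / 2)" u] by (metis add.commute diff_le_eq)
    then have *: "real n * (m / 2) \<le> m + p u + cmod l0" for n
    proof -
      have "cmod (of_nat n * of_real (m / 2)) \<le> cmod (l0 - of_nat n * of_real (m / 2)) + cmod l0"
        by (metis add.commute norm_minus_commute norm_triangle_sub)
      moreover have "cmod (of_nat n * of_real (m / 2)) = real n * (m / 2)"
        using m by (simp add: norm_mult)
      ultimately show ?thesis
        using \<open>\<And>n. cmod (l0 - of_nat n * of_real (m / 2)) \<le> m + p u\<close>[of n] by linarith
    qed
    obtain n where "(m + p u + cmod l0) / (m / 2) < real n" using reals_Archimedean2 by blast
    then show False using *[of n] m by (simp add: field_simps)
  qed
  then show ?thesis by (auto simp: m_def)
qed

text \<open>The value at x is the scalar l for which x - l is null for the extended seminorm.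
  Nonzero scalars are not null, so l is unique; null elements form an ideal, so l depends additively
  and multiplicatively on x.\<close>

lemma exists_character_of_seminorm: "\<exists>\<phi>\<in>spectrum. \<forall>x. cmod (\<phi> x) = p x"
proof -
  define \<phi> where "\<phi> x = (SOME l. unitised x (- l) = 0)" for x
  have \<phi>: "unitised x (- \<phi> x) = 0" for x
  proof -
    obtain l where "unitised x l = 0" using exists_unitised_eq_0 by blast
    then have "unitised x (- (- l)) = 0" by simp
    then show ?thesis unfolding \<phi>_def by (rule someI)
  qed
  have eq: "\<phi> x = l" if "unitised x (- l) = 0" for x l
  proof -
    have "cmod (\<phi> x - l) \<le> unitised x (- l) + unitised (- x) (\<phi> x)"
      using unitised_add_le[of x "- x" "- l" "\<phi> x"] by (simp add: unitised_zero_left)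
    also have "unitised (- x) (\<phi> x) = 0"
      using unitised_scale[of "-1" x "- \<phi> x"] \<phi>[of x] by (simp add: scaleC_minus_left)
    finally show ?thesis using that by simp
  qed
  have norm: "cmod (\<phi> x) = p x" for x
    using unitised_lipschitz[of 0 0 0] unitised_add_le[of 0 x "\<phi> x" "- \<phi> x"] unitised_add_le[of x 0 "- \<phi> x" "\<phi> x"] \<phi>[of x]
      unitised_add_le[of x "- x" "- \<phi> x" 0] unitised_scale[of "-1" x 0]
    by (simp add: unitised_zero_left unitised_zero_right scaleC_minus_left)
  have "\<phi> \<in> spectrum"
  proof (rule spectrumI)
    fix x y :: 'a and c :: complex
    show "\<phi> (x + y) = \<phi> x + \<phi> y"
      using unitised_add_le[of x y "- \<phi> x" "- \<phi> y"] \<phi>[of x] \<phi>[of y] unitised_nonneg[of "x + y" "- (\<phi> x + \<phi> y)"]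
      by (intro eq) simp
    show "\<phi> (c *\<^sub>C x) = c * \<phi> x"
      using unitised_scale[of c x "- \<phi> x"] \<phi>[of x] by (intro eq) simp
    have "unitised (x * y - \<phi> x *\<^sub>C y) 0 = 0"
      using unitised_mult[of x "- \<phi> x" y 0] \<phi>[of x] by (simp add: scaleC_minus_left)
    moreover have "unitised (\<phi> x *\<^sub>C y) (- (\<phi> x * \<phi> y)) = 0"
      using unitised_scale[of "\<phi> x" y "- \<phi> y"] \<phi>[of y] by simp
    ultimately show "\<phi> (x * y) = \<phi> x * \<phi> y"
      using unitised_add_le[of "x * y - \<phi> x *\<^sub>C y" "\<phi> x *\<^sub>C y" 0 "- (\<phi> x * \<phi> y)"]
        unitised_nonneg[of "x * y" "- (\<phi> x * \<phi> y)"] by (intro eq) simp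
    show "\<phi> a \<noteq> 0" using norm[of a] pa by auto
  qed
  then show ?thesis using norm by blast
qed

end

lemma exists_character:
  fixes a :: "'a::comm_cstar_algebra"
  assumes "a \<noteq> 0"
  obtains \<phi> where "\<phi> \<in> spectrum" "cmod (\<phi> a) = norm a"
proof -
  obtain p where "pm_seminorm p" "p a = norm a" "\<And>x y. p (x * y) = p x * p y"
    using exists_multiplicative_seminorm[OF assms] by metis
  then show ?thesis using exists_character_of_seminorm[of p a] assms that by auto
qed

lemma character_simps:
  assumes "\<phi> \<in> spectrum"
  shows "\<phi> (a + b) = \<phi> a + \<phi> b" "\<phi> (c *\<^sub>C a) = c * \<phi> a" "\<phi> (a * b) = \<phi> a * \<phi> b"
    "\<phi> 0 = 0" "\<phi> (- a) = - \<phi> a" "\<phi> (a - b) = \<phi> a - \<phi> b" "\<phi> (r *\<^sub>R a) = of_real r * \<phi> a"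
proof -
  show add: "\<And>a b. \<phi> (a + b) = \<phi> a + \<phi> b" and sc: "\<And>c a. \<phi> (c *\<^sub>C a) = c * \<phi> a"
    and "\<phi> (a * b) = \<phi> a * \<phi> b"
    using assms by (auto simp: spectrum_def)
  show "\<phi> 0 = 0" using sc[of 0 0] by simp
  show minus: "\<phi> (- a) = - \<phi> a" for a using sc[of "-1" a] by (simp add: scaleC_minus_left)
  show "\<phi> (a - b) = \<phi> a - \<phi> b" using add[of a "- b"] minus[of b] by simp
  show "\<phi> (r *\<^sub>R a) = of_real r * \<phi> a" by (simp add: scaleR_eq_scaleC sc)
qed

lemma character_sum:
  assumes "\<phi> \<in> spectrum"
  shows "\<phi> (\<Sum>i\<in>I. f i) = (\<Sum>i\<in>I. \<phi> (f i))"
  by (induction I rule: infinite_finite_induct) (auto simp: character_simps[OF assms])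

text \<open>If the value at \<open>a\<close> exceeded norm a, the multiple y of \<open>a\<close>
  with value 1 would have norm below 1, and the contraction z |-> y + y z would have a fixed point;
  applying \<phi> to it gives 1 + \<phi> z = \<phi> z.\<close>

lemma character_norm_le:
  fixes a :: "'a::comm_cstar_algebra"
  assumes \<phi>: "\<phi> \<in> spectrum"
  shows "cmod (\<phi> a) \<le> norm a"
proof (rule ccontr)
  assume "\<not> cmod (\<phi> a) \<le> norm a"
  then have lt: "norm a < cmod (\<phi> a)" by simp
  then have n0: "\<phi> a \<noteq> 0" using norm_ge_zero[of a] by auto
  define y where "y = inverse (\<phi> a) *\<^sub>C a"
  have y: "\<phi> y = 1" "norm y < 1"
    using lt n0 by (simp_all add: y_def character_simps[OF \<phi>] norm_scaleC norm_inverse norm_divide field_simps)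
  have "\<exists>!z. y + y * z = z"
  proof (rule banach_fix_type[of "norm y"], goal_cases)
    case 3
    show ?case
    proof (intro allI)
    fix u v
    have "dist (y + y * u) (y + y * v) = norm (y * (u - v))"
      by (simp add: dist_norm right_diff_distrib)
    then show "dist (y + y * u) (y + y * v) \<le> norm y * dist u v"
      using norm_mult_ineq[of y "u - v"] by (simp add: dist_norm)
    qed
  qed (use y in auto)
  then obtain z where "y + y * z = z" by auto
  then have "\<phi> y + \<phi> y * \<phi> z = \<phi> z" by (metis character_simps(1,3)[OF \<phi>])
  then show False using y by simp
qed

section \<open>Characters and the involution\<close>

lemma norm_star: "norm (star a) = norm (a :: 'a::cstar_algebra)"
proof -
  have *: "norm a \<le> norm (star a)" for a :: 'a
  proof (cases "norm a = 0")
    case False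
    have "norm a * norm a \<le> norm (star a) * norm a"
      using norm_mult_ineq[of "star a" a] by (simp add: cstar_identity power2_eq_square)
    then show ?thesis using False by simp
  qed auto
  show ?thesis using *[of a] *[of "star a"] by (simp add: star_star)
qed

lemma star_zero [simp]: "star 0 = (0 :: 'a::cstar_algebra)"
  by (metis norm_eq_zero norm_star)

lemma star_minus: "star (- a) = - star (a :: 'a::cstar_algebra)"
  using star_add[of a "- a"] by (simp add: eq_neg_iff_add_eq_0 add.commute)

lemma star_diff: "star (a - b) = star a - star (b :: 'a::cstar_algebra)"
  using star_add[of a "- b"] by (simp add: star_minus)

text \<open>Arens' argument: |\<phi> h + i t|^2 is at most norm h^2 + t^2 for all real t, which some
  t violates unless \<phi> h is real. For want of a unit, h + i t enters as the operator
  \<open>T\<close>, and the bound is obtained by cancelling \<open>onorm \<phi>\<close>.\<close>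

lemma character_self_adjoint:
  fixes h :: "'a::comm_cstar_algebra"
  assumes \<phi>: "\<phi> \<in> spectrum" and h: "star h = h"
  shows "Im (\<phi> h) = 0"
proof -
  have bl: "bounded_linear \<phi>"
    by (rule bounded_linear_intro[of _ 1])
      (auto simp: character_simps[OF \<phi>] character_norm_le[OF \<phi>] scaleR_conv_of_real)
  obtain a where a: "\<phi> a \<noteq> 0" using \<phi> by (auto simp: spectrum_def)
  have on: "onorm \<phi> > 0"
  proof (rule ccontr)
    assume "\<not> onorm \<phi> > 0"
    then have "onorm \<phi> * norm a \<le> 0" by (simp add: mult_nonpos_nonneg)
    moreover have "0 < cmod (\<phi> a)" using a by simp
    ultimately show False using onorm[OF bl, of a] by linarith
  qed
  have bound: "(cmod (\<phi> h + \<i> * of_real t))\<^sup>2 \<le> (norm h)\<^sup>2 + t\<^sup>2" for t :: real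
  proof -
    define K where "K = sqrt ((norm h)\<^sup>2 + t\<^sup>2)"
    define z where "z = \<phi> h + \<i> * of_real t"
    have K0: "K \<ge> 0" by (simp add: K_def)
    define T where "T b = h * b + (\<i> * of_real t) *\<^sub>C b" for b
    have T: "norm (T b) \<le> K * norm b" for b
    proof -
      have "star (T b) * T b = star b * h * h * b + (of_real (t\<^sup>2)) *\<^sub>C (star b * b)"
        by (simp add: T_def star_add star_mult h star_scaleC algebra_simps scaleC_mult_left scaleC_mult_right
            scaleC_minus_left power2_eq_square)
      then have "(norm (T b))\<^sup>2 \<le> norm (star b * h * h * b) + norm ((complex_of_real (t\<^sup>2)) *\<^sub>C (star b * b))"
        by (metis cstar_identity norm_triangle_ineq)
      also have "\<dots> \<le> norm b * norm h * norm h * norm b + t\<^sup>2 * (norm b)\<^sup>2"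
      proof (rule add_mono)
        have "norm (star b * h * h * b) \<le> norm (star b) * norm h * norm h * norm b"
          by (intro order_trans[OF norm_mult_ineq] mult_right_mono) auto
        then show "norm (star b * h * h * b) \<le> norm b * norm h * norm h * norm b" by (simp add: norm_star)
        show "norm ((complex_of_real (t\<^sup>2)) *\<^sub>C (star b * b)) \<le> t\<^sup>2 * (norm b)\<^sup>2"
          by (simp add: norm_scaleC cstar_identity norm_power)
      qed
      also have "\<dots> = (K * norm b)\<^sup>2"
        by (simp add: K_def power_mult_distrib algebra_simps power2_eq_square)
      finally show ?thesis by (rule power2_le_imp_le) (use K0 in simp)
    qed
    have "cmod z \<le> K"
    proof (cases "z = 0")
      case False
      have "norm (\<phi> b) \<le> (onorm \<phi> * K / cmod z) * norm b" for b
      proof -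
        have "\<phi> (T b) = z * \<phi> b"
          by (simp add: T_def z_def character_simps[OF \<phi>] algebra_simps)
        then have "cmod z * cmod (\<phi> b) \<le> onorm \<phi> * norm (T b)"
          by (metis onorm[OF bl] norm_mult)
        also have "\<dots> \<le> onorm \<phi> * (K * norm b)" using T on by (intro mult_left_mono) auto
        finally show ?thesis using False by (simp add: field_simps)
      qed
      then have "onorm \<phi> \<le> onorm \<phi> * K / cmod z"
        using on K0 by (intro onorm_bound) auto
      then show ?thesis using on False by (simp add: field_simps)
    qed (use K0 in simp)
    then have "(cmod z)\<^sup>2 \<le> K\<^sup>2" by (simp add: power_mono)
    then show ?thesis by (simp add: z_def K_def)
  qed
  show ?thesis
  proof (rule ccontr)
    assume i: "Im (\<phi> h) \<noteq> 0"
    \<comment> \<open>The product of Im (\<phi> h) and t is then norm h^2, so the left side of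
      \<open>bound\<close> exceeds the right one by norm h^2 + |\<phi> h|^2.\<close>
    define t where "t = (norm h)\<^sup>2 / Im (\<phi> h)"
    have "(Re (\<phi> h))\<^sup>2 + (Im (\<phi> h) + t)\<^sup>2 \<le> (norm h)\<^sup>2 + t\<^sup>2"
      using bound[of t] by (simp add: cmod_power2)
    then have "(Re (\<phi> h))\<^sup>2 + (Im (\<phi> h))\<^sup>2 + 2 * (Im (\<phi> h) * t) \<le> (norm h)\<^sup>2"
      by (simp add: power2_sum)
    moreover have "Im (\<phi> h) * t = (norm h)\<^sup>2" using i by (simp add: t_def)
    moreover have "(Im (\<phi> h))\<^sup>2 > 0" using i by simp
    ultimately show False
      using zero_le_power2[of "Re (\<phi> h)"] zero_le_power2[of "norm h"] by linarith
  qed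
qed

lemma character_star:
  fixes a :: "'a::comm_cstar_algebra"
  assumes \<phi>: "\<phi> \<in> spectrum"
  shows "\<phi> (star a) = cnj (\<phi> a)"
proof -
  have "Im (\<phi> (a + star a)) = 0"
    by (rule character_self_adjoint[OF \<phi>]) (simp add: star_add star_star add.commute)
  moreover have "Im (\<phi> (\<i> *\<^sub>C (a - star a))) = 0"
    by (rule character_self_adjoint[OF \<phi>]) (simp add: star_diff star_scaleC star_star scaleC_diff_right scaleC_minus_left)
  ultimately show ?thesis by (simp add: complex_eq_iff character_simps[OF \<phi>])
qed

lemma character_eqI:
  fixes a b :: "'a::comm_cstar_algebra"
  assumes "\<And>\<phi>. \<phi> \<in> spectrum \<Longrightarrow> \<phi> a = \<phi> b"
  shows "a = b"
proof (rule ccontr)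
  assume "a \<noteq> b"
  then obtain \<phi> where "\<phi> \<in> spectrum" "cmod (\<phi> (a - b)) = norm (a - b)"
    using exists_character[of "a - b"] by auto
  moreover from this have "\<phi> (a - b) = 0" using assms by (simp add: character_simps)
  ultimately show False using \<open>a \<noteq> b\<close> by simp
qed

lemma norm_le_character:
  fixes a :: "'a::comm_cstar_algebra"
  assumes "\<And>\<phi>. \<phi> \<in> spectrum \<Longrightarrow> cmod (\<phi> a) \<le> c" "c \<ge> 0"
  shows "norm a \<le> c"
  using assms exists_character[of a] by (metis norm_zero)

subsection \<open>The one-point compactification of the spectrum\<close>

instance "fun" :: (type, t0_space) t0_space
proof
  fix x y :: "'a \<Rightarrow> 'b"
  assume "x \<noteq> y"
  then obtain i where i: "x i \<noteq> y i" by auto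
  then obtain U where U: "open U" "\<not> (x i \<in> U \<longleftrightarrow> y i \<in> U)"
    using t0_space_class.t0_space[OF i] by blast
  have "open ((\<lambda>z. z i) -` U)"
    using U continuous_on_product_coordinates by (auto intro: open_vimage)
  then show "\<exists>U. open U \<and> \<not> (x \<in> U \<longleftrightarrow> y \<in> U)"
    using U by (intro exI[of _ "(\<lambda>z. z i) -` U"]) auto
qed

instance "fun" :: (type, t1_space) t1_space
proof
  fix x y :: "'a \<Rightarrow> 'b"
  assume "x \<noteq> y"
  then obtain i where i: "x i \<noteq> y i" by auto
  then obtain U where U: "open U" "x i \<in> U" "y i \<notin> U"
    using t1_space[OF i] by blast
  have "open ((\<lambda>z. z i) -` U)"
    using U continuous_on_product_coordinates by (auto intro: open_vimage)
  then show "\<exists>U. open U \<and> x \<in> U \<and> y \<notin> U"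
    using U by (intro exI[of _ "(\<lambda>z. z i) -` U"]) auto
qed

text \<open>Makes compact sets of functionals closed, as the description of neighbourhoods of
  infinity and Dini's theorem require.\<close>

instance "fun" :: (type, t2_space) t2_space
proof
  fix x y :: "'a \<Rightarrow> 'b"
  assume "x \<noteq> y"
  then obtain i where i: "x i \<noteq> y i" by auto
  then obtain U V where UV: "open U" "open V" "x i \<in> U" "y i \<in> V" "U \<inter> V = {}"
    using hausdorff[OF i] by blast
  have "open ((\<lambda>z. z i) -` U)" "open ((\<lambda>z. z i) -` V)"
    using UV continuous_on_product_coordinates by (auto intro: open_vimage)
  then show "\<exists>U V. open U \<and> open V \<and> x \<in> U \<and> y \<in> V \<and> U \<inter> V = {}"
    using UV by (intro exI[of _ "(\<lambda>z. z i) -` U"] exI[of _ "(\<lambda>z. z i) -` V"]) auto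
qed

abbreviation spectrum0 :: "('a::comm_cstar_algebra \<Rightarrow> complex) set" where
  "spectrum0 \<equiv> insert (\<lambda>_. 0) spectrum"

lemma zero_notin_spectrum [simp]: "(\<lambda>_. 0) \<notin> spectrum"
  by (simp add: spectrum_def)

lemma compact_spectrum0: "compact (spectrum0 :: ('a::comm_cstar_algebra \<Rightarrow> complex) set)"
proof -
  let ?B = "PiE UNIV (\<lambda>a::'a. cball (0::complex) (norm a))"
  let ?C = "{\<phi>::'a \<Rightarrow> complex. (\<forall>a b. \<phi> (a + b) = \<phi> a + \<phi> b) \<and> (\<forall>c a. \<phi> (c *\<^sub>C a) = c * \<phi> a) \<and>
     (\<forall>a b. \<phi> (a * b) = \<phi> a * \<phi> b)}"
  have "compactin (product_topology (\<lambda>i. euclidean) UNIV) ?B"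
    by (simp add: compactin_PiE)
  then have "compact ?B" by (simp add: euclidean_product_topology)
  moreover have "closed ?C"
    by (intro closed_Collect_conj closed_Collect_all closed_Collect_eq continuous_intros
        continuous_on_product_coordinates)
  ultimately have "compact (?B \<inter> ?C)" by (rule compact_Int_closed)
  moreover have "?B \<inter> ?C = spectrum0"
  proof (intro equalityI subsetI)
    fix \<phi> assume "\<phi> \<in> ?B \<inter> ?C"
    then show "\<phi> \<in> spectrum0" by (auto simp: spectrum_def)
  next
    fix \<phi> :: "'a \<Rightarrow> complex" assume "\<phi> \<in> spectrum0"
    moreover from this have "cmod (\<phi> x) \<le> norm x" for x
      using character_norm_le[of \<phi> x] by auto
    ultimately show "\<phi> \<in> ?B \<inter> ?C" by (auto simp: spectrum_def)
  qed
  ultimately show ?thesis by simp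
qed

section \<open>Surjectivity of the Gelfand transform\<close>

lemma continuous_on_eval: "continuous_on S (\<lambda>\<phi>. \<phi> a)"
  for S :: "('a \<Rightarrow> 'b::topological_space) set"
  by (rule continuous_on_subset[OF continuous_on_product_coordinates]) simp

theorem gelfand_surjective_real:
  fixes g :: "('a::comm_cstar_algebra \<Rightarrow> complex) \<Rightarrow> real"
  assumes g: "continuous_on spectrum0 g" and g0: "g (\<lambda>_. 0) = 0"
  shows "\<exists>a. \<forall>\<phi>\<in>spectrum. \<phi> a = of_real (g \<phi>)"
proof -
  \<comment> \<open>Constants have to be adjoined because transforms vanish at the zero functional.
    Self-adjoint elements have real values, which makes \<open>Re\<close> multiplicative on
    them.\<close>
  define R :: "(('a \<Rightarrow> complex) \<Rightarrow> real) set"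
    where "R = {f. \<exists>r a. star a = a \<and> (\<forall>\<phi>\<in>spectrum0. f \<phi> = r + Re (\<phi> a))}"
  have RI: "f \<in> R" if "star a = a" "\<And>\<phi>. \<phi> \<in> spectrum0 \<Longrightarrow> f \<phi> = r + Re (\<phi> a)" for f r a
    unfolding R_def using that by (intro CollectI exI[of _ r] exI[of _ a]) simp
  have RE: "\<exists>r a. star a = a \<and> (\<forall>\<phi>\<in>spectrum0. f \<phi> = r + Re (\<phi> a))" if "f \<in> R" for f
    using that by (simp add: R_def)
  interpret function_ring_on R "spectrum0 :: ('a \<Rightarrow> complex) set"
  proof
    show "compact (spectrum0 :: ('a \<Rightarrow> complex) set)" by (rule compact_spectrum0)
    fix f assume f: "f \<in> R"
    obtain r a where fr: "star a = a" "\<forall>\<phi>\<in>spectrum0. f \<phi> = r + Re (\<phi> a)" using RE[OF f] by blast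
    have "continuous_on spectrum0 (\<lambda>\<phi>. r + Re (\<phi> a))"
      by (intro continuous_intros continuous_on_eval)
    then show "continuous_on spectrum0 f"
      by (rule continuous_on_eq) (simp only: bspec[OF fr(2)])
    fix g assume g: "g \<in> R"
    obtain s b where gs: "star b = b" "\<forall>\<phi>\<in>spectrum0. g \<phi> = s + Re (\<phi> b)" using RE[OF g] by blast
    show "(\<lambda>x. f x + g x) \<in> R"
      by (rule RI[of "a + b" _ "r + s"]) (use fr gs in \<open>auto simp: star_add character_simps\<close>)
    show "(\<lambda>x. f x * g x) \<in> R"
    proof (rule RI[of "s *\<^sub>R a + r *\<^sub>R b + a * b" _ "r * s"])
      show "star (s *\<^sub>R a + r *\<^sub>R b + a * b) = s *\<^sub>R a + r *\<^sub>R b + a * b"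
        by (simp add: scaleR_eq_scaleC star_add star_scaleC star_mult fr gs mult.commute)
      fix \<phi> :: "'a \<Rightarrow> complex" assume \<phi>: "\<phi> \<in> spectrum0"
      show "f \<phi> * g \<phi> = r * s + Re (\<phi> (s *\<^sub>R a + r *\<^sub>R b + a * b))"
      proof (cases "\<phi> \<in> spectrum")
        case True
        then have "Im (\<phi> a) = 0" using character_self_adjoint fr by blast
        then show ?thesis using True fr gs by (simp add: character_simps algebra_simps)
      qed (use \<phi> fr gs in auto)
    qed
  next
    show "(\<lambda>_. c) \<in> R" for c by (rule RI[of 0 _ c]) (auto simp: character_simps)
    fix x y :: "'a \<Rightarrow> complex" assume xy: "x \<in> spectrum0" "y \<in> spectrum0" "x \<noteq> y"
    have st: "z (star a) = cnj (z a)" if "z \<in> spectrum0" for z a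
      using that character_star by auto
    have ad: "z (a + b) = z a + z b" "z (c *\<^sub>C a) = c * z a" if "z \<in> spectrum0" for z :: "'a \<Rightarrow> complex" and a b c
      using that by (auto simp: character_simps)
    obtain a where a: "x a \<noteq> y a" using xy by auto
    \<comment> \<open>The values of a separating element may differ in their imaginary parts only;
      multiplication by i moves the difference to the real parts.\<close>
    show "\<exists>f\<in>R. f x \<noteq> f y"
    proof (cases "Re (x a) = Re (y a)")
      case False
      have "(\<lambda>\<phi>. 0 + Re (\<phi> (a + star a))) \<in> R"
        by (rule RI[of "a + star a" _ 0]) (auto simp: star_add star_star add.commute)
      moreover have "0 + Re (x (a + star a)) \<noteq> 0 + Re (y (a + star a))"
        using False xy by (simp add: ad st)
      ultimately show ?thesis by (intro bexI[of _ "\<lambda>\<phi>. 0 + Re (\<phi> (a + star a))"])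
    next
      case True
      define b where "b = \<i> *\<^sub>C a"
      have "Im (x a) \<noteq> Im (y a)" using True a complex_eq_iff by blast
      then have False: "Re (x b) \<noteq> Re (y b)" using xy by (simp add: b_def ad)
      have "(\<lambda>\<phi>. 0 + Re (\<phi> (b + star b))) \<in> R"
        by (rule RI[of "b + star b" _ 0]) (auto simp: star_add star_star add.commute)
      moreover have "0 + Re (x (b + star b)) \<noteq> 0 + Re (y (b + star b))"
        using False xy by (simp add: ad st)
      ultimately show ?thesis by (intro bexI[of _ "\<lambda>\<phi>. 0 + Re (\<phi> (b + star b))"])
    qed
  qed
  have "\<exists>a. \<forall>\<phi>\<in>spectrum. cmod (\<phi> a - of_real (g \<phi>)) < e" if e: "e > 0" for e
  proof -
    obtain f where "f \<in> R" and f: "\<forall>\<phi>\<in>spectrum0. \<bar>g \<phi> - f \<phi>\<bar> < e / 2"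
      using Stone_Weierstrass_basic[OF g, of "e / 2"] e by auto
    then obtain r a where fr: "star a = a" "\<forall>\<phi>\<in>spectrum0. f \<phi> = r + Re (\<phi> a)" using RE by blast
    have r: "\<bar>r\<bar> < e / 2" using f fr g0 by force
    have "cmod (\<phi> a - of_real (g \<phi>)) < e" if \<phi>: "\<phi> \<in> spectrum" for \<phi>
    proof -
      have "Im (\<phi> a) = 0" using character_self_adjoint \<phi> fr by blast
      then have "\<phi> a - of_real (g \<phi>) = of_real (Re (\<phi> a) - g \<phi>)" by (simp add: complex_eq_iff)
      then have "cmod (\<phi> a - of_real (g \<phi>)) = \<bar>Re (\<phi> a) - g \<phi>\<bar>" by (metis norm_of_real)
      moreover have "\<bar>g \<phi> - (r + Re (\<phi> a))\<bar> < e / 2" using f fr \<phi> by auto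
      ultimately show ?thesis using r by linarith
    qed
    then show ?thesis by blast
  qed
  then have "\<forall>n::nat. \<exists>a. \<forall>\<phi>\<in>spectrum. cmod (\<phi> a - of_real (g \<phi>)) < 1 / real (Suc n)" by simp
  then obtain A where A: "\<And>n \<phi>. \<phi> \<in> spectrum \<Longrightarrow> cmod (\<phi> (A n) - of_real (g \<phi>)) < 1 / real (Suc n)"
    by metis
  have "Cauchy A"
  proof (rule CauchyI)
    fix e :: real assume e: "e > 0"
    obtain N where N: "1 / real (Suc N) < e / 4" using e nat_approx_posE[of "e / 4"] by auto
    have "norm (A m - A n) < e" if mn: "m \<ge> N" "n \<ge> N" for m n
    proof -
      have "norm (A m - A n) \<le> e / 2"
      proof (rule norm_le_character)
        fix \<phi> :: "'a \<Rightarrow> complex" assume \<phi>: "\<phi> \<in> spectrum"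
        have "1 / real (Suc m) \<le> 1 / real (Suc N)" "1 / real (Suc n) \<le> 1 / real (Suc N)"
          using mn by (auto intro!: divide_left_mono)
        then have "cmod (\<phi> (A m) - of_real (g \<phi>)) < e / 4" "cmod (\<phi> (A n) - of_real (g \<phi>)) < e / 4"
          using A[OF \<phi>, of m] A[OF \<phi>, of n] N by linarith+
        then show "cmod (\<phi> (A m - A n)) \<le> e / 2"
          using norm_triangle_ineq4[of "\<phi> (A m) - of_real (g \<phi>)" "\<phi> (A n) - of_real (g \<phi>)"]
          by (simp add: character_simps[OF \<phi>])
      qed (use e in auto)
      then show ?thesis using e by simp
    qed
    then show "\<exists>N. \<forall>m\<ge>N. \<forall>n\<ge>N. norm (A m - A n) < e" by blast
  qed
  then obtain a where a: "A \<longlonglongrightarrow> a" by (auto simp: Cauchy_convergent_iff convergent_def)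
  have "\<phi> a = of_real (g \<phi>)" if \<phi>: "\<phi> \<in> spectrum" for \<phi>
  proof -
    have "(\<lambda>n. cmod (\<phi> a - of_real (g \<phi>))) \<longlonglongrightarrow> 0"
    proof (rule tendsto_sandwich[OF always_eventually always_eventually tendsto_const])
      show "\<forall>n. cmod (\<phi> a - of_real (g \<phi>)) \<le> norm (a - A n) + 1 / real (Suc n)"
      proof
        fix n
        have "cmod (\<phi> a - of_real (g \<phi>)) \<le> cmod (\<phi> (a - A n)) + cmod (\<phi> (A n) - of_real (g \<phi>))"
          using norm_triangle_ineq[of "\<phi> a - \<phi> (A n)" "\<phi> (A n) - of_real (g \<phi>)"]
          by (simp add: character_simps[OF \<phi>])
        then show "cmod (\<phi> a - of_real (g \<phi>)) \<le> norm (a - A n) + 1 / real (Suc n)"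
          using A[OF \<phi>, of n] character_norm_le[OF \<phi>, of "a - A n"] by linarith
      qed
      have "(\<lambda>n. norm (a - A n) + 1 / real (Suc n)) \<longlonglongrightarrow> norm (a - a) + 0"
        by (intro tendsto_intros a LIMSEQ_Suc lim_1_over_n)
      then show "(\<lambda>n. norm (a - A n) + 1 / real (Suc n)) \<longlonglongrightarrow> 0" by simp
    qed auto
    then show ?thesis by (simp add: LIMSEQ_const_iff)
  qed
  then show ?thesis by blast
qed

theorem gelfand_surjective:
  fixes g :: "('a::comm_cstar_algebra \<Rightarrow> complex) \<Rightarrow> complex"
  assumes g: "continuous_on spectrum0 g" and g0: "g (\<lambda>_. 0) = 0"
  shows "\<exists>!a. \<forall>\<phi>\<in>spectrum. \<phi> a = g \<phi>"
proof -
  obtain a b where a: "\<forall>\<phi>\<in>spectrum. \<phi> a = of_real (Re (g \<phi>))" and b: "\<forall>\<phi>\<in>spectrum. \<phi> b = of_real (Im (g \<phi>))"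
    using gelfand_surjective_real[of "\<lambda>\<phi>. Re (g \<phi>)"] gelfand_surjective_real[of "\<lambda>\<phi>. Im (g \<phi>)"] g g0
    by (auto intro: continuous_intros)
  have "\<forall>\<phi>\<in>spectrum. \<phi> (a + \<i> *\<^sub>C b) = g \<phi>"
    using a b by (simp add: character_simps complex_eq_iff)
  moreover have "u = v" if "\<forall>\<phi>\<in>spectrum. \<phi> u = g \<phi>" "\<forall>\<phi>\<in>spectrum. \<phi> v = g \<phi>" for u v
    by (rule character_eqI) (use that in auto)
  ultimately show ?thesis by blast
qed

section \<open>Operators on a Hilbert space\<close>

subsection \<open>Inner products\<close>

lemma cinner_add_left: "cinner (x + y) z = cinner x z + cinner y (z::'h::complex_hilbert_space)"
  by (metis cinner_commute cinner_add_right complex_cnj_add)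

lemma cinner_scaleC_left: "cinner (c *\<^sub>C x) y = cnj c * cinner x (y::'h::complex_hilbert_space)"
  by (metis cinner_commute cinner_scaleC_right complex_cnj_mult)

lemma cinner_scaleR_right: "cinner x (r *\<^sub>R y) = of_real r * cinner x (y::'h::complex_hilbert_space)"
  by (simp add: scaleR_eq_scaleC cinner_scaleC_right)

lemma cinner_scaleR_left: "cinner (r *\<^sub>R x) y = of_real r * cinner x (y::'h::complex_hilbert_space)"
  by (simp add: scaleR_eq_scaleC cinner_scaleC_left)

lemma Re_cinner_self: "Re (cinner x x) = (norm (x::'h::complex_hilbert_space))\<^sup>2"
  by (simp add: cinner_self)

text \<open>The class fixes the norm of real multiples only; for complex ones it follows from
  \<open>cinner_self\<close>.\<close>

lemma norm_scaleC_hilbert: "norm (c *\<^sub>C x) = cmod c * norm (x::'h::complex_hilbert_space)"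
proof (rule power2_eq_imp_eq)
  have "complex_of_real ((norm (c *\<^sub>C x))\<^sup>2) = cnj c * (c * of_real ((norm x)\<^sup>2))"
    by (simp only: cinner_self[symmetric] cinner_scaleC_left cinner_scaleC_right mult.left_commute)
  also have "\<dots> = of_real ((cmod c * norm x)\<^sup>2)"
    by (simp only: power_mult_distrib of_real_mult complex_norm_square ac_simps)
  finally show "(norm (c *\<^sub>C x))\<^sup>2 = (cmod c * norm x)\<^sup>2" by (simp only: of_real_eq_iff)
qed auto

lemma cinner_minus_right: "cinner x (- y) = - cinner x (y::'h::complex_hilbert_space)"
  using cinner_scaleR_right[of x "-1" y] by simp

lemma cinner_zero_right [simp]: "cinner x 0 = (0::complex)" for x :: "'h::complex_hilbert_space"
  using cinner_scaleR_right[of x 0 0] by simp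

lemma cinner_zero_left [simp]: "cinner 0 x = (0::complex)" for x :: "'h::complex_hilbert_space"
  using cinner_scaleR_left[of 0 0 x] by simp

lemma norm_add_square: "(norm (x + y))\<^sup>2 = (norm x)\<^sup>2 + (norm y)\<^sup>2 + 2 * Re (cinner x y)"
  for x y :: "'h::complex_hilbert_space"
proof -
  have "Re (cinner y x) = Re (cinner x y)" by (subst cinner_commute) simp
  then show ?thesis
    by (simp add: Re_cinner_self[symmetric] cinner_add_left cinner_add_right)
qed

lemma norm_diff_square: "(norm (x - y))\<^sup>2 = (norm x)\<^sup>2 + (norm y)\<^sup>2 - 2 * Re (cinner x y)"
  for x y :: "'h::complex_hilbert_space"
  using norm_add_square[of x "- y"] by (simp add: cinner_minus_right)

lemma norm_cinner_le: "cmod (cinner x y) \<le> norm x * norm y" for x y :: "'h::complex_hilbert_space"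
proof (cases "y = 0")
  case False
  define c where "c = cinner y x / of_real ((norm y)\<^sup>2)"
  have "Re (cinner x (c *\<^sub>C y)) = (cmod (cinner x y))\<^sup>2 / (norm y)\<^sup>2"
  proof -
    have "cinner x (c *\<^sub>C y) = (cinner x y * cnj (cinner x y)) / of_real ((norm y)\<^sup>2)"
      by (subst cinner_commute[of x y]) (simp add: c_def cinner_scaleC_right cinner_commute[of x y])
    also have "\<dots> = of_real ((cmod (cinner x y))\<^sup>2 / (norm y)\<^sup>2)"
      by (simp only: complex_norm_square[symmetric] of_real_divide)
    finally show ?thesis by simp
  qed
  moreover have "(norm (c *\<^sub>C y))\<^sup>2 = (cmod (cinner x y))\<^sup>2 / (norm y)\<^sup>2"
  proof -
    have "cmod (cinner y x) = cmod (cinner x y)" by (subst cinner_commute) simp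
    then have "cmod c = cmod (cinner x y) / (norm y)\<^sup>2"
      unfolding c_def norm_divide norm_of_real by simp
    then show ?thesis
      using False by (simp add: norm_scaleC_hilbert power_mult_distrib power_divide power2_eq_square)
  qed
  ultimately have "0 \<le> (norm x)\<^sup>2 - (cmod (cinner x y))\<^sup>2 / (norm y)\<^sup>2"
    using norm_diff_square[of x "c *\<^sub>C y"] zero_le_power2[of "norm (x - c *\<^sub>C y)"] by linarith
  then have "(cmod (cinner x y))\<^sup>2 \<le> (norm x * norm y)\<^sup>2"
    using False by (simp add: field_simps power_mult_distrib)
  then show ?thesis by (rule power2_le_imp_le) simp
qed simp

interpretation cinner: bounded_bilinear "cinner :: 'h::complex_hilbert_space \<Rightarrow> 'h \<Rightarrow> complex"
proof
  show "\<exists>K. \<forall>a b. cmod (cinner a (b::'h)) \<le> norm a * norm b * K"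
    using norm_cinner_le by (intro exI[of _ 1]) auto
qed (auto simp: cinner_add_left cinner_add_right cinner_scaleR_left cinner_scaleR_right scaleR_conv_of_real)

interpretation scaleC_hilbert: bounded_bilinear "scaleC :: complex \<Rightarrow> 'h::complex_hilbert_space \<Rightarrow> 'h"
proof
  show "\<exists>K. \<forall>a b. norm (a *\<^sub>C (b::'h)) \<le> norm a * norm b * K"
    by (intro exI[of _ 1]) (simp add: norm_scaleC_hilbert)
qed (auto simp: scaleC_add_left scaleC_add_right scaleR_eq_scaleC scaleR_conv_of_real ac_simps)

lemma cinner_eqI:
  assumes "\<And>w. cinner w u = cinner w (v::'h::complex_hilbert_space)"
  shows "u = v"
proof -
  have "cinner (u - v) (u - v) = 0" using assms[of "u - v"] by (simp add: cinner.diff_right)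
  then show ?thesis by (simp add: cinner_self)
qed

subsection \<open>Adjoint pairs\<close>

definition adjoint_pair :: "('h::complex_hilbert_space \<Rightarrow> 'h) \<Rightarrow> ('h \<Rightarrow> 'h) \<Rightarrow> bool" where
  "adjoint_pair T S \<longleftrightarrow> (\<forall>u v. cinner (T u) v = cinner u (S v))"

text \<open>An explicit bound in place of the operator norm, because one constant has to serve at
  all points of the spectrum.\<close>

definition op_le :: "('h::complex_hilbert_space \<Rightarrow> 'h) \<Rightarrow> real \<Rightarrow> bool" where
  "op_le T M \<longleftrightarrow> (\<forall>v. norm (T v) \<le> M * norm v)"

lemma adjoint_pairD: "adjoint_pair T S \<Longrightarrow> cinner (T u) v = cinner u (S v)"
  by (simp add: adjoint_pair_def)

lemma adjoint_pair_sym: "adjoint_pair T S \<Longrightarrow> adjoint_pair S T"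
  unfolding adjoint_pair_def by (metis cinner_commute)

lemma adjoint_pairD': "adjoint_pair T S \<Longrightarrow> cinner u (T v) = cinner (S u) v"
  using adjoint_pairD[OF adjoint_pair_sym] by metis

lemma adjoint_pair_unique: "adjoint_pair T S \<Longrightarrow> adjoint_pair T S' \<Longrightarrow> S = S'"
  by (intro ext cinner_eqI) (metis adjoint_pairD)

text \<open>Moving T across the inner product turns each identity into one for the inner product
  itself.\<close>

lemma adjoint_pair_linear:
  assumes "adjoint_pair T S"
  shows "T (u + v) = T u + T v" "T (c *\<^sub>C u) = c *\<^sub>C T u" "T (r *\<^sub>R u) = r *\<^sub>R T u"
    "T (u - v) = T u - T v" "T 0 = 0"
proof -
  note a = adjoint_pairD'[OF assms]
  show "T (u + v) = T u + T v" by (rule cinner_eqI) (simp add: a cinner_add_right)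
  show sc: "T (c *\<^sub>C u) = c *\<^sub>C T u" for c by (rule cinner_eqI) (simp add: a cinner_scaleC_right)
  show "T (r *\<^sub>R u) = r *\<^sub>R T u" using sc by (simp add: scaleR_eq_scaleC)
  show "T (u - v) = T u - T v" by (rule cinner_eqI) (simp add: a cinner.diff_right)
  show "T 0 = 0" by (rule cinner_eqI) (simp add: a)
qed

lemma adjoint_pair_compose:
  "adjoint_pair T S \<Longrightarrow> adjoint_pair T' S' \<Longrightarrow> adjoint_pair (\<lambda>v. T (T' v)) (\<lambda>v. S' (S v))"
  by (simp add: adjoint_pair_def)

lemma adjoint_pair_add:
  "adjoint_pair T S \<Longrightarrow> adjoint_pair T' S' \<Longrightarrow> adjoint_pair (\<lambda>v. T v + T' v) (\<lambda>v. S v + S' v)"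
  by (simp add: adjoint_pair_def cinner_add_left cinner_add_right)

lemma adjoint_pair_diff:
  "adjoint_pair T S \<Longrightarrow> adjoint_pair T' S' \<Longrightarrow> adjoint_pair (\<lambda>v. T v - T' v) (\<lambda>v. S v - S' v)"
  by (simp add: adjoint_pair_def cinner.diff_left cinner.diff_right)

lemma adjoint_pair_scaleR:
  "adjoint_pair T S \<Longrightarrow> adjoint_pair (\<lambda>v. r *\<^sub>R T v) (\<lambda>v. r *\<^sub>R S v)"
  by (simp add: adjoint_pair_def cinner_scaleR_left cinner_scaleR_right)

lemma adjoint_pair_id: "adjoint_pair (\<lambda>v. v) (\<lambda>v. v)"
  by (simp add: adjoint_pair_def)

lemma op_leD: "op_le T M \<Longrightarrow> norm (T v) \<le> M * norm v"
  by (simp add: op_le_def)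

lemma op_le_adjoint:
  assumes a: "adjoint_pair T S" and T: "op_le T M"
  shows "op_le S M"
  unfolding op_le_def
proof
  fix v
  have "(norm (S v))\<^sup>2 = Re (cinner (T (S v)) v)"
    by (simp add: adjoint_pairD[OF a] Re_cinner_self)
  also have "\<dots> \<le> norm (T (S v)) * norm v"
    using norm_cinner_le complex_Re_le_cmod order_trans by blast
  also have "\<dots> \<le> M * norm (S v) * norm v"
    by (intro mult_right_mono op_leD[OF T]) simp
  finally show "norm (S v) \<le> M * norm v"
    using order_trans[OF norm_ge_zero op_leD[OF T, of v]]
    by (cases "norm (S v) = 0") (auto simp: power2_eq_square ac_simps)
qed

lemma op_le_bounded_op:
  assumes "adjoint_pair T S" "op_le T M"
  shows "bounded_op T"
  unfolding bounded_op_def using adjoint_pair_linear[OF assms(1)] op_leD[OF assms(2)]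
  by (auto intro!: bounded_linear_intro[of _ M] simp: mult.commute)

lemma op_le_tendsto:
  assumes "adjoint_pair T S" "op_le T M" "f \<longlonglongrightarrow> v"
  shows "(\<lambda>n. T (f n)) \<longlonglongrightarrow> T v"
  using op_le_bounded_op[OF assms(1,2)] assms(3)
  by (auto simp: bounded_op_def intro: bounded_linear.tendsto)

lemma op_le_square:
  assumes "\<And>v. (norm (T v))\<^sup>2 \<le> M * (norm v)\<^sup>2" "M \<ge> 0"
  shows "op_le T (sqrt M)"
  unfolding op_le_def
proof
  fix v show "norm (T v) \<le> sqrt M * norm v"
    by (rule power2_le_imp_le) (use assms in \<open>auto simp: power_mult_distrib\<close>)
qed

text \<open>\<open>s' s\<close> lies between 0 and M, so 1 - \<open>s' s\<close> / M is a
  contraction: in the expanded square the term |s' s v|^2 / M^2 is at most |s v|^2 / M, half of what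
  the cross term subtracts.\<close>

lemma contraction_complement:
  assumes a: "adjoint_pair s s'" and M: "M > 0" and b: "\<And>v. (norm (s v))\<^sup>2 \<le> M * (norm v)\<^sup>2"
  shows "norm (v - (1 / M) *\<^sub>R s' (s v)) \<le> norm v"
proof -
  have op: "op_le s (sqrt M)" using op_le_square b M by force
  have "(norm (s' (s v)))\<^sup>2 \<le> (sqrt M * norm (s v))\<^sup>2"
    by (intro power_mono op_leD[OF op_le_adjoint[OF a op]]) simp
  then have 1: "(norm (s' (s v)))\<^sup>2 \<le> M * (norm (s v))\<^sup>2" using M by (simp add: power_mult_distrib)
  have "Re (cinner v (s' (s v))) = (norm (s v))\<^sup>2"
    by (simp add: adjoint_pairD[OF a, symmetric] Re_cinner_self)
  then have "(norm (v - (1 / M) *\<^sub>R s' (s v)))\<^sup>2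
      = (norm v)\<^sup>2 + (norm (s' (s v)))\<^sup>2 / M\<^sup>2 - 2 * (norm (s v))\<^sup>2 / M"
    using M by (simp add: norm_diff_square cinner_scaleR_right power_divide)
  also have "\<dots> \<le> (norm v)\<^sup>2 + (norm (s v))\<^sup>2 / M - 2 * (norm (s v))\<^sup>2 / M"
    using 1 M by (simp add: field_simps power2_eq_square)
  also have "\<dots> \<le> (norm v)\<^sup>2"
    using M by (simp add: field_simps)
  finally show ?thesis by (rule power2_le_imp_le) simp
qed

subsection \<open>Square roots\<close>

text \<open>The iteration \<open>Y \<mapsto> (R + Y\<^sup>2) / 2\<close> converges to \<open>1 - sqrt (1 - R)\<close>. Its steps are polynomials in \<open>R\<close>
  with nonnegative coefficients, so that the scalar iteration for \<open>R = 1\<close> bounds the norms.\<close>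

fun sqrt_iter :: "('h::complex_hilbert_space \<Rightarrow> 'h) \<Rightarrow> nat \<Rightarrow> 'h \<Rightarrow> 'h" where
  "sqrt_iter R 0 v = 0"
| "sqrt_iter R (Suc n) v = (1/2) *\<^sub>R (R v + sqrt_iter R n (sqrt_iter R n v))"

fun sqrt_scalar :: "nat \<Rightarrow> real" where
  "sqrt_scalar 0 = 0"
| "sqrt_scalar (Suc n) = (1 + (sqrt_scalar n)\<^sup>2) / 2"

declare sqrt_iter.simps(2) [simp del] sqrt_scalar.simps(2) [simp del]

lemma sqrt_scalar_bounds: "0 \<le> sqrt_scalar n" "sqrt_scalar n \<le> 1"
proof -
  have "0 \<le> sqrt_scalar n \<and> sqrt_scalar n \<le> 1"
  proof (induction n)
    case (Suc n)
    then have "(sqrt_scalar n)\<^sup>2 \<le> 1" by (simp add: power_le_one)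
    then show ?case by (simp add: sqrt_scalar.simps(2))
  qed simp
  then show "0 \<le> sqrt_scalar n" "sqrt_scalar n \<le> 1" by auto
qed

lemma sqrt_scalar_incseq: "incseq sqrt_scalar"
proof (rule incseq_SucI)
  fix n
  have "0 \<le> (1 - sqrt_scalar n)\<^sup>2" by simp
  then show "sqrt_scalar n \<le> sqrt_scalar (Suc n)" by (simp add: power2_diff sqrt_scalar.simps(2))
qed

lemma sqrt_scalar_tendsto: "sqrt_scalar \<longlonglongrightarrow> 1"
proof -
  obtain L where L: "sqrt_scalar \<longlonglongrightarrow> L"
    using incseq_convergent[OF sqrt_scalar_incseq, of 1] sqrt_scalar_bounds by blast
  have "(\<lambda>n. (1 + (sqrt_scalar n)\<^sup>2) / 2) \<longlonglongrightarrow> (1 + L\<^sup>2) / 2"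
    by (intro tendsto_intros L) simp
  then have "(\<lambda>n. sqrt_scalar (Suc n)) \<longlonglongrightarrow> (1 + L\<^sup>2) / 2" by (simp add: sqrt_scalar.simps(2))
  then have "L = (1 + L\<^sup>2) / 2" using LIMSEQ_Suc[OF L] LIMSEQ_unique by blast
  then have "(1 - L)\<^sup>2 = 0" by (simp add: power2_diff)
  then show ?thesis using L by simp
qed

definition sqrt_limit :: "('h::complex_hilbert_space \<Rightarrow> 'h) \<Rightarrow> 'h \<Rightarrow> 'h" where
  "sqrt_limit R v = lim (\<lambda>n. sqrt_iter R n v)"

context
  fixes R :: "'h::complex_hilbert_space \<Rightarrow> 'h"
  assumes sa: "adjoint_pair R R" and con: "op_le R 1"
begin

lemma sqrt_iter_adjoint: "adjoint_pair (sqrt_iter R n) (sqrt_iter R n)"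
proof (induction n)
  case 0
  then show ?case by (simp add: adjoint_pair_def)
next
  case (Suc n)
  show ?case
    using adjoint_pair_scaleR[OF adjoint_pair_add[OF sa adjoint_pair_compose[OF Suc Suc]], of "1/2"]
    by (simp add: adjoint_pair_def sqrt_iter.simps(2))
qed

lemma sqrt_iter_commute:
  assumes "adjoint_pair B B'" "\<And>v. B (R v) = R (B v)"
  shows "B (sqrt_iter R n v) = sqrt_iter R n (B v)"
  by (induction n arbitrary: v) (auto simp: sqrt_iter.simps(2) adjoint_pair_linear[OF assms(1)] assms(2))

lemma sqrt_iter_commute_iter: "sqrt_iter R m (sqrt_iter R n v) = sqrt_iter R n (sqrt_iter R m v)"
proof (rule sqrt_iter_commute[OF sqrt_iter_adjoint])
  show "sqrt_iter R m (R v) = R (sqrt_iter R m v)" for v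
    using sqrt_iter_commute[OF sa, of m v] by simp
qed

lemma sqrt_iter_norm: "norm (sqrt_iter R n v) \<le> sqrt_scalar n * norm v"
proof (induction n arbitrary: v)
  case (Suc n)
  have "norm (sqrt_iter R n (sqrt_iter R n v)) \<le> sqrt_scalar n * (sqrt_scalar n * norm v)"
    using Suc[of v] Suc[of "sqrt_iter R n v"] sqrt_scalar_bounds(1)[of n]
    by (meson mult_left_mono order_trans)
  then have "norm (R v + sqrt_iter R n (sqrt_iter R n v)) \<le> norm v + sqrt_scalar n * (sqrt_scalar n * norm v)"
    using op_leD[OF con, of v] norm_triangle_ineq[of "R v" "sqrt_iter R n (sqrt_iter R n v)"] by linarith
  moreover have "norm (sqrt_iter R (Suc n) v) = (1/2) * norm (R v + sqrt_iter R n (sqrt_iter R n v))"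
    by (simp only: sqrt_iter.simps norm_scaleR abs_of_pos half_gt_zero_iff zero_less_one)
  moreover have "sqrt_scalar (Suc n) * norm v = (1/2) * (norm v + sqrt_scalar n * (sqrt_scalar n * norm v))"
    by (simp add: sqrt_scalar.simps(2) power2_eq_square algebra_simps)
  ultimately show ?case by simp
qed simp

text \<open>The iterates commute, so consecutive squares differ by the sum \<open>?Y + ?Z\<close>
  applied to the difference. The scalar recursion factors in the same way and supplies the
  bound.\<close>

lemma sqrt_iter_step:
  "norm (sqrt_iter R (Suc n) v - sqrt_iter R n v) \<le> (sqrt_scalar (Suc n) - sqrt_scalar n) * norm v"
proof (induction n arbitrary: v)
  case 0
  then show ?case using op_leD[OF con, of v] by (simp add: sqrt_iter.simps(2) sqrt_scalar.simps(2))
next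
  case (Suc n)
  let ?Y = "sqrt_iter R (Suc n)" and ?Z = "sqrt_iter R n"
  let ?y = "sqrt_scalar (Suc n)" and ?z = "sqrt_scalar n"
  define d where "d = ?Y v - ?Z v"
  note lin = adjoint_pair_linear[OF sqrt_iter_adjoint]
  have "?Y (?Y v) - ?Z (?Z v) = ?Y d + ?Z d"
    by (simp add: d_def lin(4) sqrt_iter_commute_iter[of n "Suc n"])
  then have "sqrt_iter R (Suc (Suc n)) v - ?Y v = (1/2) *\<^sub>R (?Y d + ?Z d)"
    by (subst sqrt_iter.simps(2), subst (3) sqrt_iter.simps(2))
      (simp flip: scaleR_diff_right)
  then have "norm (sqrt_iter R (Suc (Suc n)) v - ?Y v) = (1/2) * norm (?Y d + ?Z d)"
    by (simp)
  also have "\<dots> \<le> (1/2) * (?y * norm d + ?z * norm d)"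
    by (intro mult_left_mono order_trans[OF norm_triangle_ineq add_mono] sqrt_iter_norm) simp
  also have "\<dots> = (1/2) * ((?y + ?z) * norm d)" by (simp only: distrib_right)
  also have "\<dots> \<le> (1/2) * ((?y + ?z) * ((?y - ?z) * norm v))"
    using Suc[of v] sqrt_scalar_bounds(1)[of n] sqrt_scalar_bounds(1)[of "Suc n"]
    by (intro mult_left_mono) (auto simp: d_def)
  also have "\<dots> = (sqrt_scalar (Suc (Suc n)) - ?y) * norm v"
  proof -
    have "sqrt_scalar (Suc (Suc n)) - ?y = (1/2) * (?y\<^sup>2 - ?z\<^sup>2)"
      by (subst sqrt_scalar.simps(2), subst (2) sqrt_scalar.simps(2)) (simp add: field_simps)
    moreover have "(y + z) * ((y - z) * N) = (y\<^sup>2 - z\<^sup>2) * N" for y z N :: real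
      by (simp add: power2_eq_square algebra_simps)
    ultimately show ?thesis by (simp only: mult.assoc)
  qed
  finally show ?case .
qed

lemma sqrt_iter_diff:
  assumes "n \<le> m"
  shows "norm (sqrt_iter R m v - sqrt_iter R n v) \<le> (sqrt_scalar m - sqrt_scalar n) * norm v"
  using assms
proof (induction m rule: dec_induct)
  case (step m)
  have "norm (sqrt_iter R (Suc m) v - sqrt_iter R n v)
      \<le> norm (sqrt_iter R (Suc m) v - sqrt_iter R m v) + norm (sqrt_iter R m v - sqrt_iter R n v)"
    by (metis diff_add_cancel add_diff_eq norm_triangle_ineq)
  then show ?case using step(3) sqrt_iter_step[of m v] unfolding left_diff_distrib by linarith
qed simp

lemma sqrt_iter_tendsto: "(\<lambda>n. sqrt_iter R n v) \<longlonglongrightarrow> sqrt_limit R v"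
proof -
  have "Cauchy (\<lambda>n. sqrt_iter R n v)"
  proof (rule CauchyI')
    fix e :: real assume e: "e > 0"
    have "(\<lambda>n. (1 - sqrt_scalar n) * norm v) \<longlonglongrightarrow> (1 - 1) * norm v"
      by (intro tendsto_intros sqrt_scalar_tendsto)
    then have "\<forall>\<^sub>F n in sequentially. (1 - sqrt_scalar n) * norm v < e"
      using e by (intro order_tendstoD(2)) auto
    then obtain N where N: "\<And>n. n \<ge> N \<Longrightarrow> (1 - sqrt_scalar n) * norm v < e"
      by (auto simp: eventually_sequentially)
    have "dist (sqrt_iter R m v) (sqrt_iter R n v) < e" if "m \<ge> N" "m < n" for m n
    proof -
      have "norm (sqrt_iter R n v - sqrt_iter R m v) \<le> (sqrt_scalar n - sqrt_scalar m) * norm v"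
        using that by (intro sqrt_iter_diff) simp
      also have "\<dots> \<le> (1 - sqrt_scalar m) * norm v"
        using sqrt_scalar_bounds by (intro mult_right_mono) auto
      finally show ?thesis using N[of m] that by (simp add: dist_norm norm_minus_commute)
    qed
    then show "\<exists>M. \<forall>m\<ge>M. \<forall>n>m. dist (sqrt_iter R m v) (sqrt_iter R n v) < e" by blast
  qed
  then show ?thesis unfolding sqrt_limit_def by (simp add: Cauchy_convergent_iff convergent_LIMSEQ_iff)
qed

text \<open>The rate \<open>1 - sqrt_scalar n\<close> is the same for every R;
  \<open>strong_family_sqrt_limit\<close> rests on this uniformity over the spectrum.\<close>

lemma sqrt_limit_iter: "norm (sqrt_limit R v - sqrt_iter R n v) \<le> (1 - sqrt_scalar n) * norm v"
proof (rule LIMSEQ_le)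
  show "(\<lambda>m. norm (sqrt_iter R m v - sqrt_iter R n v)) \<longlonglongrightarrow> norm (sqrt_limit R v - sqrt_iter R n v)"
    by (intro tendsto_intros sqrt_iter_tendsto)
  show "(\<lambda>m. (sqrt_scalar m - sqrt_scalar n) * norm v) \<longlonglongrightarrow> (1 - sqrt_scalar n) * norm v"
    by (intro tendsto_intros sqrt_scalar_tendsto)
  show "\<exists>N. \<forall>m\<ge>N. norm (sqrt_iter R m v - sqrt_iter R n v) \<le> (sqrt_scalar m - sqrt_scalar n) * norm v"
    using sqrt_iter_diff by blast
qed

lemma sqrt_limit_adjoint: "adjoint_pair (sqrt_limit R) (sqrt_limit R)"
  unfolding adjoint_pair_def
proof (intro allI)
  fix u v
  have "(\<lambda>n. cinner (sqrt_iter R n u) v) \<longlonglongrightarrow> cinner (sqrt_limit R u) v"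
    "(\<lambda>n. cinner u (sqrt_iter R n v)) \<longlonglongrightarrow> cinner u (sqrt_limit R v)"
    by (intro cinner.tendsto tendsto_const sqrt_iter_tendsto)+
  then show "cinner (sqrt_limit R u) v = cinner u (sqrt_limit R v)"
    using adjoint_pairD[OF sqrt_iter_adjoint] LIMSEQ_unique by (metis (no_types, lifting) ext)
qed

lemma sqrt_limit_le: "op_le (sqrt_limit R) 1"
  using sqrt_limit_iter[of _ 0] by (simp add: op_le_def)

lemma sqrt_limit_commute:
  assumes "adjoint_pair B B'" "op_le B K" "\<And>v. B (R v) = R (B v)"
  shows "B (sqrt_limit R v) = sqrt_limit R (B v)"
proof -
  have "(\<lambda>n. B (sqrt_iter R n v)) \<longlonglongrightarrow> B (sqrt_limit R v)"
    by (intro op_le_tendsto[OF assms(1,2)] sqrt_iter_tendsto)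
  then show ?thesis
    using sqrt_iter_tendsto[of "B v"] LIMSEQ_unique by (simp add: sqrt_iter_commute[OF assms(1,3)])
qed

text \<open>In the limit the recursion becomes 2 Y = R + Y^2, that is (1 - Y)^2 = 1 - R. The
  iterates are contractions, so the inner one may be replaced by its limit before the outer one
  converges.\<close>

lemma sqrt_limit_square:
  "(v - sqrt_limit R v) - sqrt_limit R (v - sqrt_limit R v) = v - R v"
proof -
  let ?Y = "sqrt_limit R"
  have "(\<lambda>n. sqrt_iter R n (sqrt_iter R n v)) \<longlonglongrightarrow> ?Y (?Y v)"
  proof (rule LIM_zero_cancel, rule tendsto_norm_zero_cancel)
    show "(\<lambda>n. norm (sqrt_iter R n (sqrt_iter R n v) - ?Y (?Y v))) \<longlonglongrightarrow> 0"
    proof (rule tendsto_sandwich[OF always_eventually always_eventually tendsto_const])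
      show "\<forall>n. norm (sqrt_iter R n (sqrt_iter R n v) - ?Y (?Y v))
         \<le> norm (sqrt_iter R n v - ?Y v) + norm (sqrt_iter R n (?Y v) - ?Y (?Y v))"
      proof
        fix n
        have le: "norm (sqrt_iter R n (sqrt_iter R n v - ?Y v)) \<le> 1 * norm (sqrt_iter R n v - ?Y v)"
          by (rule order_trans[OF sqrt_iter_norm mult_right_mono]) (auto simp: sqrt_scalar_bounds)
        have eq: "sqrt_iter R n (sqrt_iter R n v) - ?Y (?Y v)
          = sqrt_iter R n (sqrt_iter R n v - ?Y v) + (sqrt_iter R n (?Y v) - ?Y (?Y v))"
          by (simp add: adjoint_pair_linear[OF sqrt_iter_adjoint])
        show "norm (sqrt_iter R n (sqrt_iter R n v) - ?Y (?Y v))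
         \<le> norm (sqrt_iter R n v - ?Y v) + norm (sqrt_iter R n (?Y v) - ?Y (?Y v))"
          by (subst eq, rule norm_triangle_le) (use le in simp)
      qed
      have "(\<lambda>n. norm (sqrt_iter R n v - ?Y v) + norm (sqrt_iter R n (?Y v) - ?Y (?Y v))) \<longlonglongrightarrow>
        norm (?Y v - ?Y v) + norm (?Y (?Y v) - ?Y (?Y v))"
        by (intro tendsto_intros sqrt_iter_tendsto)
      then show "(\<lambda>n. norm (sqrt_iter R n v - ?Y v) + norm (sqrt_iter R n (?Y v) - ?Y (?Y v))) \<longlonglongrightarrow> 0"
        by simp
    qed simp
  qed
  then have "(\<lambda>n. sqrt_iter R (Suc n) v) \<longlonglongrightarrow> (1/2) *\<^sub>R (R v + ?Y (?Y v))"
    unfolding sqrt_iter.simps by (intro tendsto_intros)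
  then have "?Y v = (1/2) *\<^sub>R (R v + ?Y (?Y v))"
    using LIMSEQ_Suc[OF sqrt_iter_tendsto[of v]] LIMSEQ_unique by blast
  then have "2 *\<^sub>R ?Y v = R v + ?Y (?Y v)" by (metis scaleR_half_double scaleR_right_distrib scaleR_2)
  then show ?thesis by (simp add: adjoint_pair_linear[OF sqrt_limit_adjoint] scaleR_2 algebra_simps)
qed

end

subsection \<open>Absolute values\<close>

text \<open>The same form of positivity as in \<open>positive_ops\<close>. The factor s plays the
  role of a square root in the trace estimates.\<close>

definition posop :: "('h::complex_hilbert_space \<Rightarrow> 'h) \<Rightarrow> bool" where
  "posop p \<longleftrightarrow> (\<exists>s s'. adjoint_pair s s' \<and> p = (\<lambda>v. s' (s v)))"

lemma posop_adjoint: "posop p \<Longrightarrow> adjoint_pair p p"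
  unfolding posop_def using adjoint_pair_compose adjoint_pair_sym by blast

lemma posop_nonneg: "posop p \<Longrightarrow> 0 \<le> Re (cinner v (p v))"
  unfolding posop_def using adjoint_pairD by (metis Re_cinner_self zero_le_power2)

lemma posop_real: "posop p \<Longrightarrow> cinner v (p v) = of_real (Re (cinner v (p v)))"
  unfolding posop_def by (metis adjoint_pairD cinner_self Re_complex_of_real)

lemma posop_eq_0:
  assumes "posop p" "Re (cinner v (p v)) = 0"
  shows "p v = 0"
proof -
  obtain s s' where s: "adjoint_pair s s'" "p = (\<lambda>v. s' (s v))" using assms(1) by (auto simp: posop_def)
  have "(norm (s v))\<^sup>2 = 0" using assms(2) by (simp add: s(2) adjoint_pairD[OF s(1), symmetric] Re_cinner_self)
  then show ?thesis using adjoint_pair_linear(5)[OF adjoint_pair_sym[OF s(1)]] by (simp add: s(2))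
qed

lemma norm_abs:
  assumes TS: "adjoint_pair T S" and p: "posop p" "\<And>v. p (p v) = S (T v)"
  shows "norm (p v) = norm (T v)"
proof -
  have "(norm (p v))\<^sup>2 = Re (cinner v (p (p v)))"
    by (subst adjoint_pairD[OF posop_adjoint[OF p(1)], symmetric]) (simp add: Re_cinner_self)
  also have "\<dots> = (norm (T v))\<^sup>2"
    by (simp add: p(2) adjoint_pairD[OF TS, symmetric] Re_cinner_self)
  finally show ?thesis by (simp add: power2_eq_iff_nonneg)
qed

definition abs_complement :: "real \<Rightarrow> ('h::complex_hilbert_space \<Rightarrow> 'h) \<Rightarrow> ('h \<Rightarrow> 'h) \<Rightarrow> 'h \<Rightarrow> 'h" where
  "abs_complement M T S v = v - (1 / M) *\<^sub>R S (T v)"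

text \<open>With R = \<open>abs_complement M T S\<close>, the operator 1 -
  \<open>sqrt_limit R\<close> is the root of 1 - R = S T / M, so this is |T|.\<close>

definition absH :: "real \<Rightarrow> ('h::complex_hilbert_space \<Rightarrow> 'h) \<Rightarrow> ('h \<Rightarrow> 'h) \<Rightarrow> 'h \<Rightarrow> 'h" where
  "absH M T S v = sqrt M *\<^sub>R (v - sqrt_limit (abs_complement M T S) v)"

text \<open>This is |T|^(1/2): \<open>sqrt_limit R\<close> is 1 - |T| / sqrt M, again a self-adjoint
  contraction, so the iteration applies once more. It brings |T| into the form that
  \<open>posop\<close> asks for.\<close>

definition sqrt_absH :: "real \<Rightarrow> ('h::complex_hilbert_space \<Rightarrow> 'h) \<Rightarrow> ('h \<Rightarrow> 'h) \<Rightarrow> 'h \<Rightarrow> 'h" where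
  "sqrt_absH M T S v = sqrt (sqrt M) *\<^sub>R (v - sqrt_limit (sqrt_limit (abs_complement M T S)) v)"

context
  fixes T S :: "'h::complex_hilbert_space \<Rightarrow> 'h" and M :: real
  assumes TS: "adjoint_pair T S" and M: "M > 0" and bd: "\<And>v. (norm (T v))\<^sup>2 \<le> M * (norm v)\<^sup>2"
begin

lemma abs_complement_adjoint: "adjoint_pair (abs_complement M T S) (abs_complement M T S)"
  unfolding abs_complement_def
  using adjoint_pair_diff[OF adjoint_pair_id adjoint_pair_scaleR[OF adjoint_pair_compose[OF adjoint_pair_sym[OF TS] TS]]] .

lemma abs_complement_le: "op_le (abs_complement M T S) 1"
  using contraction_complement[OF TS M bd] by (simp add: op_le_def abs_complement_def)

lemmas abs_limit = sqrt_limit_adjoint[OF abs_complement_adjoint abs_complement_le]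
  sqrt_limit_le[OF abs_complement_adjoint abs_complement_le]

lemma sqrt_absH_adjoint: "adjoint_pair (sqrt_absH M T S) (sqrt_absH M T S)"
  unfolding sqrt_absH_def
  by (intro adjoint_pair_scaleR adjoint_pair_diff adjoint_pair_id sqrt_limit_adjoint abs_limit)

lemma sqrt_absH_square: "sqrt_absH M T S (sqrt_absH M T S v) = absH M T S v"
proof -
  let ?Z = "sqrt_limit (sqrt_limit (abs_complement M T S))"
  have "(v - ?Z v) - ?Z (v - ?Z v) = v - sqrt_limit (abs_complement M T S) v"
    by (rule sqrt_limit_square[OF abs_limit])
  moreover have "?Z (r *\<^sub>R u) = r *\<^sub>R ?Z u" for r u
    by (rule adjoint_pair_linear[OF sqrt_limit_adjoint[OF abs_limit]])
  ultimately show ?thesis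
    using M by (simp add: sqrt_absH_def absH_def flip: scaleR_diff_right)
qed

lemma posop_absH: "posop (absH M T S)"
  unfolding posop_def using sqrt_absH_adjoint sqrt_absH_square by metis

lemma absH_square: "absH M T S (absH M T S v) = S (T v)"
proof -
  let ?Y = "sqrt_limit (abs_complement M T S)"
  have "(v - ?Y v) - ?Y (v - ?Y v) = (1 / M) *\<^sub>R S (T v)"
    using sqrt_limit_square[OF abs_complement_adjoint abs_complement_le, of v] by (simp add: abs_complement_def)
  moreover have "?Y (r *\<^sub>R u) = r *\<^sub>R ?Y u" for r u
    by (rule adjoint_pair_linear[OF abs_limit(1)])
  ultimately show ?thesis
    using M by (simp add: absH_def flip: scaleR_diff_right)
qed

text \<open>A positive root p commutes with p^2 = S T, hence with the limit q built from it. For w =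
  p v - q v this gives (p + q) w = 0; both quadratic forms are nonnegative, so p w = q w = 0 and
  |w|^2 = <v, (p - q) w> = 0.\<close>

lemma absH_unique:
  assumes p: "posop p" "\<And>v. p (p v) = S (T v)"
  shows "p = absH M T S"
proof
  fix v
  let ?q = "absH M T S"
  have q: "posop ?q" by (rule posop_absH)
  note pa = posop_adjoint[OF p(1)] and qa = posop_adjoint[OF q]
  have ple: "op_le p (sqrt M)"
    using bd norm_abs[OF TS p] M by (intro op_le_square) auto
  have com: "p (?q v) = ?q (p v)" for v
  proof -
    have "p (abs_complement M T S v) = abs_complement M T S (p v)" for v
      by (simp add: abs_complement_def adjoint_pair_linear[OF pa] flip: p(2))
    then have "p (sqrt_limit (abs_complement M T S) v) = sqrt_limit (abs_complement M T S) (p v)" for v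
      by (intro sqrt_limit_commute[OF abs_complement_adjoint abs_complement_le pa ple])
    then show ?thesis by (simp add: absH_def adjoint_pair_linear[OF pa])
  qed
  define w where "w = p v - ?q v"
  have "p w + ?q w = 0"
    by (simp add: w_def adjoint_pair_linear[OF pa] adjoint_pair_linear[OF qa] p(2) absH_square com)
  then have "Re (cinner w (p w)) + Re (cinner w (?q w)) = 0"
    by (metis cinner_add_right cinner_zero_right plus_complex.sel(1) zero_complex.sel(1))
  then have "p w = 0" "?q w = 0"
    using posop_nonneg[OF p(1), of w] posop_nonneg[OF q, of w]
    by (auto intro!: posop_eq_0[OF p(1)] posop_eq_0[OF q])
  then have "Re (cinner v (p w - ?q w)) = 0" by simp
  then have "(norm w)\<^sup>2 = 0"
    by (simp add: w_def[symmetric] cinner.diff_right adjoint_pairD[OF pa, symmetric] adjoint_pairD[OF qa, symmetric]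
        Re_cinner_self[symmetric, of w]) (simp add: w_def cinner.diff_left cinner.diff_right)
  then show "p v = ?q v" by (simp add: w_def)
qed

end

section \<open>Absolute values in \<open>hilbert_module\<close> expressed by adjoint pairs\<close>

lemma is_adjoint_hilbert_module:
  "is_adjoint hilbert_module hilbert_module T S \<longleftrightarrow> adjoint_pair T S"
  by (simp add: is_adjoint_def hilbert_module_def adjoint_pair_def)

lemma adj_hilbert_module: "adjoint_pair T S \<Longrightarrow> adj hilbert_module hilbert_module T = S"
  unfolding adj_def is_adjoint_hilbert_module using adjoint_pair_unique by blast

lemma positive_ops_hilbert_module:
  "positive_ops hilbert_module = Collect (posop :: ('h::complex_hilbert_space \<Rightarrow> 'h) \<Rightarrow> bool)"
proof -
  have m: "mcarrier hilbert_module = (UNIV :: 'h set)" by (simp add: hilbert_module_def)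
  have "adjointable hilbert_module hilbert_module = {s. \<exists>s'. adjoint_pair (s::'h \<Rightarrow> 'h) s'}"
    by (simp add: adjointable_def is_adjoint_hilbert_module m)
  then have "positive_ops hilbert_module = {compose UNIV (adj hilbert_module hilbert_module s) s |s::'h \<Rightarrow> 'h. \<exists>s'. adjoint_pair s s'}"
    by (simp add: positive_ops_def m)
  also have "\<dots> = Collect posop"
    by (force simp: posop_def compose_def adj_hilbert_module)
  finally show ?thesis .
qed

lemma abs_op_hilbert_module:
  fixes T :: "'h::complex_hilbert_space \<Rightarrow> 'h"
  assumes "adjoint_pair T S" "M > 0" "\<And>v. (norm (T v))\<^sup>2 \<le> M * (norm v)\<^sup>2"
  shows "abs_op hilbert_module T = absH M T S"
proof -
  have m: "mcarrier hilbert_module = (UNIV :: 'h set)" by (simp add: hilbert_module_def)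
  have "abs_op hilbert_module T = (THE p. posop p \<and> (\<forall>v. p (p v) = S (T v)))"
    by (simp add: abs_op_def positive_ops_hilbert_module m adj_hilbert_module[OF assms(1)] compose_def fun_eq_iff)
  also have "\<dots> = absH M T S"
    by (rule the_equality) (simp add: posop_absH[OF assms] absH_square[OF assms], elim conjE, rule absH_unique[OF assms], simp_all)
  finally show ?thesis .
qed

subsection \<open>Approximate polar decomposition\<close>

text \<open>G is the inverse of p + e; its value at v is the fixed point of w |-> w + (v - (p + e)
  w) / c.\<close>

lemma exists_resolvent:
  fixes p :: "'h::complex_hilbert_space \<Rightarrow> 'h"
  assumes p: "posop p" and K: "\<And>v. Re (cinner v (p v)) \<le> K * (norm v)\<^sup>2" "K > 0" and e: "e > 0"
  obtains G where "adjoint_pair G G" "\<And>v. p (G v) + e *\<^sub>R G v = v" "\<And>v. G (p v) + e *\<^sub>R G v = v"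
    "\<And>v. norm (p (G v)) \<le> norm v"
proof -
  note pa = posop_adjoint[OF p]
  note plin = adjoint_pair_linear[OF pa]
  \<comment> \<open>The cross term is nonnegative because p is positive. The estimate yields both
    the injectivity of p + e and the bound on p G.\<close>
  have lower: "(norm (p w))\<^sup>2 + e\<^sup>2 * (norm w)\<^sup>2 \<le> (norm (p w + e *\<^sub>R w))\<^sup>2" for w
  proof -
    have "Re (cinner (p w) (e *\<^sub>R w)) = e * Re (cinner w (p w))"
      by (simp add: cinner_scaleR_right adjoint_pairD[OF pa])
    then show ?thesis
      using posop_nonneg[OF p, of w] e by (simp add: norm_add_square power_mult_distrib)
  qed
  obtain s s' where s: "adjoint_pair s s'" "p = (\<lambda>v. s' (s v))" using p by (auto simp: posop_def)
  have sb: "(norm (s v))\<^sup>2 \<le> K * (norm v)\<^sup>2" for v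
    using K(1)[of v] by (simp add: s(2) adjoint_pairD[OF s(1), symmetric] Re_cinner_self)
  \<comment> \<open>With this c, 1 - (p + e) / c is K / c times the contraction 1 - p / K, whence
    the Lipschitz constant K / c, which is below 1.\<close>
  define c where "c = K + e"
  have c: "c > 0" using K e by (simp add: c_def)
  have "\<exists>!w. (1 / c) *\<^sub>R v + (w - (1 / c) *\<^sub>R (p w + e *\<^sub>R w)) = w" for v
  proof (rule banach_fix_type[of "K / c"], goal_cases)
    case 3
    show ?case
    proof (intro allI)
      fix w u :: 'h
      define d where "d = w - u"
      have "(1 / c) *\<^sub>R v + (w - (1 / c) *\<^sub>R (p w + e *\<^sub>R w)) - ((1 / c) *\<^sub>R v + (u - (1 / c) *\<^sub>R (p u + e *\<^sub>R u)))
         = d - (1 / c) *\<^sub>R (p d + e *\<^sub>R d)"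
        by (simp add: d_def plin scaleR_diff_right scaleR_add_right)
      also have "\<dots> = (1 - e / c) *\<^sub>R d - (1 / c) *\<^sub>R p d"
        by (simp add: scaleR_add_right scaleR_diff_left)
      also have "1 - e / c = K / c" using c by (simp add: c_def field_simps)
      also have "(K / c) *\<^sub>R d - (1 / c) *\<^sub>R p d = (K / c) *\<^sub>R (d - (1 / K) *\<^sub>R p d)"
        using K by (simp add: scaleR_diff_right)
      finally have "dist ((1 / c) *\<^sub>R v + (w - (1 / c) *\<^sub>R (p w + e *\<^sub>R w))) ((1 / c) *\<^sub>R v + (u - (1 / c) *\<^sub>R (p u + e *\<^sub>R u)))
        = K / c * norm (d - (1 / K) *\<^sub>R s' (s d))"
        using K c by (simp add: dist_norm s(2))
      also have "\<dots> \<le> K / c * norm d"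
        using contraction_complement[OF s(1) K(2) sb] K c by (intro mult_left_mono) auto
      finally show "dist ((1 / c) *\<^sub>R v + (w - (1 / c) *\<^sub>R (p w + e *\<^sub>R w))) ((1 / c) *\<^sub>R v + (u - (1 / c) *\<^sub>R (p u + e *\<^sub>R u)))
         \<le> K / c * dist w u"
        by (simp add: d_def dist_norm)
    qed
  qed (use K e c in \<open>auto simp: c_def\<close>)
  then have "\<forall>v. \<exists>w. p w + e *\<^sub>R w = v"
  proof (intro allI)
    fix v
    assume *: "\<And>v. \<exists>!w. (1 / c) *\<^sub>R v + (w - (1 / c) *\<^sub>R (p w + e *\<^sub>R w)) = w"
    obtain w where "(1 / c) *\<^sub>R v + (w - (1 / c) *\<^sub>R (p w + e *\<^sub>R w)) = w" using *[of v] by blast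
    then have "(1 / c) *\<^sub>R v = (1 / c) *\<^sub>R (p w + e *\<^sub>R w)" by (simp add: algebra_simps)
    then show "\<exists>w. p w + e *\<^sub>R w = v" using c by auto
  qed
  then obtain G where G: "\<And>v. p (G v) + e *\<^sub>R G v = v" by metis
  have inj: "w = 0" if "p w + e *\<^sub>R w = 0" for w
  proof -
    have "e\<^sup>2 * (norm w)\<^sup>2 \<le> 0" using lower[of w] zero_le_power2[of "norm (p w)"] unfolding that by (simp only: norm_zero zero_power2)
    then show ?thesis using e by (simp add: mult_le_0_iff)
  qed
  have pe: "adjoint_pair (\<lambda>v. p v + e *\<^sub>R v) (\<lambda>v. p v + e *\<^sub>R v)"
    using adjoint_pair_add[OF pa adjoint_pair_scaleR[OF adjoint_pair_id]] .
  have Ga: "adjoint_pair G G"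
    unfolding adjoint_pair_def
  proof (intro allI)
    fix u v
    have "cinner (G u) v = cinner (G u) (p (G v) + e *\<^sub>R G v)" by (simp only: G)
    also have "\<dots> = cinner (p (G u) + e *\<^sub>R G u) (G v)" using adjoint_pairD[OF pe] by metis
    finally show "cinner (G u) v = cinner u (G v)" by (simp only: G)
  qed
  have G2: "G (p v) + e *\<^sub>R G v = v" for v
  proof -
    define w where "w = (G (p v) + e *\<^sub>R G v) - v"
    have "p w + e *\<^sub>R w = (p (G (p v)) + e *\<^sub>R G (p v)) + e *\<^sub>R (p (G v) + e *\<^sub>R G v) - (p v + e *\<^sub>R v)"
      by (simp add: w_def plin scaleR_add_right scaleR_diff_right)
    also have "\<dots> = 0" by (simp only: G) simp
    finally show ?thesis using inj[of w] by (simp add: w_def)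
  qed
  have "norm (p (G v)) \<le> norm v" for v
  proof (rule power2_le_imp_le)
    have "0 \<le> e\<^sup>2 * (norm (G v))\<^sup>2" by simp
    then show "(norm (p (G v)))\<^sup>2 \<le> (norm v)\<^sup>2" using lower[of "G v"] unfolding G by linarith
  qed simp
  then show ?thesis using that Ga G G2 by blast
qed

definition abs_of :: "('h::complex_hilbert_space \<Rightarrow> 'h) \<Rightarrow> ('h \<Rightarrow> 'h) \<Rightarrow> ('h \<Rightarrow> 'h) \<Rightarrow> bool" where
  "abs_of T S p \<longleftrightarrow> adjoint_pair T S \<and> (\<exists>K>0. op_le T K) \<and> posop p \<and> (\<forall>v. p (p v) = S (T v))"

lemma abs_ofD:
  assumes "abs_of T S p"
  shows "adjoint_pair T S" "posop p" "\<And>v. p (p v) = S (T v)" "\<exists>K>0. op_le T K"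
  using assms by (auto simp: abs_of_def)

lemma norm_abs_of:
  assumes "abs_of T S p"
  shows "norm (p v) = norm (T v)"
  using norm_abs[OF abs_ofD(1-3)[OF assms]] .

text \<open>V = T G with G = (p + e)^-1. It is a contraction since |T G v| = |p G v|, the identity T
  = V (p + e) holds by construction, and p - V' T = p - G p^2 = e G p.\<close>

lemma polar_approx:
  assumes T: "abs_of T S p" and e: "e > 0"
  obtains V V' where "adjoint_pair V V'" "op_le V 1" "\<And>v. T v = V (p v) + e *\<^sub>R V v"
    "\<And>v. norm (p v - V' (T v)) \<le> e * norm v"
proof -
  note TS = abs_ofD(1)[OF T] and p = abs_ofD(2)[OF T] and pp = abs_ofD(3)[OF T]
  note Tlin = adjoint_pair_linear[OF TS]
  obtain K where K: "K > 0" "op_le T K" using abs_ofD(4)[OF T] by blast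
  have "Re (cinner v (p v)) \<le> K * (norm v)\<^sup>2" for v
  proof -
    have "Re (cinner v (p v)) \<le> norm v * norm (p v)"
      using norm_cinner_le[of v "p v"] complex_Re_le_cmod[of "cinner v (p v)"] by linarith
    also have "\<dots> \<le> norm v * (K * norm v)"
      unfolding norm_abs_of[OF T] by (intro mult_left_mono op_leD[OF K(2)]) simp
    finally show ?thesis by (simp add: power2_eq_square ac_simps)
  qed
  then obtain G where G: "adjoint_pair G G" "\<And>v. p (G v) + e *\<^sub>R G v = v" "\<And>v. G (p v) + e *\<^sub>R G v = v"
    "\<And>v. norm (p (G v)) \<le> norm v"
    using exists_resolvent[OF p _ K(1) e] by metis
  show ?thesis
  proof (rule that)
    show "adjoint_pair (\<lambda>v. T (G v)) (\<lambda>v. G (S v))" by (rule adjoint_pair_compose[OF TS G(1)])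
    show "op_le (\<lambda>v. T (G v)) 1" using G(4) norm_abs_of[OF T] by (simp add: op_le_def)
    show "T v = T (G (p v)) + e *\<^sub>R T (G v)" for v
      by (simp add: G(3) flip: Tlin)
    fix v
    have comm: "G (p v) = p (G v)" using G(2)[of v] G(3)[of v] by (metis add_right_cancel)
    have "p v - G (S (T v)) = e *\<^sub>R G (p v)"
      using G(3)[of "p v"] by (simp add: pp[symmetric] algebra_simps)
    then show "norm (p v - G (S (T v))) \<le> e * norm v"
      using G(4)[of v] e by (simp add: comm)
  qed
qed

subsection \<open>Traces along Parseval frames\<close>

text \<open>No orthonormality, because a frame of multipliers localises to a Parseval frame in
  general, and because a basis padded with zeros is still one.\<close>

definition parseval :: "(nat \<Rightarrow> 'h::complex_hilbert_space) \<Rightarrow> bool" where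
  "parseval g \<longleftrightarrow> (\<forall>v. (\<lambda>i. (cmod (cinner (g i) v))\<^sup>2) sums (norm v)\<^sup>2)"

lemma suminf_ennreal_commute:
  fixes F :: "nat \<Rightarrow> nat \<Rightarrow> ennreal"
  shows "(\<Sum>i. \<Sum>j. F i j) = (\<Sum>j. \<Sum>i. F i j)"
proof -
  have "(\<Sum>i. \<Sum>j. F i j) = (\<integral>\<^sup>+i. (\<Sum>j. F i j) \<partial>count_space UNIV)"
    by (simp add: nn_integral_count_space_nat)
  also have "\<dots> = (\<Sum>j. \<integral>\<^sup>+i. F i j \<partial>count_space UNIV)"
    by (rule nn_integral_suminf) simp
  finally show ?thesis by (simp add: nn_integral_count_space_nat)
qed

text \<open>Both sides are the double sum of |<f_j, s g_i>|^2, taken in the two orders. In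
  \<open>ennreal\<close> the exchange raises no question of convergence.\<close>

lemma parseval_swap:
  assumes f: "parseval f" and g: "parseval g" and s: "adjoint_pair s s'"
  shows "(\<Sum>i. ennreal ((norm (s (g i)))\<^sup>2)) = (\<Sum>j. ennreal ((norm (s' (f j)))\<^sup>2))"
proof -
  have "(\<Sum>i. ennreal ((norm (s (g i)))\<^sup>2)) = (\<Sum>i. \<Sum>j. ennreal ((cmod (cinner (f j) (s (g i))))\<^sup>2))"
    using f by (intro suminf_cong suminf_ennreal_eq[symmetric]) (auto simp: parseval_def)
  also have "\<dots> = (\<Sum>j. \<Sum>i. ennreal ((cmod (cinner (f j) (s (g i))))\<^sup>2))"
    by (rule suminf_ennreal_commute)
  also have "\<dots> = (\<Sum>j. \<Sum>i. ennreal ((cmod (cinner (g i) (s' (f j))))\<^sup>2))"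
  proof (intro suminf_cong arg_cong[where f = ennreal] arg_cong[where f = "\<lambda>x. x\<^sup>2"])
    fix i j
    show "cmod (cinner (f j) (s (g i))) = cmod (cinner (g i) (s' (f j)))"
      using adjoint_pairD[OF s, of "g i" "f j"] cinner_commute[of "f j" "s (g i)"] by simp
  qed
  also have "\<dots> = (\<Sum>j. ennreal ((norm (s' (f j)))\<^sup>2))"
    using g by (intro suminf_cong suminf_ennreal_eq) (auto simp: parseval_def)
  finally show ?thesis .
qed

text \<open>With p = \<open>s' s\<close>, both traces equal the sum of |s' f_j|^2 by
  \<open>parseval_swap\<close>.\<close>

lemma parseval_trace:
  assumes f: "parseval f" and g: "parseval g" and p: "posop p"
  shows "(\<Sum>i. ennreal (Re (cinner (g i) (p (g i))))) = (\<Sum>i. ennreal (Re (cinner (f i) (p (f i)))))"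
proof -
  obtain s s' where s: "adjoint_pair s s'" "p = (\<lambda>v. s' (s v))" using p by (auto simp: posop_def)
  have "Re (cinner v (p v)) = (norm (s v))\<^sup>2" for v
    by (simp add: s(2) adjoint_pairD[OF s(1), symmetric] Re_cinner_self)
  then show ?thesis
    using parseval_swap[OF f g s(1)] parseval_swap[OF f f s(1)] by simp
qed

lemma sums_of_ennreal_suminf:
  assumes "\<And>i. 0 \<le> f i" "x \<ge> 0" "(\<Sum>i. ennreal (f i)) = ennreal x"
  shows "f sums x"
proof -
  have s: "summable f" using assms by (intro summable_suminf_not_top) auto
  then have "(\<Sum>i. ennreal (f i)) = ennreal (suminf f)"
    using assms by (intro suminf_ennreal_eq summable_sums) auto
  then have "ennreal (suminf f) = ennreal x" by (simp only: assms(3))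
  then have "suminf f = x" by (simp only: ennreal_inj suminf_nonneg[OF s assms(1)] assms(2))
  then show ?thesis using s by (simp add: sums_iff)
qed

lemma parseval_trace_sums:
  assumes f: "parseval f" and g: "parseval g" and p: "posop p"
    and s: "(\<lambda>i. Re (cinner (g i) (p (g i)))) sums x"
  shows "(\<lambda>i. Re (cinner (f i) (p (f i)))) sums x"
proof (rule sums_of_ennreal_suminf)
  show "0 \<le> Re (cinner (f i) (p (f i)))" for i by (rule posop_nonneg[OF p])
  show "0 \<le> x" using posop_nonneg[OF p] s by (intro sums_le[OF _ sums_zero s]) auto
  show "(\<Sum>i. ennreal (Re (cinner (f i) (p (f i))))) = ennreal x"
    unfolding parseval_trace[OF g f p] by (rule suminf_ennreal_eq[OF posop_nonneg[OF p] s])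
qed

lemma le_of_le_add_mult_eps:
  fixes x y c :: real
  assumes "\<And>e. e > 0 \<Longrightarrow> x \<le> y + e * c" "c \<ge> 0"
  shows "x \<le> y"
proof (cases "c = 0")
  case True
  then show ?thesis using assms(1)[of 1] by simp
next
  case False
  show ?thesis
  proof (rule field_le_epsilon)
    fix e :: real assume "e > 0"
    then show "x \<le> y + e" using assms(1)[of "e / c"] False \<open>c \<ge> 0\<close> by simp
  qed
qed

text \<open>T is V p up to \<epsilon> and p = \<open>s' s\<close>, so <W v, T v> is nearly <s V' W
  v, s v>, and Cauchy-Schwarz over F applies. Only the first factor is enlarged to the whole basis;
  with F kept in the second one, tails of the trace appear when F avoids the first n
  vectors.\<close>

lemma sum_cinner_abs_le:
  assumes T: "abs_of T S p" and e: "parseval e"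
    and tr: "(\<lambda>i. Re (cinner (e i) (p (e i)))) sums \<tau>"
    and W: "adjoint_pair W W'" "op_le W 1" and F: "finite F"
  shows "(\<Sum>i\<in>F. cmod (cinner (W (e i)) (T (e i)))) \<le> sqrt \<tau> * sqrt (\<Sum>i\<in>F. Re (cinner (e i) (p (e i))))"
proof (rule le_of_le_add_mult_eps)
  show "0 \<le> (\<Sum>i\<in>F. (norm (e i))\<^sup>2)" by (intro sum_nonneg) auto
  note p = abs_ofD(2)[OF T]
  obtain s s' where s: "adjoint_pair s s'" "p = (\<lambda>v. s' (s v))" using p by (auto simp: posop_def)
  have ps: "Re (cinner v (p v)) = (norm (s v))\<^sup>2" for v
    by (simp add: s(2) adjoint_pairD[OF s(1), symmetric] Re_cinner_self)
  have \<tau>0: "0 \<le> \<tau>" using posop_nonneg[OF p] by (intro sums_le[OF _ sums_zero tr]) auto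
  fix \<epsilon> :: real assume eps: "\<epsilon> > 0"
  obtain V V' where V: "adjoint_pair V V'" "op_le V 1" "\<And>v. T v = V (p v) + \<epsilon> *\<^sub>R V v"
    using polar_approx[OF T eps] by metis
  have V': "op_le V' 1" by (rule op_le_adjoint[OF V(1,2)])
  have W': "op_le W' 1" by (rule op_le_adjoint[OF W])
  let ?B = "\<lambda>v. s (V' (W v))"
  have trm: "cmod (cinner (W v) (T v)) \<le> norm (?B v) * norm (s v) + \<epsilon> * (norm v)\<^sup>2" for v
  proof -
    have "cinner (W v) (T v) = cinner (?B v) (s v) + \<epsilon> * cinner (W v) (V v)"
      by (simp add: V(3) cinner_add_right cinner_scaleR_right adjoint_pairD'[OF V(1)] s(2) adjoint_pairD[OF s(1)])
    then have "cmod (cinner (W v) (T v)) \<le> cmod (cinner (?B v) (s v)) + cmod (\<epsilon> * cinner (W v) (V v))"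
      by (metis norm_triangle_ineq)
    also have "\<dots> \<le> norm (?B v) * norm (s v) + \<epsilon> * (norm (W v) * norm (V v))"
      using eps norm_cinner_le[of "?B v" "s v"] norm_cinner_le[of "W v" "V v"]
      by (intro add_mono) (auto simp: norm_mult)
    also have "norm (W v) * norm (V v) \<le> norm v * norm v"
      using op_leD[OF W(2), of v] op_leD[OF V(2), of v] by (intro mult_mono) auto
    finally show ?thesis using eps by (simp add: power2_eq_square)
  qed
  \<comment> \<open>In the adjoint W' V s' the contractions stand on the left, where they can only
    decrease norms; hence the passage to the adjoint and back.\<close>
  have "adjoint_pair ?B (\<lambda>v. W' (V (s' v)))"
    using adjoint_pair_compose[OF s(1) adjoint_pair_compose[OF adjoint_pair_sym[OF V(1)] W(1)]] .
  then have "(\<Sum>i. ennreal ((norm (?B (e i)))\<^sup>2)) = (\<Sum>i. ennreal ((norm (W' (V (s' (e i)))))\<^sup>2))"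
    by (rule parseval_swap[OF e e])
  also have "\<dots> \<le> (\<Sum>i. ennreal ((norm (s' (e i)))\<^sup>2))"
  proof (intro suminf_le ennreal_leI power_mono)
    fix i
    show "norm (W' (V (s' (e i)))) \<le> norm (s' (e i))"
      using op_leD[OF W', of "V (s' (e i))"] op_leD[OF V(2), of "s' (e i)"] by simp
  qed auto
  also have "\<dots> = (\<Sum>i. ennreal ((norm (s (e i)))\<^sup>2))"
    by (rule parseval_swap[OF e e s(1), symmetric])
  also have "\<dots> = ennreal \<tau>"
    using tr by (intro suminf_ennreal_eq) (auto simp: ps)
  finally have BB: "(\<Sum>i. ennreal ((norm (?B (e i)))\<^sup>2)) \<le> ennreal \<tau>" .
  have "ennreal (\<Sum>i\<in>F. (norm (?B (e i)))\<^sup>2) = (\<Sum>i\<in>F. ennreal ((norm (?B (e i)))\<^sup>2))"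
    by (simp add: sum_ennreal)
  also have "\<dots> \<le> (\<Sum>i. ennreal ((norm (?B (e i)))\<^sup>2))"
    using F by (intro sum_le_suminf) auto
  finally have "ennreal (\<Sum>i\<in>F. (norm (?B (e i)))\<^sup>2) \<le> ennreal \<tau>" using BB by simp
  then have "(\<Sum>i\<in>F. (norm (?B (e i)))\<^sup>2) \<le> \<tau>" using \<tau>0 by (simp add: ennreal_le_iff)
  then have LB: "L2_set (\<lambda>i. norm (?B (e i))) F \<le> sqrt \<tau>" by (simp add: L2_set_def)
  have "(\<Sum>i\<in>F. cmod (cinner (W (e i)) (T (e i))))
    \<le> (\<Sum>i\<in>F. \<bar>norm (?B (e i))\<bar> * \<bar>norm (s (e i))\<bar> + \<epsilon> * (norm (e i))\<^sup>2)"
    using trm by (intro sum_mono) simp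
  also have "\<dots> = (\<Sum>i\<in>F. \<bar>norm (?B (e i))\<bar> * \<bar>norm (s (e i))\<bar>) + \<epsilon> * (\<Sum>i\<in>F. (norm (e i))\<^sup>2)"
    by (simp add: sum.distrib sum_distrib_left)
  also have "(\<Sum>i\<in>F. \<bar>norm (?B (e i))\<bar> * \<bar>norm (s (e i))\<bar>)
      \<le> L2_set (\<lambda>i. norm (?B (e i))) F * L2_set (\<lambda>i. norm (s (e i))) F"
    by (rule L2_set_mult_ineq)
  also have "\<dots> \<le> sqrt \<tau> * L2_set (\<lambda>i. norm (s (e i))) F"
    by (intro mult_right_mono LB) simp
  finally show "(\<Sum>i\<in>F. cmod (cinner (W (e i)) (T (e i))))
     \<le> sqrt \<tau> * sqrt (\<Sum>i\<in>F. Re (cinner (e i) (p (e i)))) + \<epsilon> * (\<Sum>i\<in>F. (norm (e i))\<^sup>2)"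
    by (simp add: L2_set_def ps)
qed

text \<open>The counterpart of \<open>sum_cinner_abs_le\<close>: if W is the approximate polar part
  of T, the sum is nearly the trace of p. A bound valid for all contractions W thus passes to the
  trace norm.\<close>

lemma sum_abs_le:
  assumes T: "abs_of T S p"
    and C: "\<And>W W'. adjoint_pair W W' \<Longrightarrow> op_le W 1 \<Longrightarrow> (\<Sum>i\<in>F. cmod (cinner (W (e i)) (T (e i)))) \<le> C"
  shows "(\<Sum>i\<in>F. Re (cinner (e i) (p (e i)))) \<le> C"
proof (rule le_of_le_add_mult_eps)
  show "0 \<le> (\<Sum>i\<in>F. (norm (e i))\<^sup>2)" by (intro sum_nonneg) auto
  fix \<epsilon> :: real assume eps: "\<epsilon> > 0"
  obtain V V' where V: "adjoint_pair V V'" "op_le V 1" "\<And>v. norm (p v - V' (T v)) \<le> \<epsilon> * norm v"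
    using polar_approx[OF T eps] by metis
  have "Re (cinner v (p v)) \<le> cmod (cinner (V v) (T v)) + \<epsilon> * (norm v)\<^sup>2" for v
  proof -
    have "cinner v (p v) = cinner (V v) (T v) + cinner v (p v - V' (T v))"
      by (simp add: cinner.diff_right adjoint_pairD[OF V(1)])
    then have "cmod (cinner v (p v)) \<le> cmod (cinner (V v) (T v)) + cmod (cinner v (p v - V' (T v)))"
      by (metis norm_triangle_ineq)
    moreover have "cmod (cinner v (p v - V' (T v))) \<le> norm v * (\<epsilon> * norm v)"
      using norm_cinner_le[of v "p v - V' (T v)"] V(3)[of v] by (meson mult_left_mono norm_ge_zero order_trans)
    ultimately show ?thesis
      using complex_Re_le_cmod[of "cinner v (p v)"] by (simp add: power2_eq_square ac_simps)
  qed
  then have "(\<Sum>i\<in>F. Re (cinner (e i) (p (e i)))) \<le> (\<Sum>i\<in>F. cmod (cinner (V (e i)) (T (e i))) + \<epsilon> * (norm (e i))\<^sup>2)"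
    by (intro sum_mono)
  also have "\<dots> = (\<Sum>i\<in>F. cmod (cinner (V (e i)) (T (e i)))) + \<epsilon> * (\<Sum>i\<in>F. (norm (e i))\<^sup>2)"
    by (simp add: sum.distrib sum_distrib_left)
  finally show "(\<Sum>i\<in>F. Re (cinner (e i) (p (e i)))) \<le> C + \<epsilon> * (\<Sum>i\<in>F. (norm (e i))\<^sup>2)"
    using C[OF V(1,2)] by linarith
qed

subsection \<open>Orthonormal bases\<close>

definition orthonormal :: "'h::complex_hilbert_space set \<Rightarrow> bool" where
  "orthonormal B \<longleftrightarrow> (\<forall>e\<in>B. \<forall>f\<in>B. cinner e f = (if e = f then 1 else 0))"

lemma exists_orthonormal_basis: "\<exists>B. orthonormal_basis (B :: 'h::complex_hilbert_space set)"
proof -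
  have "\<exists>M\<in>Collect orthonormal. \<forall>X\<in>Collect orthonormal. M \<subseteq> X \<longrightarrow> X = (M :: 'h set)"
  proof (rule subset_Zorn')
    fix C :: "'h set set" assume C: "subset.chain (Collect orthonormal) C"
    have "cinner e f = (if e = f then 1 else 0)" if "X \<in> C" "e \<in> X" "Y \<in> C" "f \<in> Y" for X Y e f
    proof -
      have "X \<subseteq> Y \<or> Y \<subseteq> X" using C that by (auto simp: subset.chain_def)
      then obtain Z where "Z \<in> C" "e \<in> Z" "f \<in> Z" using \<open>X \<in> C\<close> \<open>e \<in> X\<close> \<open>Y \<in> C\<close> \<open>f \<in> Y\<close> by blast
      moreover have "orthonormal Z" using C \<open>Z \<in> C\<close> by (auto simp: subset.chain_def)
      ultimately show ?thesis by (simp add: orthonormal_def)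
    qed
    then show "\<Union>C \<in> Collect orthonormal" by (auto simp: orthonormal_def)
  qed
  then obtain M :: "'h set" where M: "orthonormal M" and max: "\<And>X. orthonormal X \<Longrightarrow> M \<subseteq> X \<Longrightarrow> X = M" by auto
  have "v = 0" if v: "\<And>e. e \<in> M \<Longrightarrow> cinner e v = 0" for v
  proof (rule ccontr)
    assume "v \<noteq> 0"
    define u where "u = (1 / norm v) *\<^sub>R v"
    have "cinner u u = 1" using \<open>v \<noteq> 0\<close> by (simp add: u_def cinner_self)
    moreover have eu: "cinner e u = 0" "cinner u e = 0" if "e \<in> M" for e
      using v[OF that] cinner_commute[of v e] by (simp_all add: u_def cinner_scaleR_right cinner_scaleR_left)
    moreover have "u \<notin> M" using eu(1)[of u] \<open>cinner u u = 1\<close> by auto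
    ultimately have "orthonormal (insert u M)" using M by (auto simp: orthonormal_def)
    then have "u \<in> M" using max[of "insert u M"] by blast
    then show False using \<open>u \<notin> M\<close> by simp
  qed
  then have "orthonormal_basis M" using M by (auto simp: orthonormal_basis_def orthonormal_def)
  then show ?thesis by blast
qed

lemma orthonormal_basis_some_basis: "orthonormal_basis some_basis"
  unfolding some_basis_def by (rule someI_ex[OF exists_orthonormal_basis])

text \<open>Distinct elements of B are sqrt 2 apart, so points of a countable dense set within 1/2
  of them tell them apart.\<close>

lemma countable_orthonormal:
  fixes B :: "'h::complex_hilbert_space set"
  assumes sep: "separable_space (euclidean :: 'h topology)" and B: "orthonormal B"
  shows "countable B"
proof -
  obtain D :: "'h set" where D: "countable D" "closure D = UNIV"
    using sep by (auto simp: separable_space_def)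
  have "\<exists>d\<in>D. dist d e < 1 / 2" for e
    using D(2) closure_approachable[of e D] by (metis UNIV_I half_gt_zero_iff zero_less_one)
  then obtain d where d: "\<And>e. d e \<in> D" "\<And>e. dist (d e) e < 1 / 2" by metis
  have "inj_on d B"
  proof (rule inj_onI, rule ccontr)
    fix e f assume ef: "e \<in> B" "f \<in> B" "d e = d f" "e \<noteq> f"
    have "norm e = 1" "norm f = 1"
    proof -
      have "complex_of_real ((norm e)\<^sup>2) = 1" "complex_of_real ((norm f)\<^sup>2) = 1"
        using B ef by (simp_all only: cinner_self[symmetric] orthonormal_def) simp_all
      then have "(norm e)\<^sup>2 = 1" "(norm f)\<^sup>2 = 1" by (simp_all only: of_real_eq_1_iff)
      then show "norm e = 1" "norm f = 1" by (simp_all add: power2_eq_1_iff) (metis norm_ge_zero one_neq_neg_one neg_0_le_iff_le not_one_le_zero)+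
    qed
    moreover have "cinner e f = 0" using B ef by (simp add: orthonormal_def)
    ultimately have "(norm (e - f))\<^sup>2 = 2" by (simp add: norm_diff_square)
    moreover have "norm (e - f) < 1"
      using d(2)[of e] d(2)[of f] dist_triangle3[of e f "d e"] unfolding ef(3) by (simp add: dist_norm)
    then have "(norm (e - f))\<^sup>2 \<le> 1" by (simp add: power_le_one)
    ultimately show False by simp
  qed
  moreover have "countable (d ` B)" using D(1) d(1) by (meson countable_subset image_subsetI)
  ultimately show ?thesis by (rule countable_image_inj_on[rotated])
qed

text \<open>The basis is enumerated with zeros as padding, so that finite bases need no separate treatment.\<close>

definition basis_enum :: "(nat \<Rightarrow> 'h::complex_hilbert_space) \<Rightarrow> bool" where
  "basis_enum e \<longleftrightarrow> parseval e \<and> (\<forall>r x. r 0 = 0 \<longrightarrow> (\<forall>v. 0 \<le> r v) \<longrightarrow>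
     (((\<lambda>v. complex_of_real (r v)) has_sum complex_of_real x) some_basis \<longleftrightarrow> (\<lambda>i. r (e i)) sums x))"

text \<open>The partial sums \<open>P n\<close> of the expansion are Cauchy by Bessel's inequality.
  Their limit has the coefficients of v, and totality identifies it with v.\<close>

lemma parseval_of_total:
  fixes e :: "nat \<Rightarrow> 'h::complex_hilbert_space"
  assumes orth: "\<And>i j. cinner (e i) (e j) = (if i = j \<and> e i \<noteq> 0 then 1 else 0)"
    and total: "\<And>v. (\<And>i. cinner (e i) v = 0) \<Longrightarrow> v = 0"
  shows "parseval e"
  unfolding parseval_def
proof
  fix v :: 'h
  define c where "c i = cinner (e i) v" for i
  define P where "P n = (\<Sum>i<n. c i *\<^sub>C e i)" for n
  have eP: "cinner (e i) (P n) = (if i < n then c i else 0)" for i n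
  proof -
    have "cinner (e i) (P n) = (\<Sum>j<n. c j * cinner (e i) (e j))"
      by (simp add: P_def cinner.sum_right cinner_scaleC_right)
    also have "\<dots> = (\<Sum>j<n. if j = i then c i else 0)"
      by (intro sum.cong refl) (auto simp: orth c_def)
    also have "\<dots> = (if i < n then c i else 0)" by (simp add: sum.delta')
    finally show ?thesis .
  qed
  have Pv: "Re (cinner (P n) v) = (\<Sum>i<n. (cmod (c i))\<^sup>2)" for n
    by (simp add: P_def cinner.sum_left cinner_scaleC_left Re_sum c_def[symmetric] cmod_power2 flip: power2_eq_square)
  have PP: "Re (cinner (P n) (P m)) = (\<Sum>i<n. (cmod (c i))\<^sup>2)" if "n \<le> m" for n m
  proof -
    have "cinner (P n) (P m) = (\<Sum>i<n. cnj (c i) * cinner (e i) (P m))"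
      by (simp only: P_def[of n] cinner.sum_left cinner_scaleC_left)
    also have "\<dots> = (\<Sum>i<n. cnj (c i) * c i)" using that by (intro sum.cong refl) (auto simp: eP)
    finally show ?thesis by (simp add: Re_sum cmod_power2 flip: power2_eq_square)
  qed
  have nP: "(norm (P n))\<^sup>2 = (\<Sum>i<n. (cmod (c i))\<^sup>2)" for n
    using PP[of n n] by (simp add: Re_cinner_self)
  have bessel: "(\<Sum>i<n. (cmod (c i))\<^sup>2) \<le> (norm v)\<^sup>2" for n
    using norm_diff_square[of "P n" v] Pv[of n] nP[of n] zero_le_power2[of "norm (P n - v)"] by linarith
  then have sm: "summable (\<lambda>i. (cmod (c i))\<^sup>2)"
    by (intro bounded_imp_summable[of _ "(norm v)\<^sup>2"]) (auto simp: lessThan_Suc_atMost[symmetric] simp del: sum.lessThan_Suc)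
  have "Cauchy P"
  proof (rule CauchyI')
    fix r :: real assume r: "r > 0"
    have "Cauchy (\<lambda>n. \<Sum>i<n. (cmod (c i))\<^sup>2)"
      using sm by (simp add: summable_Cauchy' Cauchy_convergent_iff summable_iff_convergent)
    then obtain M where M: "\<And>m n. m \<ge> M \<Longrightarrow> n \<ge> M \<Longrightarrow> norm ((\<Sum>i<m. (cmod (c i))\<^sup>2) - (\<Sum>i<n. (cmod (c i))\<^sup>2)) < r\<^sup>2"
      using r CauchyD[of "\<lambda>n. \<Sum>i<n. (cmod (c i))\<^sup>2" "r\<^sup>2"] by auto
    have "dist (P m) (P n) < r" if "m \<ge> M" "m < n" for m n
    proof -
      have "(norm (P m - P n))\<^sup>2 = (\<Sum>i<n. (cmod (c i))\<^sup>2) - (\<Sum>i<m. (cmod (c i))\<^sup>2)"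
        using that by (simp add: norm_diff_square nP PP)
      also have "\<dots> < r\<^sup>2" using M[of n m] that by auto
      finally show ?thesis using r by (simp add: dist_norm power_less_imp_less_base)
    qed
    then show "\<exists>M. \<forall>m\<ge>M. \<forall>n>m. dist (P m) (P n) < r" by blast
  qed
  then obtain w where w: "P \<longlonglongrightarrow> w" by (auto simp: Cauchy_convergent_iff convergent_def)
  have "cinner (e i) w = c i" for i
  proof -
    have a: "(\<lambda>n. cinner (e i) (P n)) \<longlonglongrightarrow> cinner (e i) w"
      by (intro cinner.tendsto tendsto_const w)
    have b: "\<forall>\<^sub>F n in sequentially. cinner (e i) (P n) = c i"
      using eventually_gt_at_top[of i] by eventually_elim (simp add: eP)
    show ?thesis by (rule LIMSEQ_unique[OF a tendsto_eventually[OF b]])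
  qed
  then have "w - v = 0" by (intro total) (simp add: cinner.diff_right c_def)
  then have "(\<lambda>n. (norm (P n))\<^sup>2) \<longlonglongrightarrow> (norm v)\<^sup>2" using w by (auto intro!: tendsto_intros)
  then show "(\<lambda>i. (cmod (cinner (e i) v))\<^sup>2) sums (norm v)\<^sup>2"
    by (simp add: sums_def nP c_def)
qed

lemma exists_basis_enum:
  assumes sep: "separable_space (euclidean :: 'h::complex_hilbert_space topology)"
  obtains e :: "nat \<Rightarrow> 'h::complex_hilbert_space" where "basis_enum e"
proof -
  let ?B = "some_basis :: 'h set"
  have onb: "orthonormal_basis ?B" by (rule orthonormal_basis_some_basis)
  then have on: "orthonormal ?B" by (simp add: orthonormal_basis_def orthonormal_def)
  have cB: "countable ?B" by (rule countable_orthonormal[OF sep on])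
  define N where "N = to_nat_on ?B ` ?B"
  define h where "h = from_nat_into ?B"
  have h: "h (to_nat_on ?B b) = b" if "b \<in> ?B" for b
    using that cB by (simp add: h_def)
  have bij: "inj_on h N" "h ` N = ?B"
    by (auto simp: N_def inj_on_def h image_image)
  define e where "e i = (if i \<in> N then h i else 0)" for i
  have nz: "b \<noteq> 0" if "b \<in> ?B" for b
    using on that by (metis orthonormal_def cinner_zero_left zero_neq_one)
  have hB: "h i \<in> ?B" if "i \<in> N" for i using bij that by blast
  have "parseval e"
  proof (rule parseval_of_total)
    show "cinner (e i) (e j) = (if i = j \<and> e i \<noteq> 0 then 1 else 0)" for i j
      using on hB nz bij(1) by (auto simp: e_def orthonormal_def inj_on_def)
    show "v = 0" if "\<And>i. cinner (e i) v = 0" for v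
    proof -
      have "cinner b v = 0" if "b \<in> ?B" for b
        using \<open>\<And>i. cinner (e i) v = 0\<close>[of "to_nat_on ?B b"] that h by (simp add: e_def N_def)
      then show ?thesis using onb by (auto simp: orthonormal_basis_def)
    qed
  qed
  moreover have "((\<lambda>v. complex_of_real (r v)) has_sum complex_of_real x) ?B \<longleftrightarrow> (\<lambda>i. r (e i)) sums x"
    if r: "r 0 = 0" "\<forall>v. 0 \<le> r v" for r :: "'h \<Rightarrow> real" and x
  proof -
    have "((\<lambda>v. complex_of_real (r v)) has_sum complex_of_real x) ?B \<longleftrightarrow> (r has_sum x) (h ` N)"
      by (simp add: has_sum_of_real_iff bij)
    also have "\<dots> \<longleftrightarrow> ((r \<circ> h) has_sum x) N" by (rule has_sum_reindex[OF bij(1)])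
    also have "\<dots> \<longleftrightarrow> ((\<lambda>i. r (e i)) has_sum x) UNIV"
      by (rule has_sum_cong_neutral) (auto simp: e_def r)
    also have "\<dots> \<longleftrightarrow> (\<lambda>i. r (e i)) sums x"
      using has_sum_imp_sums sums_nonneg_imp_has_sum r by blast
    finally show ?thesis .
  qed
  ultimately have "basis_enum e" by (simp add: basis_enum_def)
  then show ?thesis by (rule that)
qed

subsection \<open>The trace norm\<close>

lemma abs_op_hilbert_module_eq:
  assumes "abs_of T S p"
  shows "abs_op hilbert_module T = p"
proof -
  obtain K where K: "K > 0" "op_le T K" using abs_ofD(4)[OF assms] by blast
  have b: "(norm (T v))\<^sup>2 \<le> K\<^sup>2 * (norm v)\<^sup>2" for v
    using power_mono[OF op_leD[OF K(2), of v], of 2] by (simp add: power_mult_distrib)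
  have K2: "K\<^sup>2 > 0" using K by simp
  show ?thesis
    using abs_op_hilbert_module[OF abs_ofD(1)[OF assms] K2 b]
      absH_unique[OF abs_ofD(1)[OF assms] K2 b abs_ofD(2,3)[OF assms]] by simp
qed

lemma exists_abs_of:
  assumes "adjoint_pair T S" "op_le T K"
  shows "\<exists>p. abs_of T S p"
proof -
  define L where "L = max K 1"
  have L: "L > 0" "op_le T L"
    using assms(2) mult_right_mono[of K L "norm _"] unfolding op_le_def L_def
    by (auto intro: order_trans)
  have b: "(norm (T v))\<^sup>2 \<le> L\<^sup>2 * (norm v)\<^sup>2" for v
    using power_mono[OF op_leD[OF L(2), of v], of 2] by (simp add: power_mult_distrib)
  have "L\<^sup>2 > 0" using L by simp
  then have "abs_of T S (absH (L\<^sup>2) T S)"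
    using posop_absH[OF assms(1) _ b] absH_square[OF assms(1) _ b] L assms(1) by (auto simp: abs_of_def)
  then show ?thesis by blast
qed

text \<open>The diagonal entries are nonnegative reals, so the unordered complex sums in
  \<open>L1\<close> and \<open>trace_norm\<close> amount to a real series along the
  enumeration.\<close>

lemma basis_enum_trace:
  assumes e: "basis_enum e" and T: "abs_of T S p"
  shows "T \<in> L1 \<longleftrightarrow> summable (\<lambda>i. Re (cinner (e i) (p (e i))))"
    and "(\<lambda>i. Re (cinner (e i) (p (e i)))) sums x \<Longrightarrow> trace_norm T = x"
proof -
  note p = abs_ofD(2)[OF T]
  have "bounded_op T" using op_le_bounded_op abs_ofD(1,4)[OF T] by blast
  have eq: "cinner b (abs_op hilbert_module T b) = complex_of_real (Re (cinner b (p b)))" for b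
    using posop_real[OF p] by (simp add: abs_op_hilbert_module_eq[OF T])
  have hs: "((\<lambda>b. cinner b (abs_op hilbert_module T b)) has_sum complex_of_real x) some_basis \<longleftrightarrow>
     (\<lambda>i. Re (cinner (e i) (p (e i)))) sums x" for x
    using e posop_nonneg[OF p] by (simp add: basis_enum_def eq)
  show "(\<lambda>i. Re (cinner (e i) (p (e i)))) sums x \<Longrightarrow> trace_norm T = x"
    unfolding trace_norm_def using hs[of x] infsumI by fastforce
  have "(\<lambda>b. cinner b (abs_op hilbert_module T b)) summable_on some_basis \<longleftrightarrow>
     summable (\<lambda>i. Re (cinner (e i) (p (e i))))"
  proof
    assume s: "(\<lambda>b. cinner b (abs_op hilbert_module T b)) summable_on some_basis"
    then obtain z where z: "((\<lambda>b. cinner b (abs_op hilbert_module T b)) has_sum z) some_basis"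
      by (auto simp: summable_on_def)
    have "((\<lambda>b. Im (cinner b (abs_op hilbert_module T b))) has_sum Im z) some_basis"
      using z by (rule has_sum_Im)
    then have "((\<lambda>_. 0) has_sum Im z) (some_basis :: 'a set)" unfolding eq by simp
    then have "Im z = 0" by (rule has_sum_unique) (rule has_sum_0, simp)
    then have "z = complex_of_real (Re z)" by (simp add: complex_eq_iff)
    then show "summable (\<lambda>i. Re (cinner (e i) (p (e i))))" using z hs[of "Re z"] by (auto simp: summable_def)
  next
    assume "summable (\<lambda>i. Re (cinner (e i) (p (e i))))"
    then show "(\<lambda>b. cinner b (abs_op hilbert_module T b)) summable_on some_basis"
      using hs by (meson summable_def summable_on_def)
  qed
  then show "T \<in> L1 \<longleftrightarrow> summable (\<lambda>i. Re (cinner (e i) (p (e i))))"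
    using \<open>bounded_op T\<close> by (simp add: L1_def)
qed

lemma abs_of_sums_trace_norm:
  assumes e: "basis_enum e" and T: "abs_of T S p" and L: "T \<in> L1"
  shows "(\<lambda>i. Re (cinner (e i) (p (e i)))) sums trace_norm T"
  using basis_enum_trace[OF e T] L by (metis summable_sums)

lemma basis_enum_parseval: "basis_enum e \<Longrightarrow> parseval e"
  by (simp add: basis_enum_def)

lemma abs_of_diff:
  assumes "abs_of T S p" "abs_of T' S' p'"
  obtains q where "abs_of (\<lambda>v. T v - T' v) (\<lambda>v. S v - S' v) q"
proof -
  obtain K K' where "op_le T K" "op_le T' K'" using abs_ofD(4) assms by metis
  then have "norm (T v - T' v) \<le> (K + K') * norm v" for v
    using op_leD[of T K v] op_leD[of T' K' v] norm_triangle_ineq4[of "T v" "T' v"] by (simp add: distrib_right)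
  then have "op_le (\<lambda>v. T v - T' v) (K + K')" by (simp add: op_le_def)
  then show ?thesis
    using that exists_abs_of[OF adjoint_pair_diff[OF abs_ofD(1)[OF assms(1)] abs_ofD(1)[OF assms(2)]]] by blast
qed

lemma sum_cinner_le_trace_norm:
  assumes e: "basis_enum e" and T: "abs_of T S p" and L: "T \<in> L1"
    and W: "adjoint_pair W W'" "op_le W 1" and F: "finite F"
  shows "(\<Sum>i\<in>F. cmod (cinner (W (e i)) (T (e i)))) \<le> trace_norm T"
proof -
  note s = abs_of_sums_trace_norm[OF e T L]
  note nn = posop_nonneg[OF abs_ofD(2)[OF T]]
  have t0: "0 \<le> trace_norm T" using nn by (intro sums_le[OF _ sums_zero s])
  have "(\<Sum>i\<in>F. cmod (cinner (W (e i)) (T (e i)))) \<le> sqrt (trace_norm T) * sqrt (\<Sum>i\<in>F. Re (cinner (e i) (p (e i))))"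
    by (rule sum_cinner_abs_le[OF T basis_enum_parseval[OF e] s W F])
  also have "\<dots> \<le> sqrt (trace_norm T) * sqrt (trace_norm T)"
  proof (intro mult_left_mono)
    have "(\<Sum>i\<in>F. Re (cinner (e i) (p (e i)))) \<le> (\<Sum>i. Re (cinner (e i) (p (e i))))"
      using nn F s by (intro sum_le_suminf) (auto simp: sums_iff)
    then show "sqrt (\<Sum>i\<in>F. Re (cinner (e i) (p (e i)))) \<le> sqrt (trace_norm T)"
      using s by (simp add: sums_iff)
    show "0 \<le> sqrt (trace_norm T)" using t0 by simp
  qed
  also have "\<dots> = trace_norm T" using t0 by simp
  finally show ?thesis .
qed

text \<open>The assumption on R compares matrix entries, so that it covers T - T' as well as T = (T
  - T') + T'. It gives a bound for each contraction W, which passes to the trace norm by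
  \<open>sum_abs_le\<close>.\<close>

lemma trace_norm_triangle:
  fixes T T' R :: "'h::complex_hilbert_space \<Rightarrow> 'h" and e :: "nat \<Rightarrow> 'h"
  assumes e: "basis_enum e" and T: "abs_of T S p" "T \<in> L1" and T': "abs_of T' S' p'" "T' \<in> L1"
    and q: "abs_of R R' q" and R: "\<And>w v. cmod (cinner w (R v)) \<le> cmod (cinner w (T v)) + cmod (cinner w (T' v))"
  shows "R \<in> L1" "trace_norm R \<le> trace_norm T + trace_norm T'"
proof -
  note nn = posop_nonneg[OF abs_ofD(2)[OF q]]
  have b: "(\<Sum>i\<in>F. Re (cinner (e i) (q (e i)))) \<le> trace_norm T + trace_norm T'" if F: "finite F" for F
  proof (rule sum_abs_le[OF q])
    fix W W' :: "'h \<Rightarrow> 'h" assume W: "adjoint_pair W W'" "op_le W 1"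
    have "(\<Sum>i\<in>F. cmod (cinner (W (e i)) (R (e i))))
      \<le> (\<Sum>i\<in>F. cmod (cinner (W (e i)) (T (e i))) + cmod (cinner (W (e i)) (T' (e i))))"
      by (intro sum_mono R)
    then show "(\<Sum>i\<in>F. cmod (cinner (W (e i)) (R (e i)))) \<le> trace_norm T + trace_norm T'"
      using sum_cinner_le_trace_norm[OF e T W F] sum_cinner_le_trace_norm[OF e T' W F]
      by (simp add: sum.distrib)
  qed
  have s: "summable (\<lambda>i. Re (cinner (e i) (q (e i))))"
    using b nn by (intro bounded_imp_summable[of _ "trace_norm T + trace_norm T'"]) auto
  then show L: "R \<in> L1" using basis_enum_trace(1)[OF e q] by simp
  have "(\<Sum>i. Re (cinner (e i) (q (e i)))) \<le> trace_norm T + trace_norm T'"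
    using s b by (intro suminf_le_const) auto
  then show "trace_norm R \<le> trace_norm T + trace_norm T'"
    using abs_of_sums_trace_norm[OF e q L] by (simp add: sums_iff)
qed

section \<open>Functions vanishing at infinity\<close>

text \<open>The zero functional is the point at infinity of \<open>spectrum0\<close>, and \<open>C\<^sub>0\<close> becomes the space of the
  continuous functions on \<open>spectrum0\<close> that are zero there (\<open>cz\<close> below).\<close>

definition ext0 :: "(('a::comm_cstar_algebra \<Rightarrow> complex) \<Rightarrow> 'v::zero) \<Rightarrow> ('a \<Rightarrow> complex) \<Rightarrow> 'v" where
  "ext0 f \<phi> = (if \<phi> \<in> spectrum then f \<phi> else 0)"

lemma ext0_simps [simp]: "\<phi> \<in> spectrum \<Longrightarrow> ext0 f \<phi> = f \<phi>" "ext0 f (\<lambda>_. 0) = 0"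
  by (auto simp: ext0_def)

lemma ext0_cong: "(\<And>\<phi>. \<phi> \<in> spectrum \<Longrightarrow> f \<phi> = g \<phi>) \<Longrightarrow> ext0 f = ext0 g"
  by (auto simp: ext0_def)

lemma at_within_spectrum0:
  assumes "x \<in> spectrum"
  shows "at x within spectrum0 = at x within spectrum"
proof (rule at_within_nhd)
  show "open (- {\<lambda>_. 0} :: ('a \<Rightarrow> complex) set)" by (simp add: open_Compl)
  show "x \<in> - {\<lambda>_. 0}" using assms zero_notin_spectrum by auto
qed auto

text \<open>The open neighbourhoods of the zero functional in \<open>spectrum0\<close> are the
  complements of the compact subsets of the spectrum, so continuity there means vanishing at
  infinity.\<close>

lemma continuous_on_ext0_iff:
  fixes g :: "('a::comm_cstar_algebra \<Rightarrow> complex) \<Rightarrow> 'v::real_normed_vector"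
  shows "continuous_on spectrum0 (ext0 g) \<longleftrightarrow>
    (\<forall>x\<in>spectrum. ((\<lambda>y. norm (g y - g x)) \<longlongrightarrow> 0) (at x within spectrum)) \<and>
    (\<forall>e>0. \<exists>K. K \<subseteq> spectrum \<and> compact K \<and> (\<forall>x\<in>spectrum - K. norm (g x) < e))"
proof -
  have tend: "((\<lambda>y. norm (g y - g x)) \<longlongrightarrow> 0) (at x within spectrum) \<longleftrightarrow>
      (ext0 g \<longlongrightarrow> ext0 g x) (at x within spectrum0)" if x: "x \<in> spectrum" for x
  proof -
    have "((\<lambda>y. norm (g y - g x)) \<longlongrightarrow> 0) (at x within spectrum) \<longleftrightarrow> (g \<longlongrightarrow> g x) (at x within spectrum)"
      by (simp add: tendsto_norm_zero_iff LIM_zero_iff)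
    also have "\<dots> \<longleftrightarrow> (ext0 g \<longlongrightarrow> ext0 g x) (at x within spectrum)"
      using x by (intro filterlim_cong) (auto simp: eventually_at_filter)
    finally show ?thesis by (simp add: at_within_spectrum0[OF x])
  qed
  have zero: "(\<forall>e>0. \<exists>K. K \<subseteq> spectrum \<and> compact K \<and> (\<forall>x\<in>spectrum - K. norm (g x) < e))"
    if cont: "continuous_on spectrum0 (ext0 g)"
  proof (intro allI impI)
    fix e :: real assume e: "e > 0"
    define K where "K = spectrum0 \<inter> (\<lambda>x. norm (ext0 g x)) -` {e..}"
    have "closed K" unfolding K_def
      by (rule continuous_closed_preimage[OF continuous_on_norm[OF cont] compact_imp_closed[OF compact_spectrum0]]) simp
    then have "compact (spectrum0 \<inter> K)" by (rule compact_Int_closed[OF compact_spectrum0])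
    moreover have "spectrum0 \<inter> K = K" by (auto simp: K_def)
    moreover have "K \<subseteq> spectrum" using e by (auto simp: K_def)
    moreover have "\<forall>x\<in>spectrum - K. norm (g x) < e" by (auto simp: K_def)
    ultimately show "\<exists>K. K \<subseteq> spectrum \<and> compact K \<and> (\<forall>x\<in>spectrum - K. norm (g x) < e)"
      by metis
  qed
  have at0: "(ext0 g \<longlongrightarrow> ext0 g (\<lambda>_. 0)) (at (\<lambda>_. 0) within spectrum0)"
    if v: "\<forall>e>0. \<exists>K. K \<subseteq> spectrum \<and> compact K \<and> (\<forall>x\<in>spectrum - K. norm (g x) < e)"
  proof (rule tendstoI)
    fix e :: real assume "e > 0"
    then obtain K where K: "K \<subseteq> spectrum" "compact K" "\<forall>x\<in>spectrum - K. norm (g x) < e"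
      using v by blast
    have "open (- K)" using K(2) compact_imp_closed by blast
    moreover have "(\<lambda>_. 0) \<in> - K" using K(1) by auto
    moreover have "\<forall>x\<in>- K. x \<noteq> (\<lambda>_. 0) \<longrightarrow> x \<in> spectrum0 \<longrightarrow> dist (ext0 g x) (ext0 g (\<lambda>_. 0)) < e"
      using K(3) by auto
    ultimately show "\<forall>\<^sub>F x in at (\<lambda>_. 0) within spectrum0. dist (ext0 g x) (ext0 g (\<lambda>_. 0)) < e"
      unfolding eventually_at_topological by blast
  qed
  show ?thesis
  proof
    assume c: "continuous_on spectrum0 (ext0 g)"
    then have "\<forall>x\<in>spectrum. (ext0 g \<longlongrightarrow> ext0 g x) (at x within spectrum0)" by (simp add: continuous_on_def)
    then show "(\<forall>x\<in>spectrum. ((\<lambda>y. norm (g y - g x)) \<longlongrightarrow> 0) (at x within spectrum)) \<and>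
      (\<forall>e>0. \<exists>K. K \<subseteq> spectrum \<and> compact K \<and> (\<forall>x\<in>spectrum - K. norm (g x) < e))"
      using tend zero[OF c] by simp
  next
    assume "(\<forall>x\<in>spectrum. ((\<lambda>y. norm (g y - g x)) \<longlongrightarrow> 0) (at x within spectrum)) \<and>
      (\<forall>e>0. \<exists>K. K \<subseteq> spectrum \<and> compact K \<and> (\<forall>x\<in>spectrum - K. norm (g x) < e))"
    then show "continuous_on spectrum0 (ext0 g)"
      unfolding continuous_on_def using tend at0 by simp
  qed
qed

definition cz :: "(('a::comm_cstar_algebra \<Rightarrow> complex) \<Rightarrow> 'v::real_normed_vector) \<Rightarrow> bool" where
  "cz f \<longleftrightarrow> continuous_on spectrum0 f \<and> f (\<lambda>_. 0) = 0"

abbreviation C0H :: "(('a::comm_cstar_algebra \<Rightarrow> complex) \<Rightarrow> 'v::real_normed_vector) set" where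
  "C0H \<equiv> C0 spectrum UNIV norm"

lemma C0H_iff: "f \<in> C0H \<longleftrightarrow> f \<in> extensional spectrum \<and> cz (ext0 f)"
  unfolding C0_def cz_def by (simp add: continuous_on_ext0_iff PiE_def)

lemma cz_cong: "cz f \<Longrightarrow> (\<And>\<phi>. \<phi> \<in> spectrum0 \<Longrightarrow> f \<phi> = g \<phi>) \<Longrightarrow> cz g"
  unfolding cz_def by (metis continuous_on_eq insertI1)

lemma cz_ext0: "cz f \<Longrightarrow> cz (ext0 f)"
proof -
  assume f: "cz f"
  then have f0: "f (\<lambda>_. 0) = 0" by (simp add: cz_def)
  show "cz (ext0 f)"
  proof (rule cz_cong[OF f])
    show "f \<phi> = ext0 f \<phi>" if "\<phi> \<in> spectrum0" for \<phi>
      using that f0 by (cases "\<phi> \<in> spectrum") auto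
  qed
qed

lemma ext0_restrict [simp]: "ext0 (restrict f spectrum) = ext0 f"
  by (auto simp: ext0_def)

lemma restrict_in_C0H: "restrict f spectrum \<in> C0H \<longleftrightarrow> cz (ext0 f)"
  by (simp add: C0H_iff)

lemma C0H_eqI:
  assumes "f \<in> C0H" "g \<in> C0H" "\<And>\<phi>. \<phi> \<in> spectrum \<Longrightarrow> f \<phi> = g \<phi>"
  shows "f = g"
  using assms by (auto simp: C0H_iff intro: extensionalityI)

lemma cz_bounded:
  assumes "cz f"
  shows "\<exists>B. \<forall>\<phi>\<in>spectrum. norm (f \<phi>) \<le> B"
proof -
  have "bounded (f ` spectrum0)"
    using assms compact_spectrum0 by (intro compact_imp_bounded compact_continuous_image) (auto simp: cz_def)
  then show ?thesis by (auto simp: bounded_iff)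
qed

lemma cz_add: "cz f \<Longrightarrow> cz g \<Longrightarrow> cz (\<lambda>\<phi>. f \<phi> + g \<phi>)"
  and cz_diff: "cz f \<Longrightarrow> cz g \<Longrightarrow> cz (\<lambda>\<phi>. f \<phi> - g \<phi>)"
  and cz_scaleR: "cz f \<Longrightarrow> cz (\<lambda>\<phi>. r *\<^sub>R f \<phi>)"
  by (auto simp: cz_def intro!: continuous_intros)

lemma cz_cinner: "cz f \<Longrightarrow> cz g \<Longrightarrow> cz (\<lambda>\<phi>. cinner (f \<phi>) (g \<phi>))"
  by (auto simp: cz_def intro!: cinner.continuous_on)

lemma cz_cinner_const: "cz g \<Longrightarrow> cz (\<lambda>\<phi>. cinner v (g \<phi>))"
  by (auto simp: cz_def intro!: cinner.continuous_on continuous_intros)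

lemma cz_scaleC: "cz f \<Longrightarrow> cz (\<lambda>\<phi>. \<phi> a *\<^sub>C (f \<phi> :: 'h::complex_hilbert_space))"
  by (auto simp: cz_def intro!: scaleC_hilbert.continuous_on continuous_on_eval)

lemma cz_scaleC_const: "cz (\<lambda>\<phi>. \<phi> a *\<^sub>C (v :: 'h::complex_hilbert_space))"
  by (auto simp: cz_def intro!: scaleC_hilbert.continuous_on continuous_on_eval continuous_intros)

lemma gelfand_cz:
  fixes g :: "('a::comm_cstar_algebra \<Rightarrow> complex) \<Rightarrow> complex"
  assumes "cz (ext0 g)"
  shows "\<exists>!a. \<forall>\<phi>\<in>spectrum. \<phi> a = g \<phi>"
proof -
  have "\<exists>!a. \<forall>\<phi>\<in>spectrum. \<phi> a = ext0 g \<phi>"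
    using assms by (intro gelfand_surjective) (auto simp: cz_def)
  then show ?thesis by simp
qed

lemma exists_eval_one:
  assumes "\<phi> \<in> spectrum"
  obtains a where "\<phi> a = 1"
proof -
  obtain b where "\<phi> b \<noteq> 0" using assms by (auto simp: spectrum_def)
  then have "\<phi> (inverse (\<phi> b) *\<^sub>C b) = 1" by (simp add: character_simps[OF assms])
  then show ?thesis by (rule that)
qed

text \<open>An element c with \<psi> c = 1 provides the cutoff
  \<open>min 1 (cmod (\<phi> c))\<close>: continuous, bounded by 1, equal to 1 at \<psi> and 0 at
  the zero functional.\<close>

lemma exists_bump:
  fixes v :: "'v::real_normed_vector"
  assumes \<psi>: "\<psi> \<in> spectrum"
  obtains b where "cz b" "b \<psi> = v" "\<And>\<phi>. norm (b \<phi>) \<le> norm v"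
proof -
  obtain c where c: "\<psi> c = 1" using exists_eval_one[OF \<psi>] by metis
  show ?thesis
  proof (rule that)
    show "cz (\<lambda>\<phi>. min 1 (cmod (\<phi> c)) *\<^sub>R v)"
      by (auto simp: cz_def intro!: continuous_intros continuous_on_eval)
    show "min 1 (cmod (\<psi> c)) *\<^sub>R v = v" using c by simp
    show "norm (min 1 (cmod (\<phi> c)) *\<^sub>R v) \<le> norm v" for \<phi>
      by (simp add: mult_left_le_one_le)
  qed
qed

lemma exists_C0H_value:
  assumes "\<psi> \<in> spectrum"
  obtains \<xi> where "\<xi> \<in> C0H" "\<xi> \<psi> = v"
proof -
  obtain b where "cz b" "b \<psi> = v" using exists_bump[OF assms] by metis
  then show ?thesis using that[of "restrict b spectrum"] assms
    by (simp add: restrict_in_C0H cz_ext0)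
qed

subsection \<open>Uniform boundedness\<close>

text \<open>Gliding hump: step \<open>n\<close> adds \<open>\<plusminus> 3\<^sup>-\<^sup>n\<close> times a bump on which the \<open>n\<close>-th functional nearly attains
  its norm; one of the two signs does not decrease the value, and the later steps cannot undo it.\<close>

lemma exists_unbounded_C0:
  fixes L :: "nat \<Rightarrow> 'v::banach \<Rightarrow> 'w::real_normed_vector" and x :: "nat \<Rightarrow> 'a::comm_cstar_algebra \<Rightarrow> complex"
  assumes x: "\<And>n. x n \<in> spectrum" and L: "\<And>n. bounded_linear (L n)" and big: "\<And>n. onorm (L n) > 4 ^ n"
  obtains \<xi> where "cz \<xi>" "\<And>n. norm (L n (\<xi> (x n))) > (4 / 3) ^ n / 4"
proof -
  have "\<exists>v. norm v \<le> 1 \<and> (3 / 4) * onorm (L n) \<le> norm (L n v)" for n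
  proof (rule ccontr)
    assume neg: "\<not> ?thesis"
    have on: "onorm (L n) > 0" using big[of n] zero_less_power[of "4::real" n] by linarith
    have "norm (L n v) \<le> (3 / 4) * onorm (L n) * norm v" for v
    proof (cases "v = 0")
      case True
      then show ?thesis by (simp add: linear_simps(3)[OF L])
    next
      case False
      have "norm (L n ((1 / norm v) *\<^sub>R v)) < (3 / 4) * onorm (L n)"
        using neg False by (force simp: not_le)
      then show ?thesis using False by (simp add: linear_simps(5)[OF L] field_simps)
    qed
    then have "onorm (L n) \<le> (3 / 4) * onorm (L n)"
      using on by (intro onorm_bound) auto
    then show False using on by simp
  qed
  then obtain v where v: "\<And>n. norm (v n) \<le> 1" "\<And>n. (3 / 4) * onorm (L n) \<le> norm (L n (v n))" by metis
  have "\<exists>b. cz b \<and> b (x n) = v n \<and> (\<forall>\<phi>. norm (b \<phi>) \<le> 1)" for n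
    using exists_bump[OF x, of n "v n"] v(1)[of n] by (metis order_trans)
  then obtain b where b: "\<And>n. cz (b n)" "\<And>n. b n (x n) = v n" "\<And>n \<phi>. norm (b n \<phi>) \<le> 1" by metis
  \<comment> \<open>The steps after n add up to at most r n / 2, so 3/4 - 1/2 = 1/4 of the product
    of r n and \<open>onorm (L n)\<close> remains, and this exceeds (4/3)^n / 4.\<close>
  define r :: "nat \<Rightarrow> real" where "r n = (1 / 3) ^ n" for n
  define \<Xi> where "\<Xi> = rec_nat (\<lambda>\<phi>. 0) (\<lambda>n g. let s = (if norm (L n (g (x n) - r n *\<^sub>R v n)) \<le> norm (L n (g (x n) + r n *\<^sub>R v n)) then 1 else -1 :: real)
      in (\<lambda>\<phi>. g \<phi> + (s * r n) *\<^sub>R b n \<phi>))"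
  define s :: "nat \<Rightarrow> real" where "s n = (if norm (L n (\<Xi> n (x n) - r n *\<^sub>R v n)) \<le> norm (L n (\<Xi> n (x n) + r n *\<^sub>R v n)) then 1 else -1)" for n
  have \<Xi>0: "\<Xi> 0 = (\<lambda>\<phi>. 0)" by (simp add: \<Xi>_def)
  have \<Xi>S: "\<Xi> (Suc n) = (\<lambda>\<phi>. \<Xi> n \<phi> + (s n * r n) *\<^sub>R b n \<phi>)" for n
    by (simp add: \<Xi>_def s_def Let_def)
  define d where "d n \<phi> = (s n * r n) *\<^sub>R b n \<phi>" for n \<phi>
  have \<Xi>sum: "\<Xi> n \<phi> = (\<Sum>i<n. d i \<phi>)" for n \<phi>
    by (induction n) (auto simp: \<Xi>0 \<Xi>S d_def)
  have dle: "norm (d n \<phi>) \<le> r n" for n \<phi>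
    using b(3)[of n \<phi>] by (simp add: d_def s_def r_def abs_mult mult_left_le)
  have rsum: "(\<lambda>k. r (k + m)) sums (r m * (3 / 2))" for m
  proof -
    have "(\<lambda>k. (1 / 3 :: real) ^ k) sums (1 / (1 - 1 / 3))" by (rule geometric_sums) simp
    from sums_mult[OF this, of "r m"] show ?thesis by (simp add: r_def power_add mult.commute)
  qed
  have rs: "summable r" using rsum[of 0] by (simp add: sums_iff)
  define \<xi> where "\<xi> \<phi> = (\<Sum>i. d i \<phi>)" for \<phi>
  have unif: "uniform_limit spectrum0 (\<lambda>n \<phi>. \<Sum>i<n. d i \<phi>) \<xi> sequentially"
    unfolding \<xi>_def by (rule Weierstrass_m_test[OF _ rs]) (rule dle)
  have "continuous_on spectrum0 (\<lambda>\<phi>. \<Sum>i<n. d i \<phi>)" for n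
    using b(1) by (intro continuous_intros) (auto simp: d_def cz_def intro!: continuous_intros)
  then have "continuous_on spectrum0 \<xi>"
    by (intro uniform_limit_theorem[OF _ unif] always_eventually allI) auto
  moreover have "\<xi> (\<lambda>_. 0) = 0" using b(1) by (simp add: \<xi>_def d_def cz_def)
  ultimately have cz: "cz \<xi>" by (simp add: cz_def)
  have ds: "summable (\<lambda>i. d i \<phi>)" for \<phi>
    by (rule summable_comparison_test'[OF rs]) (rule dle)
  have tail: "norm (\<xi> \<phi> - \<Xi> (Suc n) \<phi>) \<le> r n / 2" for n \<phi>
  proof -
    have "\<xi> \<phi> - \<Xi> (Suc n) \<phi> = (\<Sum>k. d (k + Suc n) \<phi>)"
      unfolding \<xi>_def \<Xi>sum using suminf_split_initial_segment[OF ds, of \<phi> "Suc n"] by simp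
    also have "norm \<dots> \<le> (\<Sum>k. r (k + Suc n))"
      by (rule norm_suminf_le[OF dle sums_summable[OF rsum]])
    also have "\<dots> = r (Suc n) * (3 / 2)" by (rule sums_unique[OF rsum, symmetric])
    finally show ?thesis by (simp add: r_def)
  qed
  have "norm (L n (\<xi> (x n))) > (4 / 3) ^ n / 4" for n
  proof -
    let ?g = "\<Xi> n (x n)" and ?u = "r n *\<^sub>R v n"
    note lin = linear_simps[OF L[of n]]
    have "norm (L n ?u) \<le> norm (L n (\<Xi> (Suc n) (x n)))"
    proof -
      have "2 * norm (L n ?u) = norm (L n (?g + ?u) - L n (?g - ?u))"
        by (simp add: lin abs_mult flip: scaleR_2)
      also have "\<dots> \<le> norm (L n (?g + ?u)) + norm (L n (?g - ?u))" by (rule norm_triangle_ineq4)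
      finally show ?thesis by (auto simp: \<Xi>S s_def b(2))
    qed
    moreover have "norm (L n ?u) \<ge> r n * ((3 / 4) * onorm (L n))"
      using v(2)[of n] by (simp add: lin r_def mult_left_mono)
    moreover have "norm (L n (\<xi> (x n) - \<Xi> (Suc n) (x n))) \<le> onorm (L n) * (r n / 2)"
      by (rule order_trans[OF onorm[OF L] mult_left_mono[OF tail onorm_pos_le[OF L]]])
    moreover have "norm (L n (\<Xi> (Suc n) (x n))) \<le> norm (L n (\<xi> (x n))) + norm (L n (\<xi> (x n) - \<Xi> (Suc n) (x n)))"
      by (subst lin(2)) (metis norm_minus_commute norm_triangle_sub)
    ultimately have "r n * onorm (L n) / 4 \<le> norm (L n (\<xi> (x n)))" by (simp add: algebra_simps)
    moreover have "(4 / 3) ^ n < r n * onorm (L n)"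
    proof -
      have "r n * 4 ^ n < r n * onorm (L n)" using big[of n] by (simp add: r_def)
      then show ?thesis by (simp add: r_def power_divide)
    qed
    ultimately show ?thesis by simp
  qed
  then show ?thesis using that cz by blast
qed

text \<open>The maps act on values at varying points, as the fibres of an operator do. If they had
  no common bound, a sequence of them would be unbounded on a single section.\<close>

lemma C0_uniform_boundedness:
  fixes L :: "'i \<Rightarrow> 'v::banach \<Rightarrow> 'w::real_normed_vector" and x :: "'i \<Rightarrow> 'a::comm_cstar_algebra \<Rightarrow> complex"
  assumes x: "\<And>i. i \<in> I \<Longrightarrow> x i \<in> spectrum" and L: "\<And>i. i \<in> I \<Longrightarrow> bounded_linear (L i)"
    and pw: "\<And>\<xi>. cz \<xi> \<Longrightarrow> \<exists>B. \<forall>i\<in>I. norm (L i (\<xi> (x i))) \<le> B"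
  shows "\<exists>M>0. \<forall>i\<in>I. \<forall>v. norm (L i v) \<le> M * norm v"
proof (rule ccontr)
  assume neg: "\<not> ?thesis"
  have "\<exists>i\<in>I. onorm (L i) > 4 ^ n" for n :: nat
  proof (rule ccontr)
    assume "\<not> ?thesis"
    then have le: "onorm (L i) \<le> 4 ^ n" if "i \<in> I" for i using that by (auto simp: not_less)
    have "norm (L i v) \<le> 4 ^ n * norm v" if "i \<in> I" for i v
      using onorm[OF L[OF that], of v] mult_right_mono[OF le[OF that], of "norm v"] by simp
    moreover have "(4::real) ^ n > 0" by simp
    ultimately show False using neg by blast
  qed
  then obtain i where i: "\<And>n. i n \<in> I" "\<And>n. onorm (L (i n)) > 4 ^ n" by metis
  obtain \<xi> where \<xi>: "cz \<xi>" "\<And>n. norm (L (i n) (\<xi> (x (i n)))) > (4 / 3) ^ n / 4"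
    using exists_unbounded_C0[of "\<lambda>n. x (i n)" "\<lambda>n. L (i n)"] x L i by metis
  obtain B where B: "\<And>j. j \<in> I \<Longrightarrow> norm (L j (\<xi> (x j))) \<le> B" using pw[OF \<xi>(1)] by blast
  have "(4 / 3) ^ n < 4 * B" for n using \<xi>(2)[of n] B[OF i(1)[of n]] by simp
  moreover obtain n where "4 * B < (4 / 3) ^ n" using real_arch_pow[of "4 / 3" "4 * B"] by auto
  ultimately show False by (meson less_asym)
qed

subsection \<open>Symbols of multipliers of the algebra\<close>

text \<open>Multipliers of C_0(X) are multiplications by functions on X; recording the function
  reduces convergence in \<open>onorm\<close> to uniform convergence.\<close>

definition has_symbol :: "('a::comm_cstar_algebra \<Rightarrow> 'a) \<Rightarrow> (('a \<Rightarrow> complex) \<Rightarrow> complex) \<Rightarrow> bool" where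
  "has_symbol m c \<longleftrightarrow> (\<forall>\<phi>\<in>spectrum. \<forall>a. \<phi> (m a) = c \<phi> * \<phi> a)"

text \<open>\<open>onorm\<close> controls a map only once the map is known to be bounded. Here c
  \<phi> times the transform of \<open>a\<close> is the transform of \<open>m a\<close>, a bounded
  function, so uniform boundedness applies to multiplication by c \<phi>.\<close>

lemma has_symbol_bounded_linear:
  assumes m: "has_symbol m c"
  shows "bounded_linear m"
proof -
  have eq: "\<phi> (m a) = c \<phi> * \<phi> a" if "\<phi> \<in> spectrum" for \<phi> a using m that by (simp add: has_symbol_def)
  have "\<exists>M>0. \<forall>\<phi>\<in>spectrum. \<forall>z. norm (c \<phi> * z) \<le> M * norm z"
  proof (rule C0_uniform_boundedness[of spectrum "\<lambda>\<phi>. \<phi>"])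
    show "bounded_linear ((*) (c \<phi>))" for \<phi> by (rule bounded_linear_mult_right)
    fix \<xi> :: "('a \<Rightarrow> complex) \<Rightarrow> complex" assume "cz \<xi>"
    then obtain a where a: "\<forall>\<phi>\<in>spectrum. \<phi> a = \<xi> \<phi>" using gelfand_cz cz_ext0 by blast
    have "norm (c \<phi> * \<xi> \<phi>) \<le> norm (m a)" if "\<phi> \<in> spectrum" for \<phi>
      using character_norm_le[OF that, of "m a"] eq[OF that, of a] a that by simp
    then show "\<exists>B. \<forall>\<phi>\<in>spectrum. norm (c \<phi> * \<xi> \<phi>) \<le> B" by blast
  qed
  then obtain M where M: "M > 0" "\<And>\<phi> z. \<phi> \<in> spectrum \<Longrightarrow> cmod (c \<phi> * z) \<le> M * cmod z" by blast
  show ?thesis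
  proof (rule bounded_linear_intro[of _ M])
    show "m (a + b) = m a + m b" for a b
      by (rule character_eqI) (simp add: eq character_simps algebra_simps)
    show "m (r *\<^sub>R a) = r *\<^sub>R m a" for r a
      by (rule character_eqI) (simp add: eq character_simps)
    show "norm (m a) \<le> norm a * M" for a
    proof (rule norm_le_character)
      fix \<phi> :: "'a \<Rightarrow> complex" assume \<phi>: "\<phi> \<in> spectrum"
      have "cmod (\<phi> (m a)) \<le> M * cmod (\<phi> a)" using M(2)[OF \<phi>, of "\<phi> a"] by (simp add: eq[OF \<phi>])
      also have "\<dots> \<le> M * norm a" using M(1) character_norm_le[OF \<phi>] by (simp add: mult_left_mono)
      finally show "cmod (\<phi> (m a)) \<le> norm a * M" by (simp add: mult.commute)
    qed (use M in simp)
  qed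
qed

lemma has_symbol_partial_sums:
  assumes "\<And>i. has_symbol (m i) (c i)"
  shows "has_symbol (\<lambda>a. (\<Sum>i<n. m i a) - to_multiplier alg_module b a) (\<lambda>\<phi>. (\<Sum>i<n. c i \<phi>) - \<phi> b)"
  using assms
  by (simp add: has_symbol_def to_multiplier_def alg_module_def character_simps character_sum
      left_diff_distrib sum_distrib_right)

text \<open>An element with \<phi> a = 1 reads off the symbol at \<phi>, so the operator norm
  dominates the symbol there up to the factor norm a.\<close>

lemma multiplier_sums_pointwise:
  assumes c: "\<And>i. has_symbol (m i) (c i)" and m: "multiplier_sums m b" and \<phi>: "\<phi> \<in> spectrum"
  shows "(\<lambda>i. c i \<phi>) sums \<phi> b"
proof -
  let ?d = "\<lambda>n a. (\<Sum>i<n. m i a) - to_multiplier alg_module b a"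
  obtain a where a: "\<phi> a = 1" using exists_eval_one[OF \<phi>] by metis
  have le: "norm ((\<Sum>i<n. c i \<phi>) - \<phi> b) \<le> onorm (?d n) * norm a" for n
  proof -
    have "(\<Sum>i<n. c i \<phi>) - \<phi> b = \<phi> (?d n a)"
      using has_symbol_partial_sums[of m c n b, OF c] \<phi> unfolding has_symbol_def
      by (metis a mult.right_neutral)
    then show ?thesis
      using character_norm_le[OF \<phi>, of "?d n a"] onorm[OF has_symbol_bounded_linear[OF has_symbol_partial_sums[of m c n b, OF c]], of a]
      by (simp only:)
  qed
  have lim: "(\<lambda>n. onorm (?d n) * norm a) \<longlonglongrightarrow> 0"
    using tendsto_mult_right[OF m[unfolded multiplier_sums_def], of "norm a"] by (simp only: mult_zero_left)
  have "(\<lambda>n. (\<Sum>i<n. c i \<phi>) - \<phi> b) \<longlonglongrightarrow> 0"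
    by (rule Lim_null_comparison[OF always_eventually[OF allI[OF le]] lim])
  then show ?thesis by (simp add: sums_def LIM_zero_iff)
qed

text \<open>The operator norm of a multiplication is at most the supremum of its symbol, because
  characters compute the norm.\<close>

lemma multiplier_sums_uniform:
  assumes c: "\<And>i. has_symbol (m i) (c i)"
    and u: "\<And>e. e > 0 \<Longrightarrow> \<exists>N. \<forall>n\<ge>N. \<forall>\<phi>\<in>spectrum. cmod ((\<Sum>i<n. c i \<phi>) - \<phi> b) \<le> e"
  shows "multiplier_sums m b"
  unfolding multiplier_sums_def
proof (rule LIMSEQ_I)
  let ?d = "\<lambda>n a. (\<Sum>i<n. m i a) - to_multiplier alg_module b a"
  fix e :: real assume e: "e > 0"
  then obtain N where N: "\<And>n \<phi>. n \<ge> N \<Longrightarrow> \<phi> \<in> spectrum \<Longrightarrow> cmod ((\<Sum>i<n. c i \<phi>) - \<phi> b) \<le> e / 2"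
    using u[of "e / 2"] by auto
  have "norm (onorm (?d n) - 0) < e" if n: "n \<ge> N" for n
  proof -
    have "norm (?d n a) \<le> e / 2 * norm a" for a
    proof (rule norm_le_character)
      fix \<phi> :: "'a \<Rightarrow> complex" assume \<phi>: "\<phi> \<in> spectrum"
      have "\<phi> (?d n a) = ((\<Sum>i<n. c i \<phi>) - \<phi> b) * \<phi> a"
        using has_symbol_partial_sums[of m c n b, OF c] \<phi> by (simp add: has_symbol_def)
      then show "cmod (\<phi> (?d n a)) \<le> e / 2 * norm a"
        using N[OF n \<phi>] character_norm_le[OF \<phi>, of a] e by (simp only: norm_mult) (intro mult_mono, auto)
    qed (use e in simp)
    then have "onorm (?d n) \<le> e / 2" using e by (intro onorm_bound) auto
    moreover have "0 \<le> onorm (?d n)"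
      by (rule onorm_pos_le[OF has_symbol_bounded_linear[OF has_symbol_partial_sums[of m c n b, OF c]]])
    ultimately show ?thesis using e by simp
  qed
  then show "\<exists>N. \<forall>n\<ge>N. norm (onorm (?d n) - 0) < e" by blast
qed

section \<open>Localisation\<close>

lemma mcarrier_C0_module [simp]: "mcarrier C0_module = C0H"
  by (simp add: C0_module_def)

lemma mip_C0_module:
  assumes "\<xi> \<in> C0H" "\<eta> \<in> C0H" "\<phi> \<in> spectrum"
  shows "\<phi> (mip C0_module \<xi> \<eta>) = cinner (\<xi> \<phi>) (\<eta> \<phi>)"
proof -
  have "cz (\<lambda>\<phi>. cinner (ext0 \<xi> \<phi>) (ext0 \<eta> \<phi>))" using assms by (intro cz_cinner) (auto simp: C0H_iff)
  then have "cz (ext0 (\<lambda>\<phi>. cinner (ext0 \<xi> \<phi>) (ext0 \<eta> \<phi>)))" by (rule cz_ext0)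
  moreover have "ext0 (\<lambda>\<phi>. cinner (ext0 \<xi> \<phi>) (ext0 \<eta> \<phi>)) = ext0 (\<lambda>\<phi>. cinner (\<xi> \<phi>) (\<eta> \<phi>))"
    by (rule ext0_cong) simp
  ultimately have "\<exists>!a. \<forall>\<phi>\<in>spectrum. \<phi> a = cinner (\<xi> \<phi>) (\<eta> \<phi>)" by (intro gelfand_cz) simp
  from theI'[OF this] show ?thesis using assms(3) by (simp add: C0_module_def)
qed

lemma mip_C0_module_eq_iff:
  assumes "\<xi> \<in> C0H" "\<eta> \<in> C0H"
  shows "mip C0_module \<xi> \<eta> = a \<longleftrightarrow> (\<forall>\<phi>\<in>spectrum. cinner (\<xi> \<phi>) (\<eta> \<phi>) = \<phi> a)"
proof
  assume "\<forall>\<phi>\<in>spectrum. cinner (\<xi> \<phi>) (\<eta> \<phi>) = \<phi> a"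
  then show "mip C0_module \<xi> \<eta> = a" using mip_C0_module[OF assms] by (intro character_eqI) simp
qed (use mip_C0_module[OF assms] in auto)

abbreviation C0_adjoint :: "((('a::comm_cstar_algebra \<Rightarrow> complex) \<Rightarrow> 'h::complex_hilbert_space) \<Rightarrow> (('a \<Rightarrow> complex) \<Rightarrow> 'h)) \<Rightarrow> _ \<Rightarrow> bool" where
  "C0_adjoint t s \<equiv> t \<in> C0H \<rightarrow>\<^sub>E C0H \<and> is_adjoint C0_module C0_module t s"

lemma C0_adjointD:
  assumes "C0_adjoint t s"
  shows "t \<in> C0H \<rightarrow>\<^sub>E C0H" "s \<in> C0H \<rightarrow>\<^sub>E C0H" "\<xi> \<in> C0H \<Longrightarrow> t \<xi> \<in> C0H" "\<xi> \<in> C0H \<Longrightarrow> s \<xi> \<in> C0H"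
  using assms by (auto simp: is_adjoint_def)

lemma C0_adjoint_iff:
  assumes "t \<in> C0H \<rightarrow>\<^sub>E C0H" "s \<in> C0H \<rightarrow>\<^sub>E C0H"
  shows "C0_adjoint t s \<longleftrightarrow> (\<forall>\<xi>\<in>C0H. \<forall>\<eta>\<in>C0H. \<forall>\<phi>\<in>spectrum. cinner (t \<xi> \<phi>) (\<eta> \<phi>) = cinner (\<xi> \<phi>) (s \<eta> \<phi>))"
proof -
  have "mip C0_module (t \<xi>) \<eta> = mip C0_module \<xi> (s \<eta>) \<longleftrightarrow> (\<forall>\<phi>\<in>spectrum. cinner (t \<xi> \<phi>) (\<eta> \<phi>) = cinner (\<xi> \<phi>) (s \<eta> \<phi>))"
    if "\<xi> \<in> C0H" "\<eta> \<in> C0H" for \<xi> \<eta>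
  proof -
    have "t \<xi> \<in> C0H" "s \<eta> \<in> C0H" using assms that by auto
    then show ?thesis using that by (simp add: mip_C0_module_eq_iff mip_C0_module)
  qed
  then show ?thesis using assms by (simp add: is_adjoint_def)
qed

lemma C0_adjoint_cinner:
  assumes "C0_adjoint t s" "\<xi> \<in> C0H" "\<eta> \<in> C0H" "\<phi> \<in> spectrum"
  shows "cinner (t \<xi> \<phi>) (\<eta> \<phi>) = cinner (\<xi> \<phi>) (s \<eta> \<phi>)"
  using C0_adjoint_iff[OF C0_adjointD(1,2)[OF assms(1)]] assms by blast

lemma C0_adjoint_sym:
  assumes "C0_adjoint t s"
  shows "C0_adjoint s t"
  unfolding C0_adjoint_iff[OF C0_adjointD(2,1)[OF assms]]
  using C0_adjoint_cinner[OF assms] by (metis cinner_commute)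

text \<open>A concrete candidate for t_\<phi>. The description in \<open>localise\<close> speaks of
  a bounded operator and can be evaluated only after boundedness is proved; this one is available
  before.\<close>

definition fibre :: "((('a::comm_cstar_algebra \<Rightarrow> complex) \<Rightarrow> 'h::complex_hilbert_space) \<Rightarrow> (('a \<Rightarrow> complex) \<Rightarrow> 'h)) \<Rightarrow>
   ('a \<Rightarrow> complex) \<Rightarrow> 'h \<Rightarrow> 'h" where
  "fibre t \<phi> v = t (SOME \<xi>. \<xi> \<in> C0H \<and> \<xi> \<phi> = v) \<phi>"

context
  fixes t s :: "(('a::comm_cstar_algebra \<Rightarrow> complex) \<Rightarrow> 'h::complex_hilbert_space) \<Rightarrow> (('a \<Rightarrow> complex) \<Rightarrow> 'h)"
  assumes ts: "C0_adjoint t s"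
begin

text \<open>For a section \<eta> with value w at \<phi>, <w, t \<xi> \<phi>> equals <s \<eta>
  \<phi>, \<xi> \<phi>>, which sees \<xi> only through its value at \<phi>.\<close>

lemma fibre_eq:
  assumes \<xi>: "\<xi> \<in> C0H" and \<phi>: "\<phi> \<in> spectrum"
  shows "t \<xi> \<phi> = fibre t \<phi> (\<xi> \<phi>)"
proof -
  define \<zeta> where "\<zeta> = (SOME \<zeta>. \<zeta> \<in> C0H \<and> \<zeta> \<phi> = \<xi> \<phi>)"
  have \<zeta>: "\<zeta> \<in> C0H \<and> \<zeta> \<phi> = \<xi> \<phi>" unfolding \<zeta>_def by (rule someI[of _ \<xi>]) (use \<xi> in simp)
  have "cinner w (t \<xi> \<phi>) = cinner w (t \<zeta> \<phi>)" for w
  proof -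
    obtain \<eta> where \<eta>: "\<eta> \<in> C0H" "\<eta> \<phi> = w" using exists_C0H_value[OF \<phi>] by metis
    then show ?thesis
      using C0_adjoint_cinner[OF C0_adjoint_sym[OF ts], of \<eta> _ \<phi>] \<xi> \<zeta> \<phi> by metis
  qed
  then show ?thesis unfolding fibre_def \<zeta>_def[symmetric] by (rule cinner_eqI)
qed

end

lemma fibre_adjoint:
  fixes t s :: "(('a::comm_cstar_algebra \<Rightarrow> complex) \<Rightarrow> 'h::complex_hilbert_space) \<Rightarrow> (('a \<Rightarrow> complex) \<Rightarrow> 'h)"
  assumes ts: "C0_adjoint t s" and \<phi>: "\<phi> \<in> spectrum"
  shows "adjoint_pair (fibre t \<phi>) (fibre s \<phi>)"
  unfolding adjoint_pair_def
proof (intro allI)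
  fix u v :: 'h
  obtain \<xi> :: "('a \<Rightarrow> complex) \<Rightarrow> 'h" where \<xi>: "\<xi> \<in> C0H" "\<xi> \<phi> = u" using exists_C0H_value[OF \<phi>] by metis
  obtain \<eta> :: "('a \<Rightarrow> complex) \<Rightarrow> 'h" where \<eta>: "\<eta> \<in> C0H" "\<eta> \<phi> = v" using exists_C0H_value[OF \<phi>] by metis
  show "cinner (fibre t \<phi> u) v = cinner u (fibre s \<phi> v)"
    using C0_adjoint_cinner[OF ts \<xi>(1) \<eta>(1) \<phi>] fibre_eq[OF ts \<xi>(1) \<phi>] fibre_eq[OF C0_adjoint_sym[OF ts] \<eta>(1) \<phi>]
    by (simp add: \<xi>(2) \<eta>(2))
qed

text \<open>Uniform boundedness is applied to the functionals <fibre s \<phi> w, -> with |w| at most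
  1, not to the fibres of t: the former are bounded by Cauchy-Schwarz, whereas boundedness of a
  single fibre is not known yet.\<close>

lemma fibre_bounded:
  fixes t :: "(('a::comm_cstar_algebra \<Rightarrow> complex) \<Rightarrow> 'h::complex_hilbert_space) \<Rightarrow> (('a \<Rightarrow> complex) \<Rightarrow> 'h)"
  assumes ts: "C0_adjoint t s"
  shows "\<exists>M>0. \<forall>\<phi>\<in>spectrum. op_le (fibre t \<phi>) M"
proof -
  let ?I = "{(\<phi>, w). \<phi> \<in> spectrum \<and> norm w \<le> 1} :: (('a \<Rightarrow> complex) \<times> 'h) set"
  have "\<exists>M>0. \<forall>i\<in>?I. \<forall>v. norm (cinner (fibre s (fst i) (snd i)) v) \<le> M * norm v"
  proof (rule C0_uniform_boundedness[of ?I fst])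
    fix i assume i: "i \<in> ?I"
    show "fst i \<in> spectrum" using i by auto
    show "bounded_linear (cinner (fibre s (fst i) (snd i)))" by (rule cinner.bounded_linear_right)
  next
    fix \<xi> :: "('a \<Rightarrow> complex) \<Rightarrow> 'h" assume "cz \<xi>"
    then have \<xi>: "restrict \<xi> spectrum \<in> C0H" by (simp add: restrict_in_C0H cz_ext0)
    then have "cz (ext0 (t (restrict \<xi> spectrum)))" using C0_adjointD(3)[OF ts] by (simp add: C0H_iff)
    from cz_bounded[OF this] obtain B where B: "\<And>\<phi>. \<phi> \<in> spectrum \<Longrightarrow> norm (t (restrict \<xi> spectrum) \<phi>) \<le> B"
      by auto
    have "norm (cinner (fibre s \<phi> w) (\<xi> \<phi>)) \<le> B" if \<phi>: "\<phi> \<in> spectrum" and w: "norm w \<le> 1" for \<phi> w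
    proof -
      have "cinner (fibre s \<phi> w) (\<xi> \<phi>) = cinner w (fibre t \<phi> (\<xi> \<phi>))"
        using adjoint_pairD'[OF fibre_adjoint[OF ts \<phi>]] by simp
      also have "fibre t \<phi> (\<xi> \<phi>) = t (restrict \<xi> spectrum) \<phi>"
        using fibre_eq[OF ts \<xi> \<phi>] \<phi> by simp
      finally have "cmod (cinner (fibre s \<phi> w) (\<xi> \<phi>)) \<le> norm w * norm (t (restrict \<xi> spectrum) \<phi>)"
        by (simp add: norm_cinner_le)
      also have "\<dots> \<le> 1 * B" using w B[OF \<phi>] by (intro mult_mono) auto
      finally show ?thesis by simp
    qed
    then show "\<exists>B. \<forall>i\<in>?I. norm (cinner (fibre s (fst i) (snd i)) (\<xi> (fst i))) \<le> B" by auto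
  qed
  then obtain M where M: "M > 0" "\<And>\<phi> w v. \<phi> \<in> spectrum \<Longrightarrow> norm w \<le> 1 \<Longrightarrow> cmod (cinner (fibre s \<phi> w) v) \<le> M * norm v"
    by fastforce
  have "norm (fibre t \<phi> v) \<le> M * norm v" if \<phi>: "\<phi> \<in> spectrum" for \<phi> v
  proof (cases "fibre t \<phi> v = 0")
    case False
    define w where "w = (1 / norm (fibre t \<phi> v)) *\<^sub>R fibre t \<phi> v"
    have "norm w \<le> 1" by (simp add: w_def)
    have "cinner (fibre s \<phi> w) v = cinner w (fibre t \<phi> v)"
      using adjoint_pairD'[OF fibre_adjoint[OF ts \<phi>]] by simp
    also have "\<dots> = of_real (norm (fibre t \<phi> v))"
      using False by (simp add: w_def cinner_scaleR_left cinner_self power2_eq_square)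
    finally show ?thesis using M(2)[OF \<phi> \<open>norm w \<le> 1\<close>, of v] by simp
  qed (use M in simp)
  then show ?thesis using M(1) by (auto simp: op_le_def)
qed

lemma localise_eq:
  fixes t s :: "(('a::comm_cstar_algebra \<Rightarrow> complex) \<Rightarrow> 'h::complex_hilbert_space) \<Rightarrow> (('a \<Rightarrow> complex) \<Rightarrow> 'h)"
  assumes ts: "C0_adjoint t s" and \<phi>: "\<phi> \<in> spectrum"
  shows "localise t \<phi> = fibre t \<phi>"
  unfolding localise_def
proof (rule the_equality)
  obtain M where "op_le (fibre t \<phi>) M" using fibre_bounded[OF ts] \<phi> by blast
  then show "bounded_op (fibre t \<phi>) \<and> (\<forall>\<xi>\<in>C0H. t \<xi> \<phi> = fibre t \<phi> (\<xi> \<phi>))"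
    using op_le_bounded_op[OF fibre_adjoint[OF ts \<phi>]] fibre_eq[OF ts _ \<phi>] by simp
  fix T assume T: "bounded_op T \<and> (\<forall>\<xi>\<in>C0H. t \<xi> \<phi> = T (\<xi> \<phi>))"
  show "T = fibre t \<phi>"
  proof
    fix v :: 'h
    obtain \<xi> :: "('a \<Rightarrow> complex) \<Rightarrow> 'h" where "\<xi> \<in> C0H" "\<xi> \<phi> = v" using exists_C0H_value[OF \<phi>] by metis
    then show "T v = fibre t \<phi> v" using T fibre_eq[OF ts _ \<phi>] by metis
  qed
qed

lemma C0_adjoint_unique:
  fixes t s s' :: "(('a::comm_cstar_algebra \<Rightarrow> complex) \<Rightarrow> 'h::complex_hilbert_space) \<Rightarrow> (('a \<Rightarrow> complex) \<Rightarrow> 'h)"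
  assumes "C0_adjoint t s" "C0_adjoint t s'"
  shows "s = s'"
proof (rule PiE_ext[OF C0_adjointD(2)[OF assms(1)] C0_adjointD(2)[OF assms(2)]])
  fix \<eta> :: "('a \<Rightarrow> complex) \<Rightarrow> 'h" assume \<eta>: "\<eta> \<in> C0H"
  show "s \<eta> = s' \<eta>"
  proof (rule C0H_eqI)
    fix \<phi> :: "'a \<Rightarrow> complex" assume \<phi>: "\<phi> \<in> spectrum"
    have "fibre s \<phi> = fibre s' \<phi>"
      using adjoint_pair_unique fibre_adjoint[OF assms(1) \<phi>] fibre_adjoint[OF assms(2) \<phi>] by blast
    then show "s \<eta> \<phi> = s' \<eta> \<phi>"
      using fibre_eq[OF C0_adjoint_sym[OF assms(1)] \<eta> \<phi>] fibre_eq[OF C0_adjoint_sym[OF assms(2)] \<eta> \<phi>] by simp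
  qed (use C0_adjointD(4) assms \<eta> in blast)+
qed

lemma adj_C0_module: 
  assumes "C0_adjoint t s"
  shows "adj C0_module C0_module t = s"
  unfolding adj_def
proof (rule the_equality)
  show "is_adjoint C0_module C0_module t s" using assms by simp
  fix s' assume "is_adjoint C0_module C0_module t s'"
  then show "s' = s" using C0_adjoint_unique[of t s' s] assms by simp
qed

lemma adjointable_C0_module: "t \<in> adjointable C0_module C0_module \<longleftrightarrow> (\<exists>s. C0_adjoint t s)"
  by (auto simp: adjointable_def)

subsection \<open>Strongly continuous families\<close>

text \<open>Testing on sections instead of fixed vectors makes the notion stable under composition
  and includes the behaviour at infinity.\<close>

definition strong_family :: "(('a::comm_cstar_algebra \<Rightarrow> complex) \<Rightarrow> 'h::complex_hilbert_space \<Rightarrow> 'h) \<Rightarrow> bool" where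
  "strong_family T \<longleftrightarrow> (\<forall>\<xi>. cz \<xi> \<longrightarrow> cz (ext0 (\<lambda>\<phi>. T \<phi> (\<xi> \<phi>))))"

definition family_op :: "(('a::comm_cstar_algebra \<Rightarrow> complex) \<Rightarrow> 'h::complex_hilbert_space \<Rightarrow> 'h) \<Rightarrow>
   (('a \<Rightarrow> complex) \<Rightarrow> 'h) \<Rightarrow> (('a \<Rightarrow> complex) \<Rightarrow> 'h)" where
  "family_op T = (\<lambda>\<xi>\<in>C0H. \<lambda>\<phi>\<in>spectrum. T \<phi> (\<xi> \<phi>))"

lemma strong_familyD: "strong_family T \<Longrightarrow> cz \<xi> \<Longrightarrow> cz (ext0 (\<lambda>\<phi>. T \<phi> (\<xi> \<phi>)))"
  by (simp add: strong_family_def)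

lemma strong_family_fibre:
  fixes t s :: "(('a::comm_cstar_algebra \<Rightarrow> complex) \<Rightarrow> 'h::complex_hilbert_space) \<Rightarrow> (('a \<Rightarrow> complex) \<Rightarrow> 'h)"
  assumes ts: "C0_adjoint t s"
  shows "strong_family (fibre t)"
  unfolding strong_family_def
proof (intro allI impI)
  fix \<xi> :: "('a \<Rightarrow> complex) \<Rightarrow> 'h" assume "cz \<xi>"
  then have \<xi>: "restrict \<xi> spectrum \<in> C0H" by (simp add: restrict_in_C0H cz_ext0)
  then have "cz (ext0 (t (restrict \<xi> spectrum)))" using C0_adjointD(3)[OF ts] by (simp add: C0H_iff)
  moreover have "ext0 (t (restrict \<xi> spectrum)) = ext0 (\<lambda>\<phi>. fibre t \<phi> (\<xi> \<phi>))"
    by (rule ext0_cong) (simp add: fibre_eq[OF ts \<xi>])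
  ultimately show "cz (ext0 (\<lambda>\<phi>. fibre t \<phi> (\<xi> \<phi>)))" by simp
qed

lemma strong_family_id: "strong_family (\<lambda>\<phi> v. v)"
  by (simp add: strong_family_def cz_ext0)

lemma strong_family_compose:
  fixes T S :: "('a::comm_cstar_algebra \<Rightarrow> complex) \<Rightarrow> 'h::complex_hilbert_space \<Rightarrow> 'h"
  assumes "strong_family T" "strong_family S"
  shows "strong_family (\<lambda>\<phi> v. T \<phi> (S \<phi> v))"
  unfolding strong_family_def
proof (intro allI impI)
  fix \<xi> :: "('a \<Rightarrow> complex) \<Rightarrow> 'h" assume "cz \<xi>"
  from strong_familyD[OF assms(1) strong_familyD[OF assms(2) this]]
  show "cz (ext0 (\<lambda>\<phi>. T \<phi> (S \<phi> (\<xi> \<phi>))))"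
    by (rule back_subst[of cz]) (rule ext0_cong, simp)
qed

lemma strong_family_add:
  fixes T S :: "('a::comm_cstar_algebra \<Rightarrow> complex) \<Rightarrow> 'h::complex_hilbert_space \<Rightarrow> 'h"
  assumes "strong_family T" "strong_family S"
  shows "strong_family (\<lambda>\<phi> v. T \<phi> v + S \<phi> v)"
  unfolding strong_family_def
proof (intro allI impI)
  fix \<xi> :: "('a \<Rightarrow> complex) \<Rightarrow> 'h" assume "cz \<xi>"
  from cz_add[OF strong_familyD[OF assms(1) this] strong_familyD[OF assms(2) this]]
  show "cz (ext0 (\<lambda>\<phi>. T \<phi> (\<xi> \<phi>) + S \<phi> (\<xi> \<phi>)))"
    by (rule back_subst[of cz]) (auto simp: ext0_def)
qed

lemma strong_family_diff:
  fixes T S :: "('a::comm_cstar_algebra \<Rightarrow> complex) \<Rightarrow> 'h::complex_hilbert_space \<Rightarrow> 'h"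
  assumes "strong_family T" "strong_family S"
  shows "strong_family (\<lambda>\<phi> v. T \<phi> v - S \<phi> v)"
  unfolding strong_family_def
proof (intro allI impI)
  fix \<xi> :: "('a \<Rightarrow> complex) \<Rightarrow> 'h" assume "cz \<xi>"
  from cz_diff[OF strong_familyD[OF assms(1) this] strong_familyD[OF assms(2) this]]
  show "cz (ext0 (\<lambda>\<phi>. T \<phi> (\<xi> \<phi>) - S \<phi> (\<xi> \<phi>)))"
    by (rule back_subst[of cz]) (auto simp: ext0_def)
qed

lemma strong_family_scaleR:
  fixes T :: "('a::comm_cstar_algebra \<Rightarrow> complex) \<Rightarrow> 'h::complex_hilbert_space \<Rightarrow> 'h"
  assumes "strong_family T"
  shows "strong_family (\<lambda>\<phi> v. r *\<^sub>R T \<phi> v)"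
  unfolding strong_family_def
proof (intro allI impI)
  fix \<xi> :: "('a \<Rightarrow> complex) \<Rightarrow> 'h" assume "cz \<xi>"
  from cz_scaleR[OF strong_familyD[OF assms(1) this], of r]
  show "cz (ext0 (\<lambda>\<phi>. r *\<^sub>R T \<phi> (\<xi> \<phi>)))"
    by (rule back_subst[of cz]) (auto simp: ext0_def)
qed

text \<open>The error bound does not depend on the point and a section is bounded, so the images of
  a section converge uniformly on \<open>spectrum0\<close>.\<close>

lemma strong_family_limit:
  fixes S :: "('a::comm_cstar_algebra \<Rightarrow> complex) \<Rightarrow> 'h::complex_hilbert_space \<Rightarrow> 'h"
    and T :: "nat \<Rightarrow> ('a \<Rightarrow> complex) \<Rightarrow> 'h \<Rightarrow> 'h"
  assumes T: "\<And>n. strong_family (T n)" and c: "c \<longlonglongrightarrow> 0"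
    and le: "\<And>n \<phi> v. \<phi> \<in> spectrum \<Longrightarrow> norm (S \<phi> v - T n \<phi> v) \<le> c n * norm v"
  shows "strong_family S"
  unfolding strong_family_def
proof (intro allI impI)
  fix \<xi> :: "('a \<Rightarrow> complex) \<Rightarrow> 'h" assume \<xi>: "cz \<xi>"
  obtain B where B: "\<And>\<phi>. \<phi> \<in> spectrum \<Longrightarrow> norm (\<xi> \<phi>) \<le> B" using cz_bounded[OF \<xi>] by blast
  have "uniform_limit spectrum0 (\<lambda>n. ext0 (\<lambda>\<phi>. T n \<phi> (\<xi> \<phi>))) (ext0 (\<lambda>\<phi>. S \<phi> (\<xi> \<phi>))) sequentially"
  proof (rule uniform_limitI)
    fix e :: real assume e: "e > 0"
    have "(\<lambda>n. \<bar>c n\<bar> * \<bar>B\<bar>) \<longlonglongrightarrow> \<bar>0\<bar> * \<bar>B\<bar>" by (intro tendsto_intros c)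
    then have "\<forall>\<^sub>F n in sequentially. \<bar>c n\<bar> * \<bar>B\<bar> < e" using e by (intro order_tendstoD(2)) auto
    then show "\<forall>\<^sub>F n in sequentially. \<forall>\<phi>\<in>spectrum0. dist (ext0 (\<lambda>\<phi>. T n \<phi> (\<xi> \<phi>)) \<phi>) (ext0 (\<lambda>\<phi>. S \<phi> (\<xi> \<phi>)) \<phi>) < e"
    proof eventually_elim
      case (elim n)
      have "dist (T n \<phi> (\<xi> \<phi>)) (S \<phi> (\<xi> \<phi>)) < e" if \<phi>: "\<phi> \<in> spectrum" for \<phi>
      proof -
        have "dist (T n \<phi> (\<xi> \<phi>)) (S \<phi> (\<xi> \<phi>)) \<le> c n * norm (\<xi> \<phi>)"
          using le[OF \<phi>, of "\<xi> \<phi>" n] by (simp add: dist_norm norm_minus_commute)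
        also have "\<dots> \<le> \<bar>c n\<bar> * \<bar>B\<bar>"
          using B[OF \<phi>] by (intro mult_mono) auto
        finally show ?thesis using elim by simp
      qed
      then show ?case using e by (auto simp: ext0_def)
    qed
  qed
  moreover have "continuous_on spectrum0 (ext0 (\<lambda>\<phi>. T n \<phi> (\<xi> \<phi>)))" for n
    using strong_familyD[OF T \<xi>] by (simp add: cz_def)
  ultimately have "continuous_on spectrum0 (ext0 (\<lambda>\<phi>. S \<phi> (\<xi> \<phi>)))"
    by (intro uniform_limit_theorem[OF always_eventually]) auto
  then show "cz (ext0 (\<lambda>\<phi>. S \<phi> (\<xi> \<phi>)))" by (simp add: cz_def)
qed

lemma strong_family_sqrt_limit:
  fixes R :: "('a::comm_cstar_algebra \<Rightarrow> complex) \<Rightarrow> 'h::complex_hilbert_space \<Rightarrow> 'h"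
  assumes R: "strong_family R" and sa: "\<And>\<phi>. \<phi> \<in> spectrum \<Longrightarrow> adjoint_pair (R \<phi>) (R \<phi>) \<and> op_le (R \<phi>) 1"
  shows "strong_family (\<lambda>\<phi>. sqrt_limit (R \<phi>))"
proof (rule strong_family_limit)
  show "strong_family (\<lambda>\<phi>. sqrt_iter (R \<phi>) n)" for n
  proof (induction n)
    case 0
    have "ext0 (\<lambda>\<phi>. 0) = (\<lambda>\<phi>::'a \<Rightarrow> complex. 0::'h)" by (auto simp: ext0_def)
    moreover have "cz (\<lambda>\<phi>::'a \<Rightarrow> complex. 0::'h)" by (simp add: cz_def)
    ultimately show ?case by (simp add: strong_family_def)
  next
    case (Suc n)
    have "strong_family (\<lambda>\<phi> v. (1/2) *\<^sub>R (R \<phi> v + sqrt_iter (R \<phi>) n (sqrt_iter (R \<phi>) n v)))"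
      by (rule strong_family_scaleR[OF strong_family_add[OF R strong_family_compose[OF Suc Suc]]])
    then show ?case unfolding strong_family_def by (simp only: sqrt_iter.simps(2))
  qed
  show "norm (sqrt_limit (R \<phi>) v - sqrt_iter (R \<phi>) n v) \<le> (1 - sqrt_scalar n) * norm v" if "\<phi> \<in> spectrum" for n \<phi> v
    using sqrt_limit_iter sa[OF that] by blast
  have "(\<lambda>n. 1 - sqrt_scalar n) \<longlonglongrightarrow> 1 - 1" by (intro tendsto_intros sqrt_scalar_tendsto)
  then show "(\<lambda>n. 1 - sqrt_scalar n) \<longlonglongrightarrow> 0" by simp
qed

lemma family_op_in:
  fixes T :: "('a::comm_cstar_algebra \<Rightarrow> complex) \<Rightarrow> 'h::complex_hilbert_space \<Rightarrow> 'h"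
  assumes "strong_family T"
  shows "family_op T \<in> C0H \<rightarrow>\<^sub>E C0H"
proof (rule PiE_I)
  fix \<xi> :: "('a \<Rightarrow> complex) \<Rightarrow> 'h" assume \<xi>: "\<xi> \<in> C0H"
  have "cz (ext0 (\<lambda>\<phi>. T \<phi> (ext0 \<xi> \<phi>)))" using \<xi> by (intro strong_familyD[OF assms]) (simp add: C0H_iff)
  moreover have "ext0 (\<lambda>\<phi>. T \<phi> (ext0 \<xi> \<phi>)) = ext0 (\<lambda>\<phi>. T \<phi> (\<xi> \<phi>))" by (rule ext0_cong) simp
  ultimately show "family_op T \<xi> \<in> C0H" using \<xi> by (simp add: family_op_def restrict_in_C0H)
qed (simp add: family_op_def)

lemma family_op_adjoint:
  assumes "strong_family T" "strong_family S" "\<And>\<phi>. \<phi> \<in> spectrum \<Longrightarrow> adjoint_pair (T \<phi>) (S \<phi>)"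
  shows "C0_adjoint (family_op T) (family_op S)"
  unfolding C0_adjoint_iff[OF family_op_in[OF assms(1)] family_op_in[OF assms(2)]]
  using assms(3) by (auto simp: family_op_def adjoint_pairD)

lemma family_op_apply: "\<xi> \<in> C0H \<Longrightarrow> \<phi> \<in> spectrum \<Longrightarrow> family_op T \<xi> \<phi> = T \<phi> (\<xi> \<phi>)"
  by (simp add: family_op_def)

lemma positive_ops_C0_moduleE:
  fixes p :: "(('a::comm_cstar_algebra \<Rightarrow> complex) \<Rightarrow> 'h::complex_hilbert_space) \<Rightarrow> (('a \<Rightarrow> complex) \<Rightarrow> 'h)"
  assumes "p \<in> positive_ops C0_module"
  obtains "p \<in> C0H \<rightarrow>\<^sub>E C0H" "C0_adjoint p p" "\<And>\<phi>. \<phi> \<in> spectrum \<Longrightarrow> posop (fibre p \<phi>)"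
proof -
  obtain s :: "(('a \<Rightarrow> complex) \<Rightarrow> 'h) \<Rightarrow> (('a \<Rightarrow> complex) \<Rightarrow> 'h)" where "s \<in> adjointable C0_module C0_module" and ps: "p = compose C0H (adj C0_module C0_module s) s"
    using CollectD[OF assms[unfolded positive_ops_def mcarrier_C0_module]] by (elim exE conjE)
  then obtain s' where s: "C0_adjoint s s'" unfolding adjointable_C0_module by blast
  have p: "p = compose C0H s' s" using ps by (simp only: adj_C0_module[OF s])
  have pin: "p \<in> C0H \<rightarrow>\<^sub>E C0H" using C0_adjointD[OF s] by (auto simp: p compose_def)
  have pev: "p \<xi> \<phi> = fibre s' \<phi> (fibre s \<phi> (\<xi> \<phi>))" if "\<xi> \<in> C0H" "\<phi> \<in> spectrum" for \<xi> \<phi>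
    using that C0_adjointD[OF s] by (simp add: p compose_def fibre_eq[OF s] fibre_eq[OF C0_adjoint_sym[OF s]])
  have pp: "C0_adjoint p p"
    unfolding C0_adjoint_iff[OF pin pin]
    using adjoint_pairD[OF fibre_adjoint[OF s]] adjoint_pairD'[OF fibre_adjoint[OF s]] by (simp add: pev) metis
  have "posop (fibre p \<phi>)" if \<phi>: "\<phi> \<in> spectrum" for \<phi>
  proof -
    have "fibre p \<phi> = (\<lambda>v. fibre s' \<phi> (fibre s \<phi> v))"
    proof
      fix v :: 'h
      obtain \<xi> :: "('a \<Rightarrow> complex) \<Rightarrow> 'h" where "\<xi> \<in> C0H" "\<xi> \<phi> = v" using exists_C0H_value[OF \<phi>] by metis
      then show "fibre p \<phi> v = fibre s' \<phi> (fibre s \<phi> v)" using pev[of \<xi> \<phi>] fibre_eq[OF pp, of \<xi> \<phi>] \<phi> by simp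
    qed
    then show ?thesis using fibre_adjoint[OF s \<phi>] unfolding posop_def by blast
  qed
  then show ?thesis using that pin pp by blast
qed

lemma abs_op_C0_module:
  fixes t :: "(('a::comm_cstar_algebra \<Rightarrow> complex) \<Rightarrow> 'h::complex_hilbert_space) \<Rightarrow> (('a \<Rightarrow> complex) \<Rightarrow> 'h)"
  assumes ts: "C0_adjoint t s"
  obtains q where "strong_family q" "abs_op C0_module t = family_op q" "C0_adjoint (family_op q) (family_op q)"
    "\<And>\<phi>. \<phi> \<in> spectrum \<Longrightarrow> abs_of (fibre t \<phi>) (fibre s \<phi>) (q \<phi>)"
proof -
  obtain K where K: "K > 0" "\<And>\<phi>. \<phi> \<in> spectrum \<Longrightarrow> op_le (fibre t \<phi>) K" using fibre_bounded[OF ts] by blast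
  \<comment> \<open>A single M for all points makes \<open>abs_complement\<close> a strongly
    continuous family of contractions.\<close>
  define M where "M = K\<^sup>2"
  have M: "M > 0" using K by (simp add: M_def)
  have bd: "(norm (fibre t \<phi> v))\<^sup>2 \<le> M * (norm v)\<^sup>2" if "\<phi> \<in> spectrum" for \<phi> v
    using power_mono[OF op_leD[OF K(2)[OF that], of v], of 2] by (simp add: power_mult_distrib M_def)
  note ad = fibre_adjoint[OF ts]
  note st = C0_adjoint_sym[OF ts]
  have sc: "strong_family (\<lambda>\<phi>. abs_complement M (fibre t \<phi>) (fibre s \<phi>))"
    unfolding abs_complement_def
    by (intro strong_family_diff strong_family_id strong_family_scaleR
        strong_family_compose[OF strong_family_fibre[OF st] strong_family_fibre[OF ts]])
  have sl: "strong_family (\<lambda>\<phi>. sqrt_limit (abs_complement M (fibre t \<phi>) (fibre s \<phi>)))"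
    using abs_complement_adjoint[OF ad M bd] abs_complement_le[OF ad M bd]
    by (intro strong_family_sqrt_limit[OF sc]) blast
  have sl2: "strong_family (\<lambda>\<phi>. sqrt_limit (sqrt_limit (abs_complement M (fibre t \<phi>) (fibre s \<phi>))))"
    using abs_limit[OF ad M bd]
    by (intro strong_family_sqrt_limit[OF sl]) blast
  define q where "q \<phi> = absH M (fibre t \<phi>) (fibre s \<phi>)" for \<phi>
  \<comment> \<open>The family of the roots |t_\<phi>|^(1/2) is the witness for
    \<open>positive_ops\<close>, which asks for an adjointable operator on the module and not for a
    root at each point.\<close>
  define r where "r \<phi> = sqrt_absH M (fibre t \<phi>) (fibre s \<phi>)" for \<phi>
  have q: "strong_family q"
    unfolding q_def absH_def by (intro strong_family_scaleR strong_family_diff strong_family_id sl)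
  have r: "strong_family r"
    unfolding r_def sqrt_absH_def by (intro strong_family_scaleR strong_family_diff strong_family_id sl2)
  have qa: "abs_of (fibre t \<phi>) (fibre s \<phi>) (q \<phi>)" if \<phi>: "\<phi> \<in> spectrum" for \<phi>
    using posop_absH[OF ad[OF \<phi>] M bd[OF \<phi>]] absH_square[OF ad[OF \<phi>] M bd[OF \<phi>]] ad[OF \<phi>] K(1) K(2)[OF \<phi>]
    by (auto simp: abs_of_def q_def)
  have qq: "C0_adjoint (family_op q) (family_op q)"
    by (rule family_op_adjoint[OF q q]) (rule posop_adjoint[OF abs_ofD(2)[OF qa]])
  have rr: "C0_adjoint (family_op r) (family_op r)"
    by (rule family_op_adjoint[OF r r]) (simp add: r_def sqrt_absH_adjoint[OF ad M bd])
  have "abs_op C0_module t = family_op q"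
    unfolding abs_op_def adj_C0_module[OF ts]
  proof (rule the_equality)
    have "family_op q = compose C0H (adj C0_module C0_module (family_op r)) (family_op r)"
    proof (rule PiE_ext[OF C0_adjointD(1)[OF qq]])
      show "compose C0H (adj C0_module C0_module (family_op r)) (family_op r) \<in> C0H \<rightarrow>\<^sub>E C0H"
        using C0_adjointD[OF rr] by (auto simp: adj_C0_module[OF rr] compose_def)
      fix \<xi> :: "('a \<Rightarrow> complex) \<Rightarrow> 'h" assume \<xi>: "\<xi> \<in> C0H"
      show "family_op q \<xi> = compose C0H (adj C0_module C0_module (family_op r)) (family_op r) \<xi>"
      proof (rule C0H_eqI)
        show "family_op q \<xi> \<in> C0H" "compose C0H (adj C0_module C0_module (family_op r)) (family_op r) \<xi> \<in> C0H"
          using C0_adjointD[OF rr] C0_adjointD[OF qq] \<xi> by (auto simp: adj_C0_module[OF rr] compose_def)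
        fix \<phi> :: "'a \<Rightarrow> complex" assume \<phi>: "\<phi> \<in> spectrum"
        show "family_op q \<xi> \<phi> = compose C0H (adj C0_module C0_module (family_op r)) (family_op r) \<xi> \<phi>"
          using \<xi> \<phi> C0_adjointD(3)[OF rr \<xi>]
          by (simp add: adj_C0_module[OF rr] compose_def family_op_apply q_def r_def sqrt_absH_square[OF ad M bd])
      qed
    qed
    then have "family_op q \<in> positive_ops C0_module"
      using rr unfolding positive_ops_def adjointable_C0_module mcarrier_C0_module by blast
    moreover have "compose C0H (family_op q) (family_op q) = compose C0H s t"
    proof (rule extensionalityI[of _ C0H])
      fix \<xi> :: "('a \<Rightarrow> complex) \<Rightarrow> 'h" assume \<xi>: "\<xi> \<in> C0H"
      have "family_op q (family_op q \<xi>) = s (t \<xi>)"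
      proof (rule C0H_eqI)
        show "family_op q (family_op q \<xi>) \<in> C0H" "s (t \<xi>) \<in> C0H"
          using C0_adjointD[OF qq] C0_adjointD[OF ts] \<xi> by auto
        fix \<phi> :: "'a \<Rightarrow> complex" assume \<phi>: "\<phi> \<in> spectrum"
        show "family_op q (family_op q \<xi>) \<phi> = s (t \<xi>) \<phi>"
          using \<xi> \<phi> C0_adjointD(3)[OF qq \<xi>] C0_adjointD(3)[OF ts \<xi>]
          by (simp add: family_op_apply fibre_eq[OF ts] fibre_eq[OF st] abs_ofD(3)[OF qa])
      qed
      then show "compose C0H (family_op q) (family_op q) \<xi> = compose C0H s t \<xi>" using \<xi> by (simp add: compose_def)
    qed (auto simp: compose_def)
    ultimately show "family_op q \<in> positive_ops C0_module \<and>
        compose (mcarrier C0_module) (family_op q) (family_op q) = compose (mcarrier C0_module) s t" by simp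
    fix p assume p: "p \<in> positive_ops C0_module \<and> compose (mcarrier C0_module) p p = compose (mcarrier C0_module) s t"
    obtain pin: "p \<in> C0H \<rightarrow>\<^sub>E C0H" and pp: "C0_adjoint p p" and pos: "\<And>\<phi>. \<phi> \<in> spectrum \<Longrightarrow> posop (fibre p \<phi>)"
      using positive_ops_C0_moduleE p by blast
    have sq: "p (p \<xi>) = s (t \<xi>)" if "\<xi> \<in> C0H" for \<xi>
      using p that unfolding mcarrier_C0_module by (metis compose_eq)
    \<comment> \<open>Uniqueness is inherited from the fibres: at each point a competing p is a
      positive root of the same operator.\<close>
    have pq: "fibre p \<phi> = q \<phi>" if \<phi>: "\<phi> \<in> spectrum" for \<phi>
      unfolding q_def
    proof (rule absH_unique[OF ad[OF \<phi>] M bd[OF \<phi>] pos[OF \<phi>]])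
      fix v :: 'h
      obtain \<xi> :: "('a \<Rightarrow> complex) \<Rightarrow> 'h" where \<xi>: "\<xi> \<in> C0H" "\<xi> \<phi> = v" using exists_C0H_value[OF \<phi>] by metis
      have "p (p \<xi>) \<phi> = s (t \<xi>) \<phi>" using sq[OF \<xi>(1)] by simp
      then show "fibre p \<phi> (fibre p \<phi> v) = fibre s \<phi> (fibre t \<phi> v)"
        using \<xi> \<phi> C0_adjointD(3)[OF pp \<xi>(1)] C0_adjointD(3)[OF ts \<xi>(1)]
        by (simp add: fibre_eq[OF pp] fibre_eq[OF ts] fibre_eq[OF st])
    qed
    show "p = family_op q"
    proof (rule PiE_ext[OF pin C0_adjointD(1)[OF qq]])
      fix \<xi> :: "('a \<Rightarrow> complex) \<Rightarrow> 'h" assume \<xi>: "\<xi> \<in> C0H"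
      show "p \<xi> = family_op q \<xi>"
        using C0_adjointD(3)[OF pp \<xi>] C0_adjointD(3)[OF qq \<xi>] \<xi>
        by (intro C0H_eqI) (auto simp: fibre_eq[OF pp] family_op_apply pq)
    qed
  qed
  then show ?thesis using that q qq qa by blast
qed

section \<open>Frames and traces on the module\<close>

text \<open>A constant vector need not be a section vanishing at infinity. It is multiplied by
  \<phi> b, where x b = 1, and this factor is divided out near x, where it is not zero.\<close>

lemma strong_family_continuous:
  fixes T :: "('a::comm_cstar_algebra \<Rightarrow> complex) \<Rightarrow> 'h::complex_hilbert_space \<Rightarrow> 'h"
  assumes T: "strong_family T" and lin: "\<And>\<phi>. \<phi> \<in> spectrum \<Longrightarrow> adjoint_pair (T \<phi>) (S \<phi>)"
  shows "continuous_on spectrum (\<lambda>\<phi>. T \<phi> v)"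
  unfolding continuous_on_def
proof
  fix x :: "'a \<Rightarrow> complex" assume x: "x \<in> spectrum"
  obtain b where b: "x b = 1" using exists_eval_one[OF x] by metis
  let ?g = "ext0 (\<lambda>\<phi>. T \<phi> (\<phi> b *\<^sub>C v))"
  have g: "?g \<phi> = \<phi> b *\<^sub>C T \<phi> v" if "\<phi> \<in> spectrum" for \<phi>
    using that by (simp add: adjoint_pair_linear[OF lin])
  have "continuous_on spectrum0 ?g" using strong_familyD[OF T cz_scaleC_const] by (simp add: cz_def)
  then have cg: "continuous_on spectrum ?g" by (rule continuous_on_subset) auto
  have tg: "(?g \<longlongrightarrow> ?g x) (at x within spectrum)" by (rule bspec[OF cg[unfolded continuous_on_def] x])
  have tb: "((\<lambda>\<phi>. \<phi> b) \<longlongrightarrow> x b) (at x within spectrum)"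
    using continuous_on_eval[of spectrum b] x by (simp add: continuous_on_def)
  have "((\<lambda>\<phi>. inverse (\<phi> b) *\<^sub>C ?g \<phi>) \<longlongrightarrow> inverse (x b) *\<^sub>C ?g x) (at x within spectrum)"
    using b by (intro scaleC_hilbert.tendsto tendsto_inverse tb tg) simp
  then have "((\<lambda>\<phi>. inverse (\<phi> b) *\<^sub>C ?g \<phi>) \<longlongrightarrow> T x v) (at x within spectrum)"
    using b x by (simp add: g)
  moreover have "\<forall>\<^sub>F \<phi> in at x within spectrum. inverse (\<phi> b) *\<^sub>C ?g \<phi> = T \<phi> v"
  proof -
    have "\<forall>\<^sub>F \<phi> in at x within spectrum. \<phi> b \<noteq> 0"
      using tendsto_imp_eventually_ne[OF tb] b by simp
    moreover have "\<forall>\<^sub>F \<phi> in at x within spectrum. \<phi> \<in> spectrum"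
      by (simp add: eventually_at_filter)
    ultimately show ?thesis by eventually_elim (simp add: adjoint_pair_linear(2)[OF lin])
  qed
  ultimately show "((\<lambda>\<phi>. T \<phi> v) \<longlongrightarrow> T x v) (at x within spectrum)"
    by (rule Lim_transform_eventually)
qed

text \<open>The compact sets on which \<open>f n\<close> is at least e decrease, and their
  intersection is empty by the pointwise limit; hence one of them is empty.\<close>

lemma dini:
  fixes f :: "nat \<Rightarrow> 'x::t2_space \<Rightarrow> real"
  assumes S: "compact S" and c: "\<And>n. continuous_on S (f n)"
    and dec: "\<And>n x. x \<in> S \<Longrightarrow> f (Suc n) x \<le> f n x" and lim: "\<And>x. x \<in> S \<Longrightarrow> (\<lambda>n. f n x) \<longlonglongrightarrow> 0" and e: "e > 0"
  shows "\<exists>N. \<forall>n\<ge>N. \<forall>x\<in>S. f n x < e"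
proof -
  have mono: "f m x \<le> f n x" if "x \<in> S" "n \<le> m" for n m x
    using that(2) dec[OF that(1)] by (rule lift_Suc_antimono_le[rotated])
  define K where "K n = S \<inter> f n -` {e..}" for n
  have "\<exists>N. K N = {}"
  proof (rule ccontr)
    assume ne: "\<not> ?thesis"
    have "S \<inter> (\<Inter>n\<in>UNIV. K n) \<noteq> {}"
    proof (rule compact_imp_fip_image[OF S])
      show "closed (K n)" for n unfolding K_def
        by (rule continuous_closed_preimage[OF c compact_imp_closed[OF S]]) simp
      fix I :: "nat set" assume I: "finite I"
      obtain x where x: "x \<in> K (Max (insert 0 I))" using ne by blast
      have "x \<in> K i" if "i \<in> I" for i
        using x mono[of x i "Max (insert 0 I)"] that I by (auto simp: K_def)
      then show "S \<inter> (\<Inter>i\<in>I. K i) \<noteq> {}" using x by (auto simp: K_def)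
    qed
    then obtain x where x: "x \<in> S" "\<And>n. e \<le> f n x" by (auto simp: K_def)
    have "\<forall>\<^sub>F n in sequentially. f n x < e" using lim[OF x(1)] e by (rule order_tendstoD(2))
    then show False using x(2) by (auto simp: eventually_sequentially not_less[symmetric])
  qed
  then obtain N where "K N = {}" by blast
  then have "f N x < e" if "x \<in> S" for x using that by (auto simp: K_def)
  then show ?thesis using mono by (meson le_less_trans)
qed

subsection \<open>Multipliers of the module\<close>

text \<open>The difference d of two adjoints at \<eta> satisfies \<open>star a * d = 0\<close> for
  all a. In place of a unit, a = d is inserted, and the C*-identity gives d = 0.\<close>

lemma alg_adjoint_unique:
  assumes "is_adjoint alg_module F r s" "is_adjoint alg_module F r s'"
  shows "s = s'"
proof -
  have s: "s \<in> mcarrier F \<rightarrow>\<^sub>E UNIV" "s' \<in> mcarrier F \<rightarrow>\<^sub>E UNIV"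
    using assms by (simp_all add: is_adjoint_def alg_module_def)
  show ?thesis
  proof (rule PiE_ext[OF s])
    fix \<eta> assume \<eta>: "\<eta> \<in> mcarrier F"
    define d where "d = s \<eta> - s' \<eta>"
    have "star a * s \<eta> = star a * s' \<eta>" for a
      using assms \<eta> by (simp add: is_adjoint_def alg_module_def)
    then have "star d * d = 0" by (simp add: d_def right_diff_distrib)
    then have "(norm d)\<^sup>2 = 0" by (metis cstar_identity norm_zero)
    then show "s \<eta> = s' \<eta>" by (simp add: d_def)
  qed
qed

lemma adj_alg_module:
  assumes "is_adjoint alg_module F r s"
  shows "adj alg_module F r = s"
  unfolding adj_def
proof (rule the_equality)
  show "is_adjoint alg_module F r s" by (rule assms)
  show "s' = s" if "is_adjoint alg_module F r s'" for s' using alg_adjoint_unique[OF that assms] .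
qed

lemma is_adjoint_alg_C0_iff:
  fixes \<beta> :: "'a::comm_cstar_algebra \<Rightarrow> (('a \<Rightarrow> complex) \<Rightarrow> 'h::complex_hilbert_space)"
  assumes "\<And>a. \<beta> a \<in> C0H" "\<gamma> \<in> extensional C0H"
  shows "is_adjoint alg_module C0_module \<beta> \<gamma> \<longleftrightarrow>
    (\<forall>a. \<forall>\<eta>\<in>C0H. \<forall>\<phi>\<in>spectrum. cinner (\<beta> a \<phi>) (\<eta> \<phi>) = cnj (\<phi> a) * \<phi> (\<gamma> \<eta>))"
proof -
  have "mip C0_module (\<beta> a) \<eta> = star a * \<gamma> \<eta> \<longleftrightarrow> (\<forall>\<phi>\<in>spectrum. cinner (\<beta> a \<phi>) (\<eta> \<phi>) = cnj (\<phi> a) * \<phi> (\<gamma> \<eta>))"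
    if "\<eta> \<in> C0H" for a \<eta>
    using mip_C0_module_eq_iff[OF assms(1) that] by (simp add: character_simps character_star)
  then show ?thesis using assms(2) by (simp add: is_adjoint_def alg_module_def PiE_def)
qed

text \<open>\<open>B\<close> is the multiplier seen as a function on the spectrum with values in H,
  and \<gamma> is its adjoint; symbols are computed from both.\<close>

definition multiplier_value :: "('a::comm_cstar_algebra \<Rightarrow> (('a \<Rightarrow> complex) \<Rightarrow> 'h::complex_hilbert_space)) \<Rightarrow>
   ((('a \<Rightarrow> complex) \<Rightarrow> 'h) \<Rightarrow> 'a) \<Rightarrow> (('a \<Rightarrow> complex) \<Rightarrow> 'h) \<Rightarrow> bool" where
  "multiplier_value \<beta> \<gamma> B \<longleftrightarrow> (\<forall>a. \<beta> a \<in> C0H) \<and> is_adjoint alg_module C0_module \<beta> \<gamma> \<and>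
     (\<forall>\<phi>\<in>spectrum. (\<forall>a. \<beta> a \<phi> = \<phi> a *\<^sub>C B \<phi>) \<and> (\<forall>\<eta>\<in>C0H. \<phi> (\<gamma> \<eta>) = cinner (B \<phi>) (\<eta> \<phi>)))"

lemma multiplier_valueD:
  assumes "multiplier_value \<beta> \<gamma> B"
  shows "\<beta> a \<in> C0H" "is_adjoint alg_module C0_module \<beta> \<gamma>" "\<phi> \<in> spectrum \<Longrightarrow> \<beta> a \<phi> = \<phi> a *\<^sub>C B \<phi>"
    "\<phi> \<in> spectrum \<Longrightarrow> \<eta> \<in> C0H \<Longrightarrow> \<phi> (\<gamma> \<eta>) = cinner (B \<phi>) (\<eta> \<phi>)"
  using assms by (auto simp: multiplier_value_def)

text \<open>There may be no unit at which to evaluate \<beta>; at each \<phi> an element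
  \<open>u \<phi>\<close> with value 1 there takes its place.\<close>

lemma exists_multiplier_value:
  fixes \<beta> :: "'a::comm_cstar_algebra \<Rightarrow> (('a \<Rightarrow> complex) \<Rightarrow> 'h::complex_hilbert_space)"
  assumes "\<beta> \<in> multipliers C0_module"
  shows "\<exists>\<gamma> B. multiplier_value \<beta> \<gamma> B"
proof -
  have \<beta>: "\<And>a. \<beta> a \<in> C0H" using assms by (auto simp: multipliers_def adjointable_def alg_module_def)
  obtain \<gamma> where \<gamma>: "is_adjoint alg_module C0_module \<beta> \<gamma>"
    using assms by (auto simp: multipliers_def adjointable_def)
  then have ext: "\<gamma> \<in> extensional C0H" by (simp add: is_adjoint_def PiE_def)
  have ad: "cinner (\<beta> a \<phi>) (\<eta> \<phi>) = cnj (\<phi> a) * \<phi> (\<gamma> \<eta>)" if "\<eta> \<in> C0H" "\<phi> \<in> spectrum" for a \<eta> \<phi>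
    using \<gamma> that is_adjoint_alg_C0_iff[of \<beta>, OF \<beta> ext] by blast
  have "\<exists>a. \<phi> \<in> spectrum \<longrightarrow> \<phi> a = 1" for \<phi> :: "'a \<Rightarrow> complex" using exists_eval_one[of \<phi>] by blast
  then obtain u where u: "\<And>\<phi>::'a \<Rightarrow> complex. \<phi> \<in> spectrum \<Longrightarrow> \<phi> (u \<phi>) = 1" by metis
  define B where "B \<phi> = \<beta> (u \<phi>) \<phi>" for \<phi>
  have B: "\<phi> (\<gamma> \<eta>) = cinner (B \<phi>) (\<eta> \<phi>)" if "\<phi> \<in> spectrum" "\<eta> \<in> C0H" for \<phi> \<eta>
    using ad[OF that(2,1), of "u \<phi>"] u[OF that(1)] by (simp add: B_def)
  have "\<beta> a \<phi> = \<phi> a *\<^sub>C B \<phi>" if \<phi>: "\<phi> \<in> spectrum" for a \<phi>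
  proof (rule cinner_eqI)
    fix w :: 'h
    obtain \<eta> :: "('a \<Rightarrow> complex) \<Rightarrow> 'h" where \<eta>: "\<eta> \<in> C0H" "\<eta> \<phi> = w" using exists_C0H_value[OF \<phi>] by metis
    have "cinner (\<beta> a \<phi>) w = cinner (\<phi> a *\<^sub>C B \<phi>) w"
      using ad[OF \<eta>(1) \<phi>, of a] B[OF \<phi> \<eta>(1)] by (simp add: \<eta>(2) cinner_scaleC_left)
    then show "cinner w (\<beta> a \<phi>) = cinner w (\<phi> a *\<^sub>C B \<phi>)" by (metis cinner_commute)
  qed
  then show ?thesis using \<beta> \<gamma> B unfolding multiplier_value_def by blast
qed

lemma has_symbol_trace_term:
  assumes \<beta>: "multiplier_value \<beta> \<gamma> B" and q: "strong_family q" "\<And>\<phi>. \<phi> \<in> spectrum \<Longrightarrow> posop (q \<phi>)"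
  shows "has_symbol (multiplier_ip C0_module \<beta> (family_op q \<circ> \<beta>)) (\<lambda>\<phi>. cinner (B \<phi>) (q \<phi> (B \<phi>)))"
  unfolding has_symbol_def multiplier_ip_def adj_alg_module[OF multiplier_valueD(2)[OF \<beta>]]
proof (intro ballI allI)
  fix \<phi> :: "'a \<Rightarrow> complex" and a assume \<phi>: "\<phi> \<in> spectrum"
  have "family_op q (\<beta> a) \<in> C0H" using family_op_in[OF q(1)] multiplier_valueD(1)[OF \<beta>] by blast
  then show "\<phi> ((\<gamma> \<circ> (family_op q \<circ> \<beta>)) a) = cinner (B \<phi>) (q \<phi> (B \<phi>)) * \<phi> a"
    by (simp add: multiplier_valueD[OF \<beta>] \<phi> family_op_apply adjoint_pair_linear[OF posop_adjoint[OF q(2)[OF \<phi>]]]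
        cinner_scaleC_right mult.commute)
qed

lemma to_multiplier_C0_value:
  fixes \<xi> :: "('a::comm_cstar_algebra \<Rightarrow> complex) \<Rightarrow> 'h::complex_hilbert_space"
  assumes \<xi>: "\<xi> \<in> C0H"
  shows "multiplier_value (to_multiplier C0_module \<xi>) (\<lambda>\<eta>\<in>C0H. mip C0_module \<xi> \<eta>) \<xi>"
proof -
  have v: "to_multiplier C0_module \<xi> a = (\<lambda>\<phi>\<in>spectrum. \<phi> a *\<^sub>C \<xi> \<phi>)" for a
    by (simp add: to_multiplier_def C0_module_def)
  have "cz (\<lambda>\<phi>. \<phi> a *\<^sub>C ext0 \<xi> \<phi>)" for a using \<xi> by (intro cz_scaleC) (simp add: C0H_iff)
  then have "cz (ext0 (\<lambda>\<phi>. \<phi> a *\<^sub>C ext0 \<xi> \<phi>))" for a by (rule cz_ext0)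
  moreover have "ext0 (\<lambda>\<phi>. \<phi> a *\<^sub>C ext0 \<xi> \<phi>) = ext0 (\<lambda>\<phi>. \<phi> a *\<^sub>C \<xi> \<phi>)" for a by (rule ext0_cong) simp
  ultimately have mem: "to_multiplier C0_module \<xi> a \<in> C0H" for a by (simp add: v restrict_in_C0H)
  have "is_adjoint alg_module C0_module (to_multiplier C0_module \<xi>) (\<lambda>\<eta>\<in>C0H. mip C0_module \<xi> \<eta>)"
    by (subst is_adjoint_alg_C0_iff[OF mem]) (simp_all add: v mip_C0_module[OF \<xi>] cinner_scaleC_left)
  then show ?thesis using mem by (simp add: multiplier_value_def v mip_C0_module[OF \<xi>])
qed

lemma has_symbol_frame_term:
  fixes \<beta> :: "'a::comm_cstar_algebra \<Rightarrow> (('a \<Rightarrow> complex) \<Rightarrow> 'h::complex_hilbert_space)"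
  assumes \<beta>: "multiplier_value \<beta> \<gamma> B" and \<xi>: "\<xi> \<in> C0H" and \<eta>: "\<eta> \<in> C0H"
  shows "has_symbol (multiplier_ip C0_module (to_multiplier C0_module \<xi>) \<beta> \<circ> multiplier_ip C0_module \<beta> (to_multiplier C0_module \<eta>))
     (\<lambda>\<phi>. cinner (\<xi> \<phi>) (B \<phi>) * cinner (B \<phi>) (\<eta> \<phi>))"
  unfolding has_symbol_def multiplier_ip_def adj_alg_module[OF multiplier_valueD(2)[OF \<beta>]]
    adj_alg_module[OF multiplier_valueD(2)[OF to_multiplier_C0_value[OF \<xi>]]]
proof (intro ballI allI)
  fix \<phi> :: "'a \<Rightarrow> complex" and a assume \<phi>: "\<phi> \<in> spectrum"
  note tv = multiplier_valueD[OF to_multiplier_C0_value[OF \<eta>]]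
  show "\<phi> ((((\<lambda>\<eta>\<in>C0H. mip C0_module \<xi> \<eta>) \<circ> \<beta>) \<circ> (\<gamma> \<circ> to_multiplier C0_module \<eta>)) a) =
       cinner (\<xi> \<phi>) (B \<phi>) * cinner (B \<phi>) (\<eta> \<phi>) * \<phi> a"
    by (simp add: multiplier_valueD[OF \<beta>] \<phi> mip_C0_module[OF \<xi>] tv(1,3) cinner_scaleC_right)
qed

text \<open>The constant function v: it need not vanish at infinity, but it is a multiplier of the
  module.\<close>

definition const_multiplier :: "'h::complex_hilbert_space \<Rightarrow> 'a::comm_cstar_algebra \<Rightarrow> (('a \<Rightarrow> complex) \<Rightarrow> 'h)" where
  "const_multiplier v a = (\<lambda>\<phi>\<in>spectrum. \<phi> a *\<^sub>C v)"

lemma const_multiplier_value: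
  fixes v :: "'h::complex_hilbert_space"
  shows "\<exists>\<gamma>. multiplier_value (const_multiplier v :: 'a::comm_cstar_algebra \<Rightarrow> _) \<gamma> (\<lambda>\<phi>. v)"
proof -
  have mem: "const_multiplier v a \<in> C0H" for a :: 'a
    by (simp add: const_multiplier_def restrict_in_C0H cz_ext0 cz_scaleC_const)
  define \<gamma> where "\<gamma> = (\<lambda>\<eta>\<in>C0H. THE a::'a. \<forall>\<phi>\<in>spectrum. \<phi> a = cinner v (\<eta> \<phi>))"
  have \<gamma>: "\<phi> (\<gamma> \<eta>) = cinner v (\<eta> \<phi>)" if \<eta>: "\<eta> \<in> C0H" and \<phi>: "\<phi> \<in> spectrum" for \<phi> \<eta>
  proof -
    have "cz (\<lambda>\<phi>. cinner v (ext0 \<eta> \<phi>))" using \<eta> by (intro cz_cinner_const) (simp add: C0H_iff)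
    then have "cz (ext0 (\<lambda>\<phi>. cinner v (ext0 \<eta> \<phi>)))" by (rule cz_ext0)
    moreover have "ext0 (\<lambda>\<phi>. cinner v (ext0 \<eta> \<phi>)) = ext0 (\<lambda>\<phi>. cinner v (\<eta> \<phi>))" by (rule ext0_cong) simp
    ultimately have "\<exists>!a. \<forall>\<phi>\<in>spectrum. \<phi> a = cinner v (\<eta> \<phi>)" by (intro gelfand_cz) simp
    from theI'[OF this] show ?thesis using \<eta> \<phi> by (simp add: \<gamma>_def)
  qed
  have "is_adjoint alg_module C0_module (const_multiplier v) \<gamma>"
    by (subst is_adjoint_alg_C0_iff[OF mem])
      (simp_all add: \<gamma>, simp_all add: \<gamma>_def const_multiplier_def cinner_scaleC_left)
  then show ?thesis using mem \<gamma> by (auto simp: multiplier_value_def const_multiplier_def)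
qed

lemma const_multiplier_in:
  fixes v :: "'h::complex_hilbert_space"
  shows "const_multiplier v \<in> multipliers (C0_module :: (('a::comm_cstar_algebra \<Rightarrow> complex) \<Rightarrow> 'h, 'a) hmodule)"
proof -
  obtain \<gamma> where "multiplier_value (const_multiplier v :: 'a \<Rightarrow> ('a \<Rightarrow> complex) \<Rightarrow> 'h) \<gamma> (\<lambda>\<phi>. v)"
    using const_multiplier_value by blast
  from multiplier_valueD(1,2)[OF this] show ?thesis
    by (auto simp: multipliers_def adjointable_def alg_module_def)
qed

text \<open>The remainder of the expansion of \<open>cinner u w\<close> is a positive semidefinite form, so that its values
  are controlled by the diagonal ones.\<close>

lemma parseval_remainder_le:
  assumes e: "parseval e"
  shows "cmod ((\<Sum>i<n. cinner u (e i) * cinner (e i) w) - cinner u w)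
    \<le> ((norm u)\<^sup>2 - (\<Sum>i<n. (cmod (cinner (e i) u))\<^sup>2)) + ((norm w)\<^sup>2 - (\<Sum>i<n. (cmod (cinner (e i) w))\<^sup>2))"
proof -
  define Q where "Q x y = cinner x y - (\<Sum>i<n. cinner x (e i) * cinner (e i) y)" for x y
  have Qadd: "Q (x + y) z = Q x z + Q y z" "Q z (x + y) = Q z x + Q z y" for x y z
    by (simp_all add: Q_def cinner_add_left cinner_add_right algebra_simps sum.distrib)
  have Qsc: "Q (c *\<^sub>C x) y = cnj c * Q x y" "Q x (c *\<^sub>C y) = c * Q x y" for c x y
    by (simp_all add: Q_def cinner_scaleC_left cinner_scaleC_right algebra_simps sum_distrib_left)
  have Qcom: "Q y x = cnj (Q x y)" for x y
  proof -
    have "cinner y x = cnj (cinner x y)" "cinner y (e i) = cnj (cinner (e i) y)" "cinner (e i) x = cnj (cinner x (e i))" for i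
      by (rule cinner_commute)+
    then show ?thesis by (simp add: Q_def mult.commute)
  qed
  have Qdiag: "Re (Q x x) = (norm x)\<^sup>2 - (\<Sum>i<n. (cmod (cinner (e i) x))\<^sup>2)" for x
  proof -
    have "cinner x (e i) * cinner (e i) x = of_real ((cmod (cinner (e i) x))\<^sup>2)" for i
      by (subst cinner_commute) (simp only: complex_norm_square mult.commute)
    then show ?thesis by (simp add: Q_def Re_cinner_self)
  qed
  have Qnn: "0 \<le> Re (Q x x)" for x
  proof -
    have "(\<lambda>i. (cmod (cinner (e i) x))\<^sup>2) sums (norm x)\<^sup>2" using e by (simp add: parseval_def)
    then have "(\<Sum>i<n. (cmod (cinner (e i) x))\<^sup>2) \<le> (norm x)\<^sup>2"
      using sum_le_suminf[of "\<lambda>i. (cmod (cinner (e i) x))\<^sup>2" "{..<n}"] by (simp add: sums_iff)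
    then show ?thesis by (simp add: Qdiag)
  qed
  have "cmod (Q u w) \<le> Re (Q u u) + Re (Q w w)"
  proof (cases "Q u w = 0")
    case False
    \<comment> \<open>The scalar of modulus 1 that turns the cross terms of Q at u + c w into - 2 |Q
      u w|.\<close>
    define c where "c = - (cnj (Q u w) / of_real (cmod (Q u w)))"
    have "c * Q u w = - of_real (cmod (Q u w))"
      using False by (simp add: c_def field_simps complex_norm_square[symmetric] power2_eq_square)
    moreover have "cnj c * c = 1"
      using False by (simp add: c_def mult.commute complex_norm_square[symmetric] power2_eq_square)
    moreover have "cnj c * Q w u = cnj (c * Q u w)" by (simp add: Qcom[of w u])
    moreover have "Q (u + c *\<^sub>C w) (u + c *\<^sub>C w) = Q u u + c * Q u w + cnj c * Q w u + (cnj c * c) * Q w w"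
      by (simp add: Qadd Qsc algebra_simps)
    ultimately have "Q (u + c *\<^sub>C w) (u + c *\<^sub>C w) = Q u u + Q w w - 2 * of_real (cmod (Q u w))"
      by simp
    then have "0 \<le> Re (Q u u) + Re (Q w w) - 2 * cmod (Q u w)"
      using Qnn[of "u + c *\<^sub>C w"] by simp
    then show ?thesis using norm_ge_zero[of "Q u w"] by linarith
  qed (use Qnn in simp)
  moreover have "cmod ((\<Sum>i<n. cinner u (e i) * cinner (e i) w) - cinner u w) = cmod (Q u w)"
    by (simp add: Q_def norm_minus_commute)
  ultimately show ?thesis by (simp add: Qdiag)
qed

text \<open>Dini's theorem makes the diagonal remainders of \<xi> and \<eta> uniformly small, and
  \<open>parseval_remainder_le\<close> transfers this to the mixed ones.\<close>

lemma frame_const_multiplier: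
  fixes e :: "nat \<Rightarrow> 'h::complex_hilbert_space"
  assumes e: "parseval e"
  shows "frame_of_multipliers (C0_module :: (('a::comm_cstar_algebra \<Rightarrow> complex) \<Rightarrow> 'h, 'a) hmodule) (\<lambda>i. const_multiplier (e i))"
  unfolding frame_of_multipliers_def mcarrier_C0_module
proof (intro conjI allI ballI)
  show "const_multiplier (e i) \<in> multipliers (C0_module :: (('a \<Rightarrow> complex) \<Rightarrow> 'h, 'a) hmodule)" for i
    by (rule const_multiplier_in)
  fix \<xi> \<eta> :: "('a \<Rightarrow> complex) \<Rightarrow> 'h" assume \<xi>: "\<xi> \<in> C0H" and \<eta>: "\<eta> \<in> C0H"
  have "\<forall>i. \<exists>\<gamma>. multiplier_value (const_multiplier (e i) :: 'a \<Rightarrow> _) \<gamma> (\<lambda>\<phi>. e i)"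
    using const_multiplier_value by blast
  then obtain \<gamma> where \<gamma>: "\<And>i. multiplier_value (const_multiplier (e i) :: 'a \<Rightarrow> _) (\<gamma> i) (\<lambda>\<phi>. e i)" by metis
  let ?f = "\<lambda>\<zeta> n \<phi>. (norm (ext0 \<zeta> \<phi> :: 'h))\<^sup>2 - (\<Sum>i<n. (cmod (cinner (e i) (ext0 \<zeta> \<phi>)))\<^sup>2)"
  have rem: "\<exists>N. \<forall>n\<ge>N. \<forall>\<phi>\<in>spectrum0. ?f \<zeta> n \<phi> < r" if \<zeta>: "\<zeta> \<in> C0H" and r: "r > 0" for r :: real and \<zeta> :: "('a \<Rightarrow> complex) \<Rightarrow> 'h"
  proof (rule dini[OF compact_spectrum0 _ _ _ r])
    have "continuous_on spectrum0 (ext0 \<zeta>)" using \<zeta> by (simp add: C0H_iff cz_def)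
    then show "continuous_on spectrum0 (?f \<zeta> n)" for n
      by (intro continuous_intros cinner.continuous_on)
    show "?f \<zeta> (Suc n) \<phi> \<le> ?f \<zeta> n \<phi>" for n \<phi> by simp
    show "(\<lambda>n. ?f \<zeta> n \<phi>) \<longlonglongrightarrow> 0" for \<phi>
    proof -
      have "(\<lambda>n. \<Sum>i<n. (cmod (cinner (e i) (ext0 \<zeta> \<phi>)))\<^sup>2) \<longlonglongrightarrow> (norm (ext0 \<zeta> \<phi>))\<^sup>2"
        using e by (simp add: parseval_def sums_def)
      from tendsto_diff[OF tendsto_const[of "(norm (ext0 \<zeta> \<phi>))\<^sup>2"] this] show ?thesis by simp
    qed
  qed
  show "multiplier_sums (\<lambda>i. multiplier_ip C0_module (to_multiplier C0_module \<xi>) (const_multiplier (e i)) \<circ>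
      multiplier_ip C0_module (const_multiplier (e i)) (to_multiplier C0_module \<eta>)) (mip C0_module \<xi> \<eta>)"
  proof (rule multiplier_sums_uniform[OF has_symbol_frame_term[OF \<gamma> \<xi> \<eta>]])
    fix r :: real assume r: "r > 0"
    obtain N1 where N1: "\<forall>n\<ge>N1. \<forall>\<phi>\<in>spectrum0. ?f \<xi> n \<phi> < r / 2" using rem[OF \<xi>, of "r / 2"] r by auto
    obtain N2 where N2: "\<forall>n\<ge>N2. \<forall>\<phi>\<in>spectrum0. ?f \<eta> n \<phi> < r / 2" using rem[OF \<eta>, of "r / 2"] r by auto
    have "cmod ((\<Sum>i<n. cinner (\<xi> \<phi>) (e i) * cinner (e i) (\<eta> \<phi>)) - \<phi> (mip C0_module \<xi> \<eta>)) \<le> r"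
      if n: "n \<ge> max N1 N2" and \<phi>: "\<phi> \<in> spectrum" for n \<phi>
    proof -
      have "?f \<xi> n \<phi> < r / 2" "?f \<eta> n \<phi> < r / 2" using N1 N2 n \<phi> by auto
      then show ?thesis
        using parseval_remainder_le[OF e, where n = n and u = "\<xi> \<phi>" and w = "\<eta> \<phi>"] \<phi>
        by (simp add: mip_C0_module[OF \<xi> \<eta>])
    qed
    then show "\<exists>N. \<forall>n\<ge>N. \<forall>\<phi>\<in>spectrum. cmod ((\<Sum>i<n. cinner (\<xi> \<phi>) (e i) * cinner (e i) (\<eta> \<phi>)) - \<phi> (mip C0_module \<xi> \<eta>)) \<le> r"
      by blast
  qed
qed

text \<open>For a section with value v at \<phi>, the frame identity read at \<phi> is the expansion
  of |v|^2.\<close>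

lemma frame_parseval:
  fixes \<beta> :: "nat \<Rightarrow> 'a::comm_cstar_algebra \<Rightarrow> (('a \<Rightarrow> complex) \<Rightarrow> 'h::complex_hilbert_space)"
  assumes f: "frame_of_multipliers C0_module \<beta>" and B: "\<And>i. multiplier_value (\<beta> i) (\<gamma> i) (B i)" and \<phi>: "\<phi> \<in> spectrum"
  shows "parseval (\<lambda>i. B i \<phi>)"
  unfolding parseval_def
proof
  fix v :: 'h
  obtain \<xi> :: "('a \<Rightarrow> complex) \<Rightarrow> 'h" where \<xi>: "\<xi> \<in> C0H" "\<xi> \<phi> = v" using exists_C0H_value[OF \<phi>] by metis
  have "(\<lambda>i. cinner (\<xi> \<phi>) (B i \<phi>) * cinner (B i \<phi>) (\<xi> \<phi>)) sums \<phi> (mip C0_module \<xi> \<xi>)"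
    by (rule multiplier_sums_pointwise[OF has_symbol_frame_term[OF B \<xi>(1) \<xi>(1)] _ \<phi>])
      (use f \<xi> in \<open>simp add: frame_of_multipliers_def\<close>)
  then have "(\<lambda>i. Re (cinner v (B i \<phi>) * cinner (B i \<phi>) v)) sums Re (cinner v v)"
    unfolding \<xi>(2) mip_C0_module[OF \<xi>(1) \<xi>(1) \<phi>] by (rule sums_Re)
  moreover have "Re (cinner v (B i \<phi>) * cinner (B i \<phi>) v) = (cmod (cinner (B i \<phi>) v))\<^sup>2" for i
    by (subst cinner_commute) (simp add: cmod_power2 flip: power2_eq_square)
  ultimately show "(\<lambda>i. (cmod (cinner (B i \<phi>) v))\<^sup>2) sums (norm v)\<^sup>2"
    by (simp add: Re_cinner_self)
qed

section \<open>Continuity of the trace norm\<close>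

text \<open>The i-th term in the expansion of \<open>e i\<close> itself gives |e i|^4 \<le> |e
  i|^2.\<close>

lemma parseval_norm_le: 
  assumes "parseval e" shows "norm (e i) \<le> 1"
proof -
  have s: "(\<lambda>j. (cmod (cinner (e j) (e i)))\<^sup>2) sums (norm (e i))\<^sup>2" using assms by (simp add: parseval_def)
  have "(\<Sum>j\<in>{i}. (cmod (cinner (e j) (e i)))\<^sup>2) \<le> (\<Sum>j. (cmod (cinner (e j) (e i)))\<^sup>2)"
    using s by (intro sum_le_suminf) (auto simp: sums_iff)
  then have "((norm (e i))\<^sup>2)\<^sup>2 \<le> (norm (e i))\<^sup>2"
    using s by (simp add: sums_iff cinner_self norm_power)
  moreover have "x \<le> 1" if "x\<^sup>2 \<le> x" for x :: real
  proof (rule ccontr)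
    assume "\<not> x \<le> 1"
    then have "x * 1 < x * x" by (intro mult_strict_left_mono) auto
    then show False using that by (simp add: power2_eq_square)
  qed
  ultimately have "(norm (e i))\<^sup>2 \<le> 1\<^sup>2" by simp
  then show ?thesis by (rule power2_le_imp_le) simp
qed

text \<open>For each contraction W the sum is cut at n: the head is bounded term by term, the tail
  by \<open>sum_cinner_abs_le\<close> for T and T' separately. When T tends to T' strongly and the
  traces converge too, the head tends to 0 and the tail of T to that of T'.\<close>

lemma trace_norm_diff_le:
  fixes T T' :: "'h::complex_hilbert_space \<Rightarrow> 'h" and e :: "nat \<Rightarrow> 'h"
  assumes e: "basis_enum e" and T: "abs_of T S p" "T \<in> L1" and T': "abs_of T' S' p'" "T' \<in> L1"
  shows "trace_norm (\<lambda>v. T v - T' v) \<le> (\<Sum>i<n. norm (T (e i) - T' (e i)))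
     + sqrt (trace_norm T) * sqrt (trace_norm T - (\<Sum>i<n. Re (cinner (e i) (p (e i)))))
     + sqrt (trace_norm T') * sqrt (trace_norm T' - (\<Sum>i<n. Re (cinner (e i) (p' (e i)))))"
proof -
  obtain q where q: "abs_of (\<lambda>v. T v - T' v) (\<lambda>v. S v - S' v) q" using abs_of_diff[OF T(1) T'(1)] by metis
  have tri: "cmod (cinner w (T v - T' v)) \<le> cmod (cinner w (T v)) + cmod (cinner w (T' v))" for w v
    by (simp add: cinner.diff_right norm_triangle_ineq4)
  have D: "(\<lambda>v. T v - T' v) \<in> L1" by (rule trace_norm_triangle(1)[OF e T T' q tri])
  have s: "(\<lambda>i. Re (cinner (e i) (q (e i)))) sums trace_norm (\<lambda>v. T v - T' v)"
    by (rule abs_of_sums_trace_norm[OF e q D])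
  have split: "(\<Sum>i<n. f i) + (\<Sum>i\<in>{n..<N}. f i) = (\<Sum>i<N. f i)" if "n \<le> N" for f :: "nat \<Rightarrow> real" and N
    using sum.atLeastLessThan_concat[of 0 n N f] that by (simp add: atLeast0LessThan)
  have part: "(\<Sum>i\<in>{n..<N}. cmod (cinner (W (e i)) (R (e i))))
      \<le> sqrt (trace_norm R) * sqrt (trace_norm R - (\<Sum>i<n. Re (cinner (e i) (r (e i)))))"
    if R: "abs_of R R' r" "R \<in> L1" and W: "adjoint_pair W W'" "op_le W 1" and N: "n \<le> N" for R R' r W W' N
  proof -
    note rs = abs_of_sums_trace_norm[OF e R]
    note nn = posop_nonneg[OF abs_ofD(2)[OF R(1)]]
    have t0: "0 \<le> trace_norm R" using nn by (intro sums_le[OF _ sums_zero rs])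
    have "(\<Sum>i<n. Re (cinner (e i) (r (e i)))) + (\<Sum>i\<in>{n..<N}. Re (cinner (e i) (r (e i)))) = (\<Sum>i<N. Re (cinner (e i) (r (e i))))"
      by (rule split[OF N])
    also have "\<dots> \<le> trace_norm R"
      using sum_le_suminf[of "\<lambda>i. Re (cinner (e i) (r (e i)))" "{..<N}"] rs nn by (simp add: sums_iff)
    finally have "(\<Sum>i\<in>{n..<N}. Re (cinner (e i) (r (e i)))) \<le> trace_norm R - (\<Sum>i<n. Re (cinner (e i) (r (e i))))"
      by simp
    then have "sqrt (trace_norm R) * sqrt (\<Sum>i\<in>{n..<N}. Re (cinner (e i) (r (e i))))
       \<le> sqrt (trace_norm R) * sqrt (trace_norm R - (\<Sum>i<n. Re (cinner (e i) (r (e i)))))"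
      using t0 by (intro mult_left_mono) auto
    then show ?thesis
      using sum_cinner_abs_le[OF R(1) basis_enum_parseval[OF e] rs W, of "{n..<N}"] by simp
  qed
  have "(\<Sum>i<N. Re (cinner (e i) (q (e i)))) \<le> (\<Sum>i<n. norm (T (e i) - T' (e i)))
     + sqrt (trace_norm T) * sqrt (trace_norm T - (\<Sum>i<n. Re (cinner (e i) (p (e i)))))
     + sqrt (trace_norm T') * sqrt (trace_norm T' - (\<Sum>i<n. Re (cinner (e i) (p' (e i)))))" if N: "N \<ge> n" for N
  proof (rule sum_abs_le[OF q])
    fix W W' :: "'h \<Rightarrow> 'h" assume W: "adjoint_pair W W'" "op_le W 1"
    have "(\<Sum>i<N. cmod (cinner (W (e i)) (T (e i) - T' (e i))))
      = (\<Sum>i<n. cmod (cinner (W (e i)) (T (e i) - T' (e i)))) + (\<Sum>i\<in>{n..<N}. cmod (cinner (W (e i)) (T (e i) - T' (e i))))"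
      by (rule split[OF N, symmetric])
    also have "\<dots> \<le> (\<Sum>i<n. norm (T (e i) - T' (e i)))
        + (\<Sum>i\<in>{n..<N}. cmod (cinner (W (e i)) (T (e i))) + cmod (cinner (W (e i)) (T' (e i))))"
    proof (intro add_mono sum_mono tri)
      fix i
      have "norm (W (e i)) \<le> 1"
        using op_leD[OF W(2), of "e i"] parseval_norm_le[OF basis_enum_parseval[OF e], of i] by simp
      then have "norm (W (e i)) * norm (T (e i) - T' (e i)) \<le> 1 * norm (T (e i) - T' (e i))"
        by (intro mult_right_mono) auto
      then show "cmod (cinner (W (e i)) (T (e i) - T' (e i))) \<le> norm (T (e i) - T' (e i))"
        using norm_cinner_le[of "W (e i)" "T (e i) - T' (e i)"] by simp
    qed
    also have "\<dots> = (\<Sum>i<n. norm (T (e i) - T' (e i)))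
        + ((\<Sum>i\<in>{n..<N}. cmod (cinner (W (e i)) (T (e i)))) + (\<Sum>i\<in>{n..<N}. cmod (cinner (W (e i)) (T' (e i)))))"
      by (simp add: sum.distrib)
    finally show "(\<Sum>i<N. cmod (cinner (W (e i)) (T (e i) - T' (e i)))) \<le> (\<Sum>i<n. norm (T (e i) - T' (e i)))
     + sqrt (trace_norm T) * sqrt (trace_norm T - (\<Sum>i<n. Re (cinner (e i) (p (e i)))))
     + sqrt (trace_norm T') * sqrt (trace_norm T' - (\<Sum>i<n. Re (cinner (e i) (p' (e i)))))"
      using part[OF T W N] part[OF T' W N] by linarith
  qed
  then show ?thesis
    using s unfolding sums_def by (intro LIMSEQ_le_const2[of _ "trace_norm (\<lambda>v. T v - T' v)"]) auto
qed

lemma abs_trace_norm_diff_le: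
  fixes T T' :: "'h::complex_hilbert_space \<Rightarrow> 'h" and e :: "nat \<Rightarrow> 'h"
  assumes e: "basis_enum e" and T: "abs_of T S p" "T \<in> L1" and T': "abs_of T' S' p'" "T' \<in> L1"
  shows "\<bar>trace_norm T - trace_norm T'\<bar> \<le> trace_norm (\<lambda>v. T v - T' v)"
proof -
  obtain q where q: "abs_of (\<lambda>v. T v - T' v) (\<lambda>v. S v - S' v) q" using abs_of_diff[OF T(1) T'(1)] by metis
  have D: "(\<lambda>v. T v - T' v) \<in> L1"
    by (rule trace_norm_triangle(1)[OF e T T' q]) (simp add: cinner.diff_right norm_triangle_ineq4)
  have "trace_norm T \<le> trace_norm (\<lambda>v. T v - T' v) + trace_norm T'"
  proof (rule trace_norm_triangle(2)[OF e q D T' T(1)])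
    show "cmod (cinner w (T v)) \<le> cmod (cinner w (T v - T' v)) + cmod (cinner w (T' v))" for w v
      using norm_triangle_ineq[of "cinner w (T v - T' v)" "cinner w (T' v)"] by (simp add: cinner.diff_right)
  qed
  moreover have "trace_norm T' \<le> trace_norm (\<lambda>v. T v - T' v) + trace_norm T"
  proof (rule trace_norm_triangle(2)[OF e q D T T'(1)])
    show "cmod (cinner w (T' v)) \<le> cmod (cinner w (T v - T' v)) + cmod (cinner w (T v))" for w v
      using norm_triangle_ineq4[of "cinner w (T v)" "cinner w (T v - T' v)"] by (simp add: cinner.diff_right)
  qed
  ultimately show ?thesis by simp
qed

lemma trace_norm_nonneg:
  fixes T :: "'h::complex_hilbert_space \<Rightarrow> 'h" and e :: "nat \<Rightarrow> 'h"
  assumes e: "basis_enum e" and T: "abs_of T S p" "T \<in> L1"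
  shows "0 \<le> trace_norm T"
  using posop_nonneg[OF abs_ofD(2)[OF T(1)]] by (intro sums_le[OF _ sums_zero abs_of_sums_trace_norm[OF e T]])

theorem theorem3p1:
  fixes t :: "(('a::comm_cstar_algebra \<Rightarrow> complex) \<Rightarrow> 'h::complex_hilbert_space) \<Rightarrow>
              (('a \<Rightarrow> complex) \<Rightarrow> 'h)"
  assumes "separable_space (euclidean :: 'h topology)"
    and "t \<in> adjointable C0_module C0_module"
  shows "t \<in> trace_class_ops C0_module \<longleftrightarrow>
         (\<lambda>x\<in>spectrum. localise t x) \<in> C0 spectrum L1 trace_norm"
proof -
  obtain s where ts: "C0_adjoint t s" using assms(2) unfolding adjointable_C0_module by blast
  obtain q where q: "strong_family q" "abs_op C0_module t = family_op q"
    and qa: "\<And>\<phi>. \<phi> \<in> spectrum \<Longrightarrow> abs_of (fibre t \<phi>) (fibre s \<phi>) (q \<phi>)"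
    using abs_op_C0_module[OF ts] by metis
  have qp: "posop (q \<phi>)" if "\<phi> \<in> spectrum" for \<phi> using abs_ofD(2)[OF qa[OF that]] .
  obtain e :: "nat \<Rightarrow> 'h" where e: "basis_enum e" using exists_basis_enum[OF assms(1)] by metis
  note pe = basis_enum_parseval[OF e]
  define \<tau> where "\<tau> \<phi> = trace_norm (fibre t \<phi>)" for \<phi>
  define g where "g n \<phi> = (\<Sum>i<n. Re (cinner (e i) (q \<phi> (e i))))" for n \<phi>
  have loc: "(\<lambda>x\<in>spectrum. localise t x) = (\<lambda>x\<in>spectrum. fibre t x)"
    by (intro restrict_ext localise_eq[OF ts])
  have gc: "continuous_on spectrum (g n)" for n
    unfolding g_def
    by (intro continuous_intros cinner.continuous_on strong_family_continuous[OF q(1) posop_adjoint[OF qp]])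
  show ?thesis
  proof
    assume "t \<in> trace_class_ops C0_module"
    then obtain b where "has_trace C0_module (family_op q) b" by (auto simp: trace_class_ops_def q(2))
    then obtain \<beta> where \<beta>: "frame_of_multipliers C0_module \<beta>"
      and sum: "multiplier_sums (\<lambda>i. multiplier_ip C0_module (\<beta> i) (family_op q \<circ> \<beta> i)) b"
      unfolding has_trace_def by blast
    have "\<forall>i. \<exists>\<gamma> B. multiplier_value (\<beta> i) \<gamma> B"
      using \<beta> exists_multiplier_value by (auto simp: frame_of_multipliers_def)
    then obtain \<gamma> B where B: "\<And>i. multiplier_value (\<beta> i) (\<gamma> i) (B i)" by metis
    \<comment> \<open>The frame that defines the trace is arbitrary; its localisation at \<phi> is
      exchanged for the fixed basis.\<close>
    have sb: "(\<lambda>i. Re (cinner (e i) (q \<phi> (e i)))) sums Re (\<phi> b)" if \<phi>: "\<phi> \<in> spectrum" for \<phi>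
    proof (rule parseval_trace_sums[OF pe frame_parseval[OF \<beta> B \<phi>] qp[OF \<phi>]])
      show "(\<lambda>i. Re (cinner (B i \<phi>) (q \<phi> (B i \<phi>)))) sums Re (\<phi> b)"
        by (rule sums_Re[OF multiplier_sums_pointwise[OF has_symbol_trace_term[OF B q(1) qp] sum \<phi>]])
    qed
    have L: "fibre t \<phi> \<in> L1" if "\<phi> \<in> spectrum" for \<phi>
      using basis_enum_trace(1)[OF e qa[OF that]] sums_summable[OF sb[OF that]] by simp
    have \<tau>b: "\<tau> \<phi> = Re (\<phi> b)" if "\<phi> \<in> spectrum" for \<phi>
      unfolding \<tau>_def by (rule basis_enum_trace(2)[OF e qa[OF that] sb[OF that]])
    have \<tau>0: "0 \<le> \<tau> \<phi>" if "\<phi> \<in> spectrum" for \<phi>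
      unfolding \<tau>_def by (rule trace_norm_nonneg[OF e qa[OF that] L[OF that]])
    have \<tau>c: "cz (ext0 \<tau>)"
    proof -
      have "cz (\<lambda>\<phi>. Re (\<phi> b))" by (auto simp: cz_def intro!: continuous_intros continuous_on_eval)
      then have "cz (ext0 (\<lambda>\<phi>. Re (\<phi> b)))" by (rule cz_ext0)
      moreover have "ext0 (\<lambda>\<phi>. Re (\<phi> b)) = ext0 \<tau>" by (rule ext0_cong) (simp add: \<tau>b)
      ultimately show ?thesis by simp
    qed
    then have \<tau>cont: "\<forall>x\<in>spectrum. ((\<lambda>y. norm (\<tau> y - \<tau> x)) \<longlongrightarrow> 0) (at x within spectrum)"
      and \<tau>van: "\<forall>r>0. \<exists>K. K \<subseteq> spectrum \<and> compact K \<and> (\<forall>x\<in>spectrum - K. norm (\<tau> x) < r)"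
      unfolding cz_def continuous_on_ext0_iff by blast+
    have main: "((\<lambda>y. trace_norm (\<lambda>v. fibre t y v - fibre t x v)) \<longlongrightarrow> 0) (at x within spectrum)"
      if x: "x \<in> spectrum" for x
    proof (rule tendstoI)
      fix r :: real assume r: "r > 0"
      \<comment> \<open>The index n is chosen at x alone. The factor 2 accounts for the tail at y,
        which tends to the tail at x.\<close>
      have "(\<lambda>n. 2 * (sqrt (\<tau> x) * sqrt (\<tau> x - g n x))) \<longlonglongrightarrow> 2 * (sqrt (\<tau> x) * sqrt (\<tau> x - \<tau> x))"
        using sb[OF x] unfolding g_def \<tau>b[OF x] sums_def by (intro tendsto_intros)
      then have "\<forall>\<^sub>F n in sequentially. 2 * (sqrt (\<tau> x) * sqrt (\<tau> x - g n x)) < r"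
        using r by (intro order_tendstoD(2)) auto
      then obtain n where n: "2 * (sqrt (\<tau> x) * sqrt (\<tau> x - g n x)) < r" by (auto simp: eventually_sequentially)
      let ?h = "\<lambda>y. (\<Sum>i<n. norm (fibre t y (e i) - fibre t x (e i)))
         + sqrt (\<tau> y) * sqrt (\<tau> y - g n y) + sqrt (\<tau> x) * sqrt (\<tau> x - g n x)"
      have ft: "((\<lambda>y. fibre t y v) \<longlongrightarrow> fibre t x v) (at x within spectrum)" for v
        using strong_family_continuous[OF strong_family_fibre[OF ts] fibre_adjoint[OF ts], of v] x
        by (simp add: continuous_on_def)
      have gt: "(g n \<longlongrightarrow> g n x) (at x within spectrum)" using gc x by (simp add: continuous_on_def)
      have \<tau>t: "(\<tau> \<longlongrightarrow> \<tau> x) (at x within spectrum)"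
        by (rule LIM_zero_cancel[OF tendsto_norm_zero_cancel[OF bspec[OF \<tau>cont x]]])
      have "(?h \<longlongrightarrow> (\<Sum>i<n. norm (fibre t x (e i) - fibre t x (e i)))
         + sqrt (\<tau> x) * sqrt (\<tau> x - g n x) + sqrt (\<tau> x) * sqrt (\<tau> x - g n x)) (at x within spectrum)"
        by (intro tendsto_intros ft gt \<tau>t)
      then have "\<forall>\<^sub>F y in at x within spectrum. ?h y < r"
        using n by (intro order_tendstoD(2)) auto
      moreover have "\<forall>\<^sub>F y in at x within spectrum. y \<in> spectrum" by (simp add: eventually_at_filter)
      ultimately show "\<forall>\<^sub>F y in at x within spectrum. dist (trace_norm (\<lambda>v. fibre t y v - fibre t x v)) 0 < r"
      proof eventually_elim
        case (elim y)
        obtain p where p: "abs_of (\<lambda>v. fibre t y v - fibre t x v) (\<lambda>v. fibre s y v - fibre s x v) p"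
          using abs_of_diff[OF qa[OF elim(2)] qa[OF x]] by metis
        have "(\<lambda>v. fibre t y v - fibre t x v) \<in> L1"
          by (rule trace_norm_triangle(1)[OF e qa[OF elim(2)] L[OF elim(2)] qa[OF x] L[OF x] p])
            (simp add: cinner.diff_right norm_triangle_ineq4)
        then have "0 \<le> trace_norm (\<lambda>v. fibre t y v - fibre t x v)" by (rule trace_norm_nonneg[OF e p])
        moreover have "trace_norm (\<lambda>v. fibre t y v - fibre t x v) \<le> ?h y"
          unfolding \<tau>_def g_def
          by (rule trace_norm_diff_le[OF e qa[OF elim(2)] L[OF elim(2)] qa[OF x] L[OF x]])
        ultimately show ?case using elim(1) by simp
      qed
    qed
    show "(\<lambda>x\<in>spectrum. localise t x) \<in> C0 spectrum L1 trace_norm"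
      unfolding loc C0_def
    proof (intro CollectI conjI ballI allI impI)
      show "(\<lambda>x\<in>spectrum. fibre t x) \<in> spectrum \<rightarrow>\<^sub>E L1" using L by auto
      fix x :: "'a \<Rightarrow> complex" assume x: "x \<in> spectrum"
      have "\<forall>\<^sub>F y in at x within spectrum. trace_norm (\<lambda>v. fibre t y v - fibre t x v)
          = trace_norm (restrict (fibre t) spectrum y - restrict (fibre t) spectrum x)"
        using x by (simp add: eventually_at_filter fun_diff_def)
      then show "((\<lambda>y. trace_norm (restrict (fibre t) spectrum y - restrict (fibre t) spectrum x)) \<longlongrightarrow> 0) (at x within spectrum)"
        by (rule Lim_transform_eventually[OF main[OF x]])
    next
      fix r :: real assume "r > 0"
      then obtain K where K: "K \<subseteq> spectrum" "compact K" "\<forall>x\<in>spectrum - K. norm (\<tau> x) < r" using \<tau>van by blast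
      have "trace_norm (restrict (fibre t) spectrum x) < r" if "x \<in> spectrum - K" for x
        using K(3) that abs_ge_self[of "\<tau> x"] by (force simp: \<tau>_def)
      then show "\<exists>K\<subseteq>spectrum. compact K \<and> (\<forall>x\<in>spectrum - K. trace_norm (restrict (fibre t) spectrum x) < r)"
        using K by blast
    qed
  next
    assume "(\<lambda>x\<in>spectrum. localise t x) \<in> C0 spectrum L1 trace_norm"
    then have L: "\<And>\<phi>. \<phi> \<in> spectrum \<Longrightarrow> fibre t \<phi> \<in> L1"
      and cont: "\<And>x. x \<in> spectrum \<Longrightarrow> ((\<lambda>y. trace_norm (restrict (fibre t) spectrum y - restrict (fibre t) spectrum x)) \<longlongrightarrow> 0) (at x within spectrum)"
      and van: "\<And>r. r > 0 \<Longrightarrow> \<exists>K\<subseteq>spectrum. compact K \<and> (\<forall>x\<in>spectrum - K. trace_norm (restrict (fibre t) spectrum x) < r)"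
      unfolding loc C0_def by (auto simp: PiE_iff)
    have \<tau>0: "0 \<le> \<tau> \<phi>" if "\<phi> \<in> spectrum" for \<phi>
      unfolding \<tau>_def by (rule trace_norm_nonneg[OF e qa[OF that] L[OF that]])
    have gs: "(\<lambda>n. g n \<phi>) \<longlonglongrightarrow> \<tau> \<phi>" if "\<phi> \<in> spectrum" for \<phi>
      using abs_of_sums_trace_norm[OF e qa[OF that] L[OF that]] by (simp add: sums_def g_def \<tau>_def)
    have gmono: "g n \<phi> \<le> g (Suc n) \<phi>" if "\<phi> \<in> spectrum" for n \<phi>
      using posop_nonneg[OF qp[OF that]] by (simp add: g_def)
    have g0: "0 \<le> g n \<phi>" if "\<phi> \<in> spectrum" for n \<phi>
      using posop_nonneg[OF qp[OF that]] by (simp add: g_def sum_nonneg)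
    have gle: "g n \<phi> \<le> \<tau> \<phi>" if "\<phi> \<in> spectrum" for n \<phi>
      using gmono[OF that] by (intro incseq_le[OF incseq_SucI gs[OF that]])
    have \<tau>lim: "((\<lambda>y. norm (\<tau> y - \<tau> x)) \<longlongrightarrow> 0) (at x within spectrum)" if x: "x \<in> spectrum" for x
    proof (rule Lim_null_comparison[OF _ cont[OF x]])
      have "\<forall>\<^sub>F y in at x within spectrum. y \<in> spectrum" by (simp add: eventually_at_filter)
      then show "\<forall>\<^sub>F y in at x within spectrum. norm (norm (\<tau> y - \<tau> x))
          \<le> trace_norm (restrict (fibre t) spectrum y - restrict (fibre t) spectrum x)"
      proof eventually_elim
        case (elim y)
        then show ?case
          using abs_trace_norm_diff_le[OF e qa[OF elim] L[OF elim] qa[OF x] L[OF x]] x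
          by (simp add: \<tau>_def fun_diff_def)
      qed
    qed
    have \<tau>van: "\<exists>K\<subseteq>spectrum. compact K \<and> (\<forall>x\<in>spectrum - K. \<tau> x < r)" if r: "r > 0" for r
    proof -
      obtain K where "K \<subseteq> spectrum" "compact K" "\<forall>x\<in>spectrum - K. trace_norm (restrict (fibre t) spectrum x) < r"
        using van[OF r] by blast
      then show ?thesis by (intro exI[of _ K]) (auto simp: \<tau>_def)
    qed
    \<comment> \<open>Since 0 \<le> \<open>g n\<close> \<le> \<tau>, the difference vanishes at
      infinity together with \<tau>. This provides the continuous functions on the compact
      \<open>spectrum0\<close> that Dini's theorem requires.\<close>
    have diffc: "cz (ext0 (\<lambda>\<phi>. \<tau> \<phi> - g n \<phi>))" for n
      unfolding cz_def continuous_on_ext0_iff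
    proof (intro conjI ballI allI impI)
      fix x :: "'a \<Rightarrow> complex" assume x: "x \<in> spectrum"
      have "(g n \<longlongrightarrow> g n x) (at x within spectrum)" using gc x by (simp add: continuous_on_def)
      moreover have "(\<tau> \<longlongrightarrow> \<tau> x) (at x within spectrum)"
        by (rule LIM_zero_cancel[OF tendsto_norm_zero_cancel[OF \<tau>lim[OF x]]])
      ultimately have "((\<lambda>y. \<tau> y - g n y) \<longlongrightarrow> \<tau> x - g n x) (at x within spectrum)" by (intro tendsto_diff)
      then show "((\<lambda>y. norm (\<tau> y - g n y - (\<tau> x - g n x))) \<longlongrightarrow> 0) (at x within spectrum)"
        by (intro tendsto_norm_zero LIM_zero)
    next
      fix r :: real assume "r > 0"
      then obtain K where K: "K \<subseteq> spectrum" "compact K" "\<forall>x\<in>spectrum - K. \<tau> x < r" using \<tau>van by blast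
      have "norm (\<tau> x - g n x) < r" if x: "x \<in> spectrum - K" for x
      proof -
        have "\<tau> x < r" using K(3) x by blast
        moreover have "g n x \<le> \<tau> x" "0 \<le> g n x" using gle g0 x by blast+
        ultimately show ?thesis by simp
      qed
      then show "\<exists>K\<subseteq>spectrum. compact K \<and> (\<forall>x\<in>spectrum - K. norm (\<tau> x - g n x) < r)" using K by blast
    qed simp
    \<comment> \<open>\<open>g 0\<close> is the empty sum, so the case n = 0 is \<tau>
      itself.\<close>
    have "cz (ext0 \<tau>)" using diffc[of 0] by (simp add: g_def)
    then have "cz (\<lambda>\<phi>. complex_of_real (ext0 \<tau> \<phi>))" by (auto simp: cz_def intro!: continuous_intros)
    then obtain b where b: "\<And>\<phi>. \<phi> \<in> spectrum \<Longrightarrow> \<phi> b = of_real (\<tau> \<phi>)"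
      using gelfand_surjective[of "\<lambda>\<phi>. complex_of_real (ext0 \<tau> \<phi>)"] unfolding cz_def by auto
    have "\<forall>i. \<exists>\<gamma>. multiplier_value (const_multiplier (e i) :: 'a \<Rightarrow> _) \<gamma> (\<lambda>\<phi>. e i)"
      using const_multiplier_value by blast
    then obtain \<gamma> where \<gamma>: "\<And>i. multiplier_value (const_multiplier (e i) :: 'a \<Rightarrow> _) (\<gamma> i) (\<lambda>\<phi>. e i)" by metis
    have "multiplier_sums (\<lambda>i. multiplier_ip C0_module (const_multiplier (e i)) (family_op q \<circ> const_multiplier (e i))) b"
    proof (rule multiplier_sums_uniform[OF has_symbol_trace_term[OF \<gamma> q(1) qp]])
      fix r :: real assume r: "r > 0"
      have "\<exists>N. \<forall>n\<ge>N. \<forall>\<phi>\<in>spectrum0. ext0 (\<lambda>\<phi>. \<tau> \<phi> - g n \<phi>) \<phi> < r"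
      proof (rule dini[OF compact_spectrum0 _ _ _ r])
        show "continuous_on spectrum0 (ext0 (\<lambda>\<phi>. \<tau> \<phi> - g n \<phi>))" for n using diffc by (simp add: cz_def)
        show "ext0 (\<lambda>\<phi>. \<tau> \<phi> - g (Suc n) \<phi>) \<phi> \<le> ext0 (\<lambda>\<phi>. \<tau> \<phi> - g n \<phi>) \<phi>" for n \<phi>
          using gmono[of \<phi> n] by (simp add: ext0_def)
        show "(\<lambda>n. ext0 (\<lambda>\<phi>. \<tau> \<phi> - g n \<phi>) \<phi>) \<longlonglongrightarrow> 0" for \<phi>
          using tendsto_diff[OF tendsto_const[of "\<tau> \<phi>"] gs[of \<phi>]] by (cases "\<phi> \<in> spectrum") (simp_all add: ext0_def)
      qed
      then obtain N where N: "\<And>n \<phi>. n \<ge> N \<Longrightarrow> \<phi> \<in> spectrum \<Longrightarrow> \<tau> \<phi> - g n \<phi> < r" by fastforce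
      have "cmod ((\<Sum>i<n. cinner (e i) (q \<phi> (e i))) - \<phi> b) \<le> r" if n: "n \<ge> N" and \<phi>: "\<phi> \<in> spectrum" for n \<phi>
      proof -
        have "(\<Sum>i<n. cinner (e i) (q \<phi> (e i))) = of_real (g n \<phi>)"
          unfolding g_def of_real_sum by (intro sum.cong refl posop_real[OF qp[OF \<phi>]])
        then have "cmod ((\<Sum>i<n. cinner (e i) (q \<phi> (e i))) - \<phi> b) = \<bar>g n \<phi> - \<tau> \<phi>\<bar>"
          by (simp add: b[OF \<phi>] flip: of_real_diff)
        then show ?thesis using N[OF n \<phi>] gle[OF \<phi>, of n] by simp
      qed
      then show "\<exists>N. \<forall>n\<ge>N. \<forall>\<phi>\<in>spectrum. cmod ((\<Sum>i<n. cinner (e i) (q \<phi> (e i))) - \<phi> b) \<le> r" by blast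
    qed
    then have "has_trace C0_module (family_op q) b"
      unfolding has_trace_def using frame_const_multiplier[OF pe] by blast
    then show "t \<in> trace_class_ops C0_module" using assms(2) by (auto simp: trace_class_ops_def q(2))
  qed
qed

end
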